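(* Let $R$ be a commutative ring such that every RD-essential extension of $R$-modules is essential. Then for every maximal ideal $P$ of $R$, the localization $R_P$ is a pure-semisimple ring.
   Context: A submodule is RD-pure if the inclusion remains injective after tensoring with every module $R/rR$, $r\in R$. An extension $A\subseteq B$ is RD-essential if $A$ is RD-pure in $B$ and for every submodule $K$ of $B$, either $K\cap A\neq0$ or $(A+K)/K$ is not RD-pure in $B/K$. A ring is pure-semisimple if every module over it is pure-injective (injective relative to exact sequences remaining exact under tensoring with every module).
   Formalization: In the definition of RD-essential, the condition is required only for every nonzero submodule K of B; with K = 0 allowed, no extension would be RD-essential and the statement would fail (e.g. for the ring of integers). *)

theory Defs
  imports "HOL-Algebra.Module" "HOL-Algebra.QuotRing"
begin

definition module_hom ::
  "('s,'c) ring_scheme \<Rightarrow> ('s,'a) module \<Rightarrow> ('s,'b) module \<Rightarrow> ('a \<Rightarrow> 'b) set" where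
  "module_hom S M N = {f. f \<in> carrier M \<rightarrow> carrier N
      \<and> (\<forall>x\<in>carrier M. \<forall>y\<in>carrier M. f (x \<oplus>\<^bsub>M\<^esub> y) = f x \<oplus>\<^bsub>N\<^esub> f y)
      \<and> (\<forall>c\<in>carrier S. \<forall>x\<in>carrier M. f (c \<odot>\<^bsub>M\<^esub> x) = c \<odot>\<^bsub>N\<^esub> f x)}"

section \<open>Tensor products, realised as free modules modulo bilinearity relations\<close>

text \<open>Elements of the free S-module on X \<times> Y: finitely supported S-valued functions
  whose support lies in X \<times> Y.\<close>
definition fsupp :: "('s,'c) ring_scheme \<Rightarrow> 'b set \<Rightarrow> 'n set \<Rightarrow> ('b \<times> 'n \<Rightarrow> 's) set" where
  "fsupp S X Y = {\<phi>. (\<forall>p. \<phi> p \<in> carrier S) \<and> finite {p. \<phi> p \<noteq> \<zero>\<^bsub>S\<^esub>}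
                      \<and> {p. \<phi> p \<noteq> \<zero>\<^bsub>S\<^esub>} \<subseteq> X \<times> Y}"

definition fdelta :: "('s,'c) ring_scheme \<Rightarrow> 'p \<Rightarrow> 'p \<Rightarrow> 's" where
  "fdelta S p = (\<lambda>q. if q = p then \<one>\<^bsub>S\<^esub> else \<zero>\<^bsub>S\<^esub>)"

definition fadd :: "('s,'c) ring_scheme \<Rightarrow> ('p \<Rightarrow> 's) \<Rightarrow> ('p \<Rightarrow> 's) \<Rightarrow> 'p \<Rightarrow> 's" where
  "fadd S \<phi> \<psi> = (\<lambda>p. \<phi> p \<oplus>\<^bsub>S\<^esub> \<psi> p)"

definition fminus :: "('s,'c) ring_scheme \<Rightarrow> ('p \<Rightarrow> 's) \<Rightarrow> ('p \<Rightarrow> 's) \<Rightarrow> 'p \<Rightarrow> 's" where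
  "fminus S \<phi> \<psi> = (\<lambda>p. \<phi> p \<ominus>\<^bsub>S\<^esub> \<psi> p)"

definition fscale :: "('s,'c) ring_scheme \<Rightarrow> 's \<Rightarrow> ('p \<Rightarrow> 's) \<Rightarrow> 'p \<Rightarrow> 's" where
  "fscale S c \<phi> = (\<lambda>p. c \<otimes>\<^bsub>S\<^esub> \<phi> p)"

inductive_set fspan :: "('s,'c) ring_scheme \<Rightarrow> ('p \<Rightarrow> 's) set \<Rightarrow> ('p \<Rightarrow> 's) set"
  for S G where
  fspan_zero: "(\<lambda>_. \<zero>\<^bsub>S\<^esub>) \<in> fspan S G"
| fspan_step: "\<lbrakk>g \<in> G; c \<in> carrier S; v \<in> fspan S G\<rbrakk> \<Longrightarrow> fadd S (fscale S c g) v \<in> fspan S G"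

definition tensor_rels ::
  "('s,'c) ring_scheme \<Rightarrow> ('s,'b) module \<Rightarrow> ('s,'n) module \<Rightarrow> 'b set \<Rightarrow> ('b \<times> 'n \<Rightarrow> 's) set" where
  "tensor_rels S M N X =
     {fminus S (fdelta S (x \<oplus>\<^bsub>M\<^esub> x', n)) (fadd S (fdelta S (x, n)) (fdelta S (x', n)))
        | x x' n. x \<in> X \<and> x' \<in> X \<and> n \<in> carrier N}
   \<union> {fminus S (fdelta S (x, n \<oplus>\<^bsub>N\<^esub> n')) (fadd S (fdelta S (x, n)) (fdelta S (x, n')))
        | x n n'. x \<in> X \<and> n \<in> carrier N \<and> n' \<in> carrier N}
   \<union> {fminus S (fdelta S (c \<odot>\<^bsub>M\<^esub> x, n)) (fscale S c (fdelta S (x, n)))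
        | c x n. c \<in> carrier S \<and> x \<in> X \<and> n \<in> carrier N}
   \<union> {fminus S (fdelta S (x, c \<odot>\<^bsub>N\<^esub> n)) (fscale S c (fdelta S (x, n)))
        | c x n. c \<in> carrier S \<and> x \<in> X \<and> n \<in> carrier N}"

text \<open>The map A \<otimes>_S N \<rightarrow> B \<otimes>_S N induced by the inclusion of a submodule A of B
  is injective (its kernel is trivial).  An element of A \<otimes> N is represented by
  some \<phi> in the free module on A \<times> N; it is zero in A \<otimes> N iff \<phi> lies in the span of
  the relations over A, and its image is zero in B \<otimes> N iff \<phi> lies in the span of
  the relations over B.\<close>
definition tensor_inj ::
  "('s,'c) ring_scheme \<Rightarrow> ('s,'n) module \<Rightarrow> 'b set \<Rightarrow> ('s,'b) module \<Rightarrow> bool" where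
  "tensor_inj S N A B \<longleftrightarrow>
     (\<forall>\<phi> \<in> fsupp S A (carrier N).
        \<phi> \<in> fspan S (tensor_rels S B N (carrier B)) \<longrightarrow> \<phi> \<in> fspan S (tensor_rels S B N A))"

definition quot_module :: "('s,'b) module \<Rightarrow> 'b set \<Rightarrow> ('s, 'b set) module" where
  "quot_module M K =
     \<lparr>carrier = a_rcosets\<^bsub>M\<^esub> K,
      mult = (\<lambda>_ _. K), one = K,
      zero = K,
      add = set_add M,
      smult = (\<lambda>c X. \<Union>x\<in>X. K +>\<^bsub>M\<^esub> (c \<odot>\<^bsub>M\<^esub> x))\<rparr>"

definition cyclic_mod :: "('r,'c) ring_scheme \<Rightarrow> 'r \<Rightarrow> ('r, 'r set) module" where
  "cyclic_mod R r =
     \<lparr>carrier = carrier (R Quot (PIdl\<^bsub>R\<^esub> r)),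
      mult = mult (R Quot (PIdl\<^bsub>R\<^esub> r)), one = one (R Quot (PIdl\<^bsub>R\<^esub> r)),
      zero = zero (R Quot (PIdl\<^bsub>R\<^esub> r)),
      add = add (R Quot (PIdl\<^bsub>R\<^esub> r)),
      smult = (\<lambda>a X. ((PIdl\<^bsub>R\<^esub> r) +>\<^bsub>R\<^esub> a) \<otimes>\<^bsub>R Quot (PIdl\<^bsub>R\<^esub> r)\<^esub> X)\<rparr>"

definition RD_pure :: "('r,'c) ring_scheme \<Rightarrow> 'b set \<Rightarrow> ('r,'b) module \<Rightarrow> bool" where
  "RD_pure R A B \<longleftrightarrow> (\<forall>r \<in> carrier R. tensor_inj R (cyclic_mod R r) A B)"

definition RD_essential :: "('r,'c) ring_scheme \<Rightarrow> 'b set \<Rightarrow> ('r,'b) module \<Rightarrow> bool" where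
  "RD_essential R A B \<longleftrightarrow> RD_pure R A B \<and>
     (\<forall>K. submodule K R B \<and> K \<noteq> {\<zero>\<^bsub>B\<^esub>} \<longrightarrow>
          K \<inter> A \<noteq> {\<zero>\<^bsub>B\<^esub>} \<or>
          \<not> RD_pure R ((\<lambda>a. K +>\<^bsub>B\<^esub> a) ` A) (quot_module B K))"

definition essential :: "('r,'c) ring_scheme \<Rightarrow> 'b set \<Rightarrow> ('r,'b) module \<Rightarrow> bool" where
  "essential R A B \<longleftrightarrow>
     (\<forall>K. submodule K R B \<and> K \<noteq> {\<zero>\<^bsub>B\<^esub>} \<longrightarrow> K \<inter> A \<noteq> {\<zero>\<^bsub>B\<^esub>})"

definition pure_sub :: "('s,'c) ring_scheme \<Rightarrow> 'b set \<Rightarrow> ('s,'b) module \<Rightarrow> bool" where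
  "pure_sub S A B \<longleftrightarrow>
     (\<forall>N :: ('s, 's list set) module. module S N \<longrightarrow> tensor_inj S N A B)"

definition pure_mono ::
  "('s,'c) ring_scheme \<Rightarrow> ('s,'a) module \<Rightarrow> ('s,'b) module \<Rightarrow> ('a \<Rightarrow> 'b) \<Rightarrow> bool" where
  "pure_mono S A B f \<longleftrightarrow> f \<in> module_hom S A B \<and> inj_on f (carrier A)
      \<and> pure_sub S (f ` carrier A) B"

definition pure_injective_along ::
  "('s,'c) ring_scheme \<Rightarrow> ('s,'e) module \<Rightarrow> ('s,'a) module \<Rightarrow> ('s,'b) module \<Rightarrow> ('a \<Rightarrow> 'b) \<Rightarrow> bool" where
  "pure_injective_along S E A B f \<longleftrightarrow>
     (module S E \<and> module S A \<and> module S B \<and> pure_mono S A B f \<longrightarrow>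
       (\<forall>g \<in> module_hom S A E. \<exists>h \<in> module_hom S B E. \<forall>a \<in> carrier A. h (f a) = g a))"

definition loc_eq :: "('r,'c) ring_scheme \<Rightarrow> 'r set \<Rightarrow> (('r \<times> 'r) \<times> ('r \<times> 'r)) set" where
  "loc_eq R S = {((a, s), (b, t)). a \<in> carrier R \<and> b \<in> carrier R \<and> s \<in> S \<and> t \<in> S \<and>
                   (\<exists>u \<in> S. u \<otimes>\<^bsub>R\<^esub> (a \<otimes>\<^bsub>R\<^esub> t \<ominus>\<^bsub>R\<^esub> b \<otimes>\<^bsub>R\<^esub> s) = \<zero>\<^bsub>R\<^esub>)}"

definition frac :: "('r,'c) ring_scheme \<Rightarrow> 'r set \<Rightarrow> 'r \<Rightarrow> 'r \<Rightarrow> ('r \<times> 'r) set" where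
  "frac R S a s = loc_eq R S `` {(a, s)}"

definition localization :: "('r,'c) ring_scheme \<Rightarrow> 'r set \<Rightarrow> ('r \<times> 'r) set ring" where
  "localization R S =
     \<lparr>carrier = {frac R S a s | a s. a \<in> carrier R \<and> s \<in> S},
      mult = (\<lambda>X Y. case (SOME p. p \<in> X, SOME q. q \<in> Y) of
                ((a, s), (b, t)) \<Rightarrow> frac R S (a \<otimes>\<^bsub>R\<^esub> b) (s \<otimes>\<^bsub>R\<^esub> t)),
      one = frac R S \<one>\<^bsub>R\<^esub> \<one>\<^bsub>R\<^esub>,
      zero = frac R S \<zero>\<^bsub>R\<^esub> \<one>\<^bsub>R\<^esub>,
      add = (\<lambda>X Y. case (SOME p. p \<in> X, SOME q. q \<in> Y) of
                ((a, s), (b, t)) \<Rightarrow> frac R S (a \<otimes>\<^bsub>R\<^esub> t \<oplus>\<^bsub>R\<^esub> b \<otimes>\<^bsub>R\<^esub> s) (s \<otimes>\<^bsub>R\<^esub> t))\<rparr>"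

definition localize_at :: "('r,'c) ring_scheme \<Rightarrow> 'r set \<Rightarrow> ('r \<times> 'r) set ring" where
  "localize_at R P = localization R (carrier R - P)"

end

theory Submission
  imports Defs
begin

text \<open>
  RD-purity of A in B means r B \<inter> A = r A for all r.  By Zorn's lemma every RD-pure extension has a
  quotient that is an RD-essential extension of the same module, which by hypothesis is essential.
  Applied to suitable extensions this shows that P is locally T-nilpotent and that any two elements
  of P locally have a common divisor in P; together these make the maximal ideal of R_P principal, generated by a
  nilpotent p.  Over such a ring an essential RD-pure extension is trivial, so every RD-pure
  extension splits, and pushing out along a given homomorphism gives pure-injectivity.
\<close>

section \<open>Quotients and transport of modules\<close>

text \<open>The hypothesis speaks of modules on one fixed carrier type. Extensions are therefore
  presented inside one concrete module M, by submodules N \<subseteq> A standing for A/N in M/N, and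
  conditions on a further quotient M/K are written with elements of M. Only
  \<open>RD_essential_quotient\<close> forms M/K and copies it to the required type.

  The extensions are modules over R, where elements outside P need not act invertibly. Divisibility
  and annihilation are therefore asserted up to a factor outside P; this is what "locally" means.

  A principal P with nilpotent generator p is exactly what the splitting needs. RD-purity at the
  single scalar p then controls the action of all of P, and since a power of p is zero, elements of
  the extension are pulled into the submodule plus the complement by induction on that power. Purity
  over R_P enters through the test modules R_P/rR_P, which turn it into RD-purity.\<close>

lemma module_hom_image:
  fixes R :: "('r,'c) ring_scheme" and M :: "('r,'m) module" and Q :: "('r,'q) module"
  assumes M: "module R M"
    and car: "carrier Q = \<pi> ` carrier M"
    and zero: "\<zero>\<^bsub>Q\<^esub> = \<pi> \<zero>\<^bsub>M\<^esub>"
    and add: "\<And>x y. \<lbrakk>x \<in> carrier M; y \<in> carrier M\<rbrakk> \<Longrightarrow> \<pi> (x \<oplus>\<^bsub>M\<^esub> y) = \<pi> x \<oplus>\<^bsub>Q\<^esub> \<pi> y"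
    and smult: "\<And>c x. \<lbrakk>c \<in> carrier R; x \<in> carrier M\<rbrakk> \<Longrightarrow> \<pi> (c \<odot>\<^bsub>M\<^esub> x) = c \<odot>\<^bsub>Q\<^esub> \<pi> x"
  shows "module R Q"
proof -
  interpret module R M by fact
  have Q: "\<exists>x\<in>carrier M. X = \<pi> x" if "X \<in> carrier Q" for X
    using that car by auto
  have "abelian_group Q"
  proof (rule abelian_groupI)
    fix X Y assume "X \<in> carrier Q" "Y \<in> carrier Q"
    then obtain x y where "x \<in> carrier M" "X = \<pi> x" "y \<in> carrier M" "Y = \<pi> y" using Q by metis
    then show "X \<oplus>\<^bsub>Q\<^esub> Y \<in> carrier Q" "X \<oplus>\<^bsub>Q\<^esub> Y = Y \<oplus>\<^bsub>Q\<^esub> X"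
      by (simp_all add: car add[symmetric] M.a_comm)
  next
    show "\<zero>\<^bsub>Q\<^esub> \<in> carrier Q" by (simp add: car zero)
  next
    fix X Y Z assume "X \<in> carrier Q" "Y \<in> carrier Q" "Z \<in> carrier Q"
    then obtain x y z where "x \<in> carrier M" "X = \<pi> x" "y \<in> carrier M" "Y = \<pi> y"
      "z \<in> carrier M" "Z = \<pi> z" using Q by metis
    then show "X \<oplus>\<^bsub>Q\<^esub> Y \<oplus>\<^bsub>Q\<^esub> Z = X \<oplus>\<^bsub>Q\<^esub> (Y \<oplus>\<^bsub>Q\<^esub> Z)"
      by (simp add: add[symmetric] M.a_assoc)
  next
    fix X assume "X \<in> carrier Q"
    then obtain x where x: "x \<in> carrier M" "X = \<pi> x" using Q by metis
    then show "\<zero>\<^bsub>Q\<^esub> \<oplus>\<^bsub>Q\<^esub> X = X"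
      by (simp add: zero add[symmetric])
    have "\<pi> (\<ominus>\<^bsub>M\<^esub> x) \<oplus>\<^bsub>Q\<^esub> X = \<zero>\<^bsub>Q\<^esub>"
      using x by (simp add: zero add[symmetric] M.l_neg)
    then show "\<exists>Y\<in>carrier Q. Y \<oplus>\<^bsub>Q\<^esub> X = \<zero>\<^bsub>Q\<^esub>"
      using x by (auto simp: car)
  qed
  then show ?thesis
  proof (rule moduleI[OF R.is_cring])
    fix a X assume a: "a \<in> carrier R" and "X \<in> carrier Q"
    then obtain x where x: "x \<in> carrier M" "X = \<pi> x" using Q by metis
    then show "a \<odot>\<^bsub>Q\<^esub> X \<in> carrier Q"
      using a by (simp add: smult[symmetric] car)
  next
    fix a b X assume a: "a \<in> carrier R" "b \<in> carrier R" and "X \<in> carrier Q"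
    then obtain x where x: "x \<in> carrier M" "X = \<pi> x" using Q by metis
    then show "(a \<oplus>\<^bsub>R\<^esub> b) \<odot>\<^bsub>Q\<^esub> X = a \<odot>\<^bsub>Q\<^esub> X \<oplus>\<^bsub>Q\<^esub> b \<odot>\<^bsub>Q\<^esub> X"
      and "a \<otimes>\<^bsub>R\<^esub> b \<odot>\<^bsub>Q\<^esub> X = a \<odot>\<^bsub>Q\<^esub> (b \<odot>\<^bsub>Q\<^esub> X)"
      using a by (simp_all add: smult[symmetric] add[symmetric] smult_l_distr smult_assoc1)
  next
    fix a X Y assume a: "a \<in> carrier R" and "X \<in> carrier Q" "Y \<in> carrier Q"
    then obtain x y where "x \<in> carrier M" "X = \<pi> x" "y \<in> carrier M" "Y = \<pi> y" using Q by metis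
    then show "a \<odot>\<^bsub>Q\<^esub> (X \<oplus>\<^bsub>Q\<^esub> Y) = a \<odot>\<^bsub>Q\<^esub> X \<oplus>\<^bsub>Q\<^esub> a \<odot>\<^bsub>Q\<^esub> Y"
      using a by (simp add: smult[symmetric] add[symmetric] smult_r_distr)
  next
    fix X assume "X \<in> carrier Q"
    then obtain x where x: "x \<in> carrier M" "X = \<pi> x" using Q by metis
    then show "\<one>\<^bsub>R\<^esub> \<odot>\<^bsub>Q\<^esub> X = X"
      by (simp add: smult[symmetric])
  qed
qed

text \<open>Both the hypothesis and \<open>pure_sub\<close> quantify over modules on one particular
  type, so the modules fed to them have to be copied along an injection.\<close>

definition transport_module :: "('m \<Rightarrow> 'q) \<Rightarrow> ('r,'m) module \<Rightarrow> ('r,'q) module" where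
  "transport_module i M = (let j = inv_into (carrier M) i in
     \<lparr>carrier = i ` carrier M, mult = (\<lambda>_ _. i \<zero>\<^bsub>M\<^esub>), one = i \<zero>\<^bsub>M\<^esub>, zero = i \<zero>\<^bsub>M\<^esub>,
      add = (\<lambda>X Y. i (j X \<oplus>\<^bsub>M\<^esub> j Y)), smult = (\<lambda>c X. i (c \<odot>\<^bsub>M\<^esub> j X))\<rparr>)"

lemma transport_module_simps:
  "carrier (transport_module i M) = i ` carrier M"
  "\<zero>\<^bsub>transport_module i M\<^esub> = i \<zero>\<^bsub>M\<^esub>"
  "\<lbrakk>inj_on i (carrier M); x \<in> carrier M; y \<in> carrier M\<rbrakk>
     \<Longrightarrow> i x \<oplus>\<^bsub>transport_module i M\<^esub> i y = i (x \<oplus>\<^bsub>M\<^esub> y)"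
  "\<lbrakk>inj_on i (carrier M); x \<in> carrier M\<rbrakk>
     \<Longrightarrow> c \<odot>\<^bsub>transport_module i M\<^esub> i x = i (c \<odot>\<^bsub>M\<^esub> x)"
  by (simp_all add: transport_module_def Let_def inv_into_f_f)

lemma transport_module_module:
  assumes "module R M" "inj_on i (carrier M)"
  shows "module R (transport_module i M)"
  by (rule module_hom_image[OF assms(1), where \<pi> = i])
    (simp_all add: transport_module_simps(1,2) transport_module_simps(3,4)[OF assms(2)])

context
  fixes R :: "('r,'c) ring_scheme" and M :: "('r,'m) module"
  assumes M: "module R M"
begin

interpretation module R M by (rule M)

lemma submodule_imp_additive_subgroup:
  "submodule K R M \<Longrightarrow> additive_subgroup K M"
  by (simp add: additive_subgroup.intro submodule.axioms(1))

lemma submodule_imp_abelian_subgroup: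
  "submodule K R M \<Longrightarrow> abelian_subgroup K M"
  by (simp add: M.abelian_group_axioms abelian_subgroupI3 submodule_imp_additive_subgroup)

lemma submodule_zero: "submodule K R M \<Longrightarrow> \<zero>\<^bsub>M\<^esub> \<in> K"
  using additive_subgroup.zero_closed submodule_imp_additive_subgroup by blast

lemma submodule_minus:
  "\<lbrakk>submodule K R M; x \<in> K; y \<in> K\<rbrakk> \<Longrightarrow> x \<ominus>\<^bsub>M\<^esub> y \<in> K"
  by (simp add: M.minus_eq submoduleE)

lemma a_rcos_eq_iff:
  assumes K: "submodule K R M" and "x \<in> carrier M" "y \<in> carrier M"
  shows "K +>\<^bsub>M\<^esub> x = K +>\<^bsub>M\<^esub> y \<longleftrightarrow> x \<ominus>\<^bsub>M\<^esub> y \<in> K"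
proof -
  interpret K: abelian_subgroup K M by (rule submodule_imp_abelian_subgroup[OF K])
  have "x \<in> K +>\<^bsub>M\<^esub> y \<longleftrightarrow> x \<ominus>\<^bsub>M\<^esub> y \<in> K"
    using K.a_rcos_module[OF assms(3,2)] by (simp add: M.minus_eq)
  moreover have "K +>\<^bsub>M\<^esub> x = K +>\<^bsub>M\<^esub> y \<longleftrightarrow> x \<in> K +>\<^bsub>M\<^esub> y"
    using K.a_rcos_self[OF assms(2)] K.a_repr_independence'[OF _ assms(3), of x] by auto
  ultimately show ?thesis by simp
qed

text \<open>The four identities are the premises of \<open>module_hom_image\<close> for the coset
  map, so M/K inherits its module axioms from M.\<close>

lemma quot_module_simps:
  assumes K: "submodule K R M"
  shows "carrier (quot_module M K) = (\<lambda>x. K +>\<^bsub>M\<^esub> x) ` carrier M"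
    and "\<zero>\<^bsub>quot_module M K\<^esub> = K +>\<^bsub>M\<^esub> \<zero>\<^bsub>M\<^esub>"
    and "\<lbrakk>x \<in> carrier M; y \<in> carrier M\<rbrakk>
      \<Longrightarrow> K +>\<^bsub>M\<^esub> (x \<oplus>\<^bsub>M\<^esub> y) = (K +>\<^bsub>M\<^esub> x) \<oplus>\<^bsub>quot_module M K\<^esub> (K +>\<^bsub>M\<^esub> y)"
    and "\<lbrakk>c \<in> carrier R; x \<in> carrier M\<rbrakk>
      \<Longrightarrow> K +>\<^bsub>M\<^esub> (c \<odot>\<^bsub>M\<^esub> x) = c \<odot>\<^bsub>quot_module M K\<^esub> (K +>\<^bsub>M\<^esub> x)"
proof -
  interpret K: abelian_subgroup K M by (rule submodule_imp_abelian_subgroup[OF K])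
  show "carrier (quot_module M K) = (\<lambda>x. K +>\<^bsub>M\<^esub> x) ` carrier M"
    by (auto simp: quot_module_def A_RCOSETS_def' a_r_coset_def')
  show "\<zero>\<^bsub>quot_module M K\<^esub> = K +>\<^bsub>M\<^esub> \<zero>\<^bsub>M\<^esub>"
    by (simp add: quot_module_def M.a_coset_add_zero K.a_subset)
  show "K +>\<^bsub>M\<^esub> (x \<oplus>\<^bsub>M\<^esub> y) = (K +>\<^bsub>M\<^esub> x) \<oplus>\<^bsub>quot_module M K\<^esub> (K +>\<^bsub>M\<^esub> y)"
    if "x \<in> carrier M" "y \<in> carrier M"
    using that by (simp add: quot_module_def K.a_rcos_sum)
  show "K +>\<^bsub>M\<^esub> (c \<odot>\<^bsub>M\<^esub> x) = c \<odot>\<^bsub>quot_module M K\<^esub> (K +>\<^bsub>M\<^esub> x)"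
    if c: "c \<in> carrier R" and x: "x \<in> carrier M"
  proof -
    \<comment> \<open>The scalar action of \<open>quot_module\<close> is a union over all
      representatives y of the coset; the cosets joined there are all equal because c (y - x) lies
      in K.\<close>
    have "K +>\<^bsub>M\<^esub> (c \<odot>\<^bsub>M\<^esub> y) = K +>\<^bsub>M\<^esub> (c \<odot>\<^bsub>M\<^esub> x)" if y: "y \<in> K +>\<^bsub>M\<^esub> x" for y
    proof -
      have yM: "y \<in> carrier M" using y x K.a_elemrcos_carrier by blast
      have "y \<ominus>\<^bsub>M\<^esub> x \<in> K"
        using K.a_rcos_module_imp[OF x y] by (simp add: M.minus_eq)
      then have "c \<odot>\<^bsub>M\<^esub> (y \<ominus>\<^bsub>M\<^esub> x) \<in> K" using K c submoduleE(4) by blast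
      then have "c \<odot>\<^bsub>M\<^esub> y \<ominus>\<^bsub>M\<^esub> c \<odot>\<^bsub>M\<^esub> x \<in> K"
        using c x yM by (simp add: M.minus_eq smult_r_distr smult_r_minus)
      then show ?thesis using a_rcos_eq_iff[OF K] c x yM by simp
    qed
    moreover have "x \<in> K +>\<^bsub>M\<^esub> x" using x K.a_rcos_self by blast
    ultimately have "(\<Union>y\<in>K +>\<^bsub>M\<^esub> x. K +>\<^bsub>M\<^esub> (c \<odot>\<^bsub>M\<^esub> y)) = K +>\<^bsub>M\<^esub> (c \<odot>\<^bsub>M\<^esub> x)" by blast
    then show ?thesis by (simp add: quot_module_def)
  qed
qed

end

definition self_module :: "('r,'c) ring_scheme \<Rightarrow> ('r,'r) module" where
  "self_module R = \<lparr>carrier = carrier R, mult = mult R, one = one R, zero = zero R,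
     add = add R, smult = mult R\<rparr>"

lemma (in cring) self_module_module: "module R (self_module R)"
proof (rule moduleI)
  show "abelian_group (self_module R)"
    by (rule abelian_groupI) (auto simp: self_module_def a_ac intro: add.l_inv_ex)
qed (auto simp: self_module_def l_distr r_distr m_assoc is_cring)

text \<open>Tensoring only needs that R/rR is generated by one element with annihilator rR. Stated
  through the generator, these properties survive a transport to another carrier type.\<close>

lemma (in cring) cyclic_mod_facts:
  assumes r: "r \<in> carrier R"
  shows "module R (cyclic_mod R r)"
    and "carrier (cyclic_mod R r) = (\<lambda>s. s \<odot>\<^bsub>cyclic_mod R r\<^esub> (PIdl r +> \<one>)) ` carrier R"
    and "PIdl r +> \<one> \<in> carrier (cyclic_mod R r)"
    and "s \<in> carrier R \<Longrightarrow> s \<odot>\<^bsub>cyclic_mod R r\<^esub> (PIdl r +> \<one>) = \<zero>\<^bsub>cyclic_mod R r\<^esub>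
      \<longleftrightarrow> (\<exists>t\<in>carrier R. s = r \<otimes> t)"
proof -
  interpret I: ideal "PIdl r" R by (rule cgenideal_ideal[OF r])
  let ?\<pi> = "\<lambda>s. PIdl r +> s"
  have car: "carrier (cyclic_mod R r) = ?\<pi> ` carrier R"
    unfolding cyclic_mod_def FactRing_def A_RCOSETS_def' by simp blast
  interpret H: ring_hom_cring R "R Quot (PIdl r)" ?\<pi> by (rule I.rcos_ring_hom_cring[OF is_cring])
  show "module R (cyclic_mod R r)"
    by (rule module_hom_image[OF self_module_module, where \<pi> = ?\<pi>])
      (use car in \<open>simp_all add: self_module_def cyclic_mod_def\<close>)
  have sm: "s \<odot>\<^bsub>cyclic_mod R r\<^esub> (?\<pi> \<one>) = ?\<pi> s" if "s \<in> carrier R" for s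
    using that by (simp add: cyclic_mod_def flip: H.hom_mult)
  show "carrier (cyclic_mod R r) = (\<lambda>s. s \<odot>\<^bsub>cyclic_mod R r\<^esub> (?\<pi> \<one>)) ` carrier R"
    using car sm by simp
  show "?\<pi> \<one> \<in> carrier (cyclic_mod R r)" using car one_closed by blast
  have z: "\<zero>\<^bsub>cyclic_mod R r\<^esub> = PIdl r"
    unfolding cyclic_mod_def FactRing_def by (simp only: ring.simps)
  show "s \<odot>\<^bsub>cyclic_mod R r\<^esub> (?\<pi> \<one>) = \<zero>\<^bsub>cyclic_mod R r\<^esub> \<longleftrightarrow> (\<exists>t\<in>carrier R. s = r \<otimes> t)"
    if s: "s \<in> carrier R"
  proof -
    have "?\<pi> s = PIdl r \<longleftrightarrow> s \<in> PIdl r"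
      using a_coset_join1[OF _ s I.a_subgroup] a_coset_join2[OF s I.a_subgroup] by blast
    also have "\<dots> \<longleftrightarrow> (\<exists>t\<in>carrier R. s = t \<otimes> r)"
      unfolding cgenideal_def by blast
    also have "\<dots> \<longleftrightarrow> (\<exists>t\<in>carrier R. s = r \<otimes> t)"
      by (rule bex_cong[OF refl]) (metis m_comm r)
    finally show ?thesis unfolding sm[OF s] z .
  qed
qed

section \<open>RD-purity as a divisibility condition\<close>

context cring
begin

lemma fsuppD: "\<phi> \<in> fsupp R X Y \<Longrightarrow> \<phi> p \<in> carrier R"
  unfolding fsupp_def by blast

lemma fsupp_mono: "X \<subseteq> X' \<Longrightarrow> fsupp R X Y \<subseteq> fsupp R X' Y"
  by (auto simp: fsupp_def)

lemma fdelta_closed [simp]: "fdelta R p q \<in> carrier R"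
  by (simp add: fdelta_def)

lemma fdelta_fsupp: "\<lbrakk>x \<in> X; y \<in> Y\<rbrakk> \<Longrightarrow> fdelta R (x, y) \<in> fsupp R X Y"
  by (auto simp: fsupp_def fdelta_def)

lemma fsupp_lincomb:
  assumes "c \<in> carrier R" "\<phi> \<in> fsupp R X Y" "\<psi> \<in> fsupp R X Y"
  shows "fadd R (fscale R c \<phi>) \<psi> \<in> fsupp R X Y"
proof -
  have "{p. fadd R (fscale R c \<phi>) \<psi> p \<noteq> \<zero>} \<subseteq> {p. \<phi> p \<noteq> \<zero>} \<union> {p. \<psi> p \<noteq> \<zero>}"
    using assms by (auto simp: fadd_def fscale_def)
  with assms show ?thesis
    unfolding fsupp_def using finite_subset by (fastforce simp: fadd_def fscale_def)
qed

lemma fminus_eq_lincomb: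
  assumes "\<And>p. \<phi> p \<in> carrier R" "\<And>p. \<psi> p \<in> carrier R"
  shows "fminus R \<phi> \<psi> = fadd R (fscale R (\<ominus> \<one>) \<psi>) \<phi>"
  using assms by (auto simp: fminus_def fadd_def fscale_def minus_eq l_minus a_comm)

lemma fadd_eq_lincomb:
  assumes "\<And>p. \<phi> p \<in> carrier R"
  shows "fadd R \<phi> \<psi> = fadd R (fscale R \<one> \<phi>) \<psi>"
  using assms by (auto simp: fadd_def fscale_def)

lemma fadd_fsupp: "\<lbrakk>\<phi> \<in> fsupp R X Y; \<psi> \<in> fsupp R X Y\<rbrakk> \<Longrightarrow> fadd R \<phi> \<psi> \<in> fsupp R X Y"
  using fsupp_lincomb[of \<one> \<phi> X Y \<psi>] fadd_eq_lincomb[of \<phi> \<psi>] by (simp add: fsuppD)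

lemma fminus_fsupp: "\<lbrakk>\<phi> \<in> fsupp R X Y; \<psi> \<in> fsupp R X Y\<rbrakk> \<Longrightarrow> fminus R \<phi> \<psi> \<in> fsupp R X Y"
  using fsupp_lincomb[of "\<ominus> \<one>" \<psi> X Y \<phi>] fminus_eq_lincomb[of \<phi> \<psi>] by (simp add: fsuppD)

lemma zero_fsupp: "(\<lambda>_. \<zero>) \<in> fsupp R X Y"
  by (simp add: fsupp_def)

lemma fscale_fsupp: "\<lbrakk>c \<in> carrier R; \<phi> \<in> fsupp R X Y\<rbrakk> \<Longrightarrow> fscale R c \<phi> \<in> fsupp R X Y"
  using fsupp_lincomb[of c \<phi> X Y "\<lambda>_. \<zero>"] fsuppD[of \<phi> X Y]
  by (simp add: zero_fsupp fadd_def fscale_def)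

lemma fspan_carrier:
  assumes "G \<subseteq> UNIV \<rightarrow> carrier R" "v \<in> fspan R G"
  shows "v p \<in> carrier R"
  using assms(2,1) by (induction arbitrary: p) (force simp: fadd_def fscale_def)+

lemma fspan_fadd:
  assumes "G \<subseteq> UNIV \<rightarrow> carrier R" "v \<in> fspan R G" "w \<in> fspan R G"
  shows "fadd R v w \<in> fspan R G"
  using assms(2)
proof induction
  case fspan_zero
  have "fadd R (\<lambda>_. \<zero>) w = w"
    using fspan_carrier[of G w] assms by (simp add: fadd_def)
  then show ?case using assms(3) by simp
next
  case (fspan_step g c v)
  have g: "g p \<in> carrier R" for p using fspan_step(1) assms(1) by blast
  have "fadd R (fadd R (fscale R c g) v) w = fadd R (fscale R c g) (fadd R v w)"
    using fspan_carrier[OF assms(1) fspan_step(3)] fspan_carrier[OF assms(1,3)] fspan_step(2) g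
    by (simp add: fadd_def fscale_def a_assoc)
  then show ?case using fspan_step fspan.fspan_step by metis
qed

lemma fspan_fscale:
  assumes "G \<subseteq> UNIV \<rightarrow> carrier R" "v \<in> fspan R G" "d \<in> carrier R"
  shows "fscale R d v \<in> fspan R G"
  using assms(2)
proof induction
  case fspan_zero
  then show ?case using assms(3) by (simp add: fscale_def fspan.fspan_zero)
next
  case (fspan_step g c v)
  have g: "g p \<in> carrier R" for p using fspan_step(1) assms(1) by blast
  have "fscale R d (fadd R (fscale R c g) v) = fadd R (fscale R (d \<otimes> c) g) (fscale R d v)"
    using fspan_carrier[OF assms(1) fspan_step(3)] assms(3) fspan_step(2) g
    by (simp add: fadd_def fscale_def r_distr m_assoc)
  then show ?case using fspan_step fspan.fspan_step assms(3) by (metis m_closed)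
qed

lemma fspan_base:
  assumes "G \<subseteq> UNIV \<rightarrow> carrier R" "g \<in> G"
  shows "g \<in> fspan R G"
proof -
  have g: "g p \<in> carrier R" for p using assms by blast
  have "fadd R (fscale R \<one> g) (\<lambda>_. \<zero>) = g"
    using g by (simp add: fadd_def fscale_def)
  then show ?thesis using fspan.fspan_step[OF assms(2) one_closed fspan.fspan_zero] by simp
qed

end

text \<open>For N = Su and a coordinate \<sigma> with n = \<sigma>(n) u, the tensor x \<otimes> n
  equals \<sigma>(n) x \<otimes> u. This map collects the first factors, so that \<phi> represents
  \<open>tensor_eval\<close> \<otimes> u.\<close>

definition tensor_eval ::
  "('s,'c) ring_scheme \<Rightarrow> ('s,'b) module \<Rightarrow> ('n \<Rightarrow> 's) \<Rightarrow> ('b \<times> 'n \<Rightarrow> 's) \<Rightarrow> 'b" where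
  "tensor_eval S B \<sigma> \<phi> =
     (\<Oplus>\<^bsub>B\<^esub>p\<in>{p. \<phi> p \<noteq> \<zero>\<^bsub>S\<^esub>}. (\<phi> p \<otimes>\<^bsub>S\<^esub> \<sigma> (snd p)) \<odot>\<^bsub>B\<^esub> fst p)"

context
  fixes S :: "('s,'c) ring_scheme" and B :: "('s,'b) module" and N :: "('s,'n) module"
    and \<sigma> :: "'n \<Rightarrow> 's"
  assumes B: "module S B"
    and \<sigma>: "\<And>n. n \<in> carrier N \<Longrightarrow> \<sigma> n \<in> carrier S"
begin

interpretation B: module S B by (rule B)

text \<open>The support of a linear combination can shrink by cancellation, so sums are compared
  over a common finite index set instead of over each support.\<close>

lemma tensor_eval_superset:
  assumes "\<phi> \<in> fsupp S (carrier B) (carrier N)" "finite F" "{p. \<phi> p \<noteq> \<zero>\<^bsub>S\<^esub>} \<subseteq> F"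
    "F \<subseteq> carrier B \<times> carrier N"
  shows "tensor_eval S B \<sigma> \<phi> = (\<Oplus>\<^bsub>B\<^esub>p\<in>F. (\<phi> p \<otimes>\<^bsub>S\<^esub> \<sigma> (snd p)) \<odot>\<^bsub>B\<^esub> fst p)"
  unfolding tensor_eval_def
proof (rule B.M.add.finprod_mono_neutral_cong_left)
  show "(\<phi> p \<otimes>\<^bsub>S\<^esub> \<sigma> (snd p)) \<odot>\<^bsub>B\<^esub> fst p = \<zero>\<^bsub>B\<^esub>" if "p \<in> F - {p. \<phi> p \<noteq> \<zero>\<^bsub>S\<^esub>}" for p
  proof -
    have "fst p \<in> carrier B" "snd p \<in> carrier N" using that assms(4) by auto
    with that \<sigma> show ?thesis by simp
  qed
  show "(\<lambda>p. (\<phi> p \<otimes>\<^bsub>S\<^esub> \<sigma> (snd p)) \<odot>\<^bsub>B\<^esub> fst p) \<in> F \<rightarrow> carrier B"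
    using assms \<sigma> B.R.fsuppD[OF assms(1)] by auto
qed (use assms in auto)

lemma tensor_eval_closed:
  assumes "\<phi> \<in> fsupp S (carrier B) (carrier N)"
  shows "tensor_eval S B \<sigma> \<phi> \<in> carrier B"
  unfolding tensor_eval_def
  by (rule B.M.finsum_closed) (use assms \<sigma> in \<open>force simp: fsupp_def\<close>)

lemma tensor_eval_lincomb:
  assumes \<phi>: "\<phi> \<in> fsupp S (carrier B) (carrier N)" and \<psi>: "\<psi> \<in> fsupp S (carrier B) (carrier N)"
    and c: "c \<in> carrier S"
  shows "tensor_eval S B \<sigma> (fadd S (fscale S c \<phi>) \<psi>)
    = c \<odot>\<^bsub>B\<^esub> tensor_eval S B \<sigma> \<phi> \<oplus>\<^bsub>B\<^esub> tensor_eval S B \<sigma> \<psi>"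
proof -
  let ?F = "{p. \<phi> p \<noteq> \<zero>\<^bsub>S\<^esub>} \<union> {p. \<psi> p \<noteq> \<zero>\<^bsub>S\<^esub>}"
  let ?e = "\<lambda>\<phi> p. (\<phi> p \<otimes>\<^bsub>S\<^esub> \<sigma> (snd p)) \<odot>\<^bsub>B\<^esub> fst p"
  have F: "finite ?F" "?F \<subseteq> carrier B \<times> carrier N"
    using \<phi> \<psi> by (auto simp: fsupp_def)
  have cl: "?e \<phi> \<in> ?F \<rightarrow> carrier B" if "\<phi> \<in> fsupp S (carrier B) (carrier N)" for \<phi>
    using F(2) \<sigma> B.R.fsuppD[OF that] by (auto intro!: B.smult_closed)
  have pt: "?e (fadd S (fscale S c \<phi>) \<psi>) p = c \<odot>\<^bsub>B\<^esub> ?e \<phi> p \<oplus>\<^bsub>B\<^esub> ?e \<psi> p" if "p \<in> ?F" for p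
  proof -
    have "fst p \<in> carrier B" "snd p \<in> carrier N" using that F(2) by auto
    then show ?thesis
      using c \<sigma> B.R.fsuppD[OF \<phi>] B.R.fsuppD[OF \<psi>]
      by (simp add: fadd_def fscale_def B.R.l_distr B.smult_l_distr B.R.m_assoc B.smult_assoc1)
  qed
  have "tensor_eval S B \<sigma> (fadd S (fscale S c \<phi>) \<psi>) = finsum B (?e (fadd S (fscale S c \<phi>) \<psi>)) ?F"
    by (rule tensor_eval_superset[OF B.R.fsupp_lincomb[OF c \<phi> \<psi>] F(1) _ F(2)])
      (use c \<phi> \<psi> in \<open>auto simp: fadd_def fscale_def\<close>)
  also have "\<dots> = (\<Oplus>\<^bsub>B\<^esub>p\<in>?F. c \<odot>\<^bsub>B\<^esub> ?e \<phi> p \<oplus>\<^bsub>B\<^esub> ?e \<psi> p)"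
    by (rule B.M.finsum_cong'[OF refl _ pt]) (use cl[OF \<phi>] cl[OF \<psi>] c in \<open>auto simp: Pi_iff\<close>)
  also have "\<dots> = (\<Oplus>\<^bsub>B\<^esub>p\<in>?F. c \<odot>\<^bsub>B\<^esub> ?e \<phi> p) \<oplus>\<^bsub>B\<^esub> finsum B (?e \<psi>) ?F"
    by (rule B.M.finsum_addf) (use cl[OF \<phi>] cl[OF \<psi>] c in auto)
  also have "(\<Oplus>\<^bsub>B\<^esub>p\<in>?F. c \<odot>\<^bsub>B\<^esub> ?e \<phi> p) = c \<odot>\<^bsub>B\<^esub> finsum B (?e \<phi>) ?F"
    by (rule B.finsum_smult_ldistr[symmetric, OF F(1) c cl[OF \<phi>]])
  finally show ?thesis
    using tensor_eval_superset[OF \<phi> F(1) _ F(2)] tensor_eval_superset[OF \<psi> F(1) _ F(2)] by simp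
qed

lemma tensor_eval_fdelta:
  assumes "x \<in> carrier B" "n \<in> carrier N"
  shows "tensor_eval S B \<sigma> (fdelta S (x, n)) = \<sigma> n \<odot>\<^bsub>B\<^esub> x"
proof -
  have "tensor_eval S B \<sigma> (fdelta S (x, n))
    = (\<Oplus>\<^bsub>B\<^esub>p\<in>{(x, n)}. (fdelta S (x, n) p \<otimes>\<^bsub>S\<^esub> \<sigma> (snd p)) \<odot>\<^bsub>B\<^esub> fst p)"
    by (rule tensor_eval_superset[OF B.R.fdelta_fsupp])
      (use assms in \<open>auto simp: fdelta_def\<close>)
  also have "\<dots> = \<sigma> n \<odot>\<^bsub>B\<^esub> x"
    using assms \<sigma> by (simp add: fdelta_def)
  finally show ?thesis .
qed

lemma tensor_eval_fminus:
  assumes "\<phi> \<in> fsupp S (carrier B) (carrier N)" "\<psi> \<in> fsupp S (carrier B) (carrier N)"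
  shows "tensor_eval S B \<sigma> (fminus S \<phi> \<psi>) = tensor_eval S B \<sigma> \<phi> \<ominus>\<^bsub>B\<^esub> tensor_eval S B \<sigma> \<psi>"
  using assms tensor_eval_closed[OF assms(1)] tensor_eval_closed[OF assms(2)]
  by (simp add: B.R.fminus_eq_lincomb B.R.fsuppD tensor_eval_lincomb B.smult_l_minus B.M.minus_eq
      B.M.a_comm)

lemma tensor_eval_fadd:
  assumes "\<phi> \<in> fsupp S (carrier B) (carrier N)" "\<psi> \<in> fsupp S (carrier B) (carrier N)"
  shows "tensor_eval S B \<sigma> (fadd S \<phi> \<psi>) = tensor_eval S B \<sigma> \<phi> \<oplus>\<^bsub>B\<^esub> tensor_eval S B \<sigma> \<psi>"
  using assms tensor_eval_closed[OF assms(1)]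
  by (subst B.R.fadd_eq_lincomb) (simp_all add: B.R.fsuppD tensor_eval_lincomb)

lemma tensor_eval_zero: "tensor_eval S B \<sigma> (\<lambda>_. \<zero>\<^bsub>S\<^esub>) = \<zero>\<^bsub>B\<^esub>"
  by (simp add: tensor_eval_def)

lemma tensor_eval_fscale:
  assumes "\<phi> \<in> fsupp S (carrier B) (carrier N)" "c \<in> carrier S"
  shows "tensor_eval S B \<sigma> (fscale S c \<phi>) = c \<odot>\<^bsub>B\<^esub> tensor_eval S B \<sigma> \<phi>"
proof -
  have "fscale S c \<phi> = fadd S (fscale S c \<phi>) (\<lambda>_. \<zero>\<^bsub>S\<^esub>)"
    using assms by (auto simp: fadd_def fscale_def B.R.fsuppD)
  moreover have "(\<lambda>_. \<zero>\<^bsub>S\<^esub>) \<in> fsupp S (carrier B) (carrier N)" by (simp add: fsupp_def)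
  ultimately show ?thesis
    using tensor_eval_lincomb[OF assms(1) _ assms(2)] tensor_eval_closed[OF assms(1)] assms(2)
    by (metis B.M.r_zero B.smult_closed tensor_eval_zero)
qed

end

lemma (in module) submodule_smult_image:
  assumes X: "submodule X R M" and r: "r \<in> carrier R"
  shows "submodule ((\<lambda>x. r \<odot>\<^bsub>M\<^esub> x) ` X) R M"
proof (rule submoduleI)
  note XE = submoduleE[OF X]
  show "(\<lambda>x. r \<odot>\<^bsub>M\<^esub> x) ` X \<subseteq> carrier M" using XE(1) r by auto
  obtain x where "x \<in> X" using XE(2) by auto
  then have "\<zero>\<^bsub>M\<^esub> \<in> X" using XE(4)[OF R.zero_closed] XE(1) by (metis smult_l_null subsetD)
  then show "\<zero>\<^bsub>M\<^esub> \<in> (\<lambda>x. r \<odot>\<^bsub>M\<^esub> x) ` X" using r by (force intro: image_eqI[of _ _ "\<zero>\<^bsub>M\<^esub>"])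
next
  note XE = submoduleE[OF X]
  fix a assume "a \<in> (\<lambda>x. r \<odot>\<^bsub>M\<^esub> x) ` X"
  then obtain x where x: "x \<in> X" "a = r \<odot>\<^bsub>M\<^esub> x" by auto
  with XE(1) r have "\<ominus>\<^bsub>M\<^esub> a = r \<odot>\<^bsub>M\<^esub> (\<ominus>\<^bsub>M\<^esub> x)" by (auto simp: smult_r_minus)
  then show "\<ominus>\<^bsub>M\<^esub> a \<in> (\<lambda>x. r \<odot>\<^bsub>M\<^esub> x) ` X" using XE(3)[OF x(1)] by blast
  fix c assume c: "c \<in> carrier R"
  have "x \<in> carrier M" using x XE(1) by auto
  then have "c \<odot>\<^bsub>M\<^esub> a = r \<odot>\<^bsub>M\<^esub> (c \<odot>\<^bsub>M\<^esub> x)"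
    using x(2) r c by (metis R.m_comm smult_assoc1)
  then show "c \<odot>\<^bsub>M\<^esub> a \<in> (\<lambda>x. r \<odot>\<^bsub>M\<^esub> x) ` X" using XE(4)[OF c x(1)] by blast
next
  note XE = submoduleE[OF X]
  fix a b assume "a \<in> (\<lambda>x. r \<odot>\<^bsub>M\<^esub> x) ` X" "b \<in> (\<lambda>x. r \<odot>\<^bsub>M\<^esub> x) ` X"
  then obtain x y where x: "x \<in> X" "a = r \<odot>\<^bsub>M\<^esub> x" "y \<in> X" "b = r \<odot>\<^bsub>M\<^esub> y" by auto
  then have "a \<oplus>\<^bsub>M\<^esub> b = r \<odot>\<^bsub>M\<^esub> (x \<oplus>\<^bsub>M\<^esub> y)"
    using XE(1) r smult_r_distr by (metis subsetD)
  then show "a \<oplus>\<^bsub>M\<^esub> b \<in> (\<lambda>x. r \<odot>\<^bsub>M\<^esub> x) ` X" using XE(5)[OF x(1,3)] by blast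
qed

context cring
begin

text \<open>The identity behind the induction step of \<open>reduce\<close>, read at one point of
  the index set: d1 to d6 are values of the basis functions occurring there and f is the value of
  the remaining function. Each bracket is a bilinearity relation, except f - d5, which comes from
  the induction hypothesis.\<close>

lemma lincomb_identity:
  assumes "c \<in> carrier R" "s \<in> carrier R" "d1 \<in> carrier R" "d2 \<in> carrier R" "d3 \<in> carrier R"
    "d4 \<in> carrier R" "d5 \<in> carrier R" "d6 \<in> carrier R" "f \<in> carrier R"
  shows "c \<otimes> ((d1 \<ominus> s \<otimes> d2) \<oplus> \<ominus> \<one> \<otimes> (d3 \<ominus> s \<otimes> d2)) \<oplus>
    (\<ominus> \<one> \<otimes> (d4 \<ominus> c \<otimes> d3) \<oplus> (\<ominus> \<one> \<otimes> (d6 \<ominus> (d4 \<oplus> d5)) \<oplus> (f \<ominus> d5))) = (c \<otimes> d1 \<oplus> f) \<ominus> d6"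
  using assms by algebra

text \<open>The same for rx \<otimes> u = 0: d1, d2, d3 are the values of the basis functions at
  (rx, u), (x, u) and (x, 0), and ru = 0 = 0u makes d3 occur in two relations.\<close>

lemma lincomb_identity':
  assumes "r \<in> carrier R" "d1 \<in> carrier R" "d2 \<in> carrier R" "d3 \<in> carrier R"
  shows "(d1 \<ominus> r \<otimes> d2) \<oplus> (\<ominus> \<one> \<otimes> (d3 \<ominus> r \<otimes> d2) \<oplus> (d3 \<ominus> \<zero> \<otimes> d2)) = d1"
  using assms by algebra

end

section \<open>Tensor products with a cyclic module\<close>

context
  fixes S :: "('s,'c) ring_scheme" and B :: "('s,'b) module" and N :: "('s,'n) module"
    and u :: 'n and r :: 's
  assumes B: "module S B" and N: "module S N"
    and u: "u \<in> carrier N" and r: "r \<in> carrier S"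
    and gen: "carrier N = (\<lambda>s. s \<odot>\<^bsub>N\<^esub> u) ` carrier S"
    and ann: "\<And>s. s \<in> carrier S \<Longrightarrow> s \<odot>\<^bsub>N\<^esub> u = \<zero>\<^bsub>N\<^esub> \<longleftrightarrow> (\<exists>t\<in>carrier S. s = r \<otimes>\<^bsub>S\<^esub> t)"
begin

interpretation B: module S B by (rule B)
interpretation N: module S N by (rule N)

text \<open>A choice of coordinates along u. It is additive and linear only up to the annihilator rS
  of u, which is why relations evaluate into rX and not to zero.\<close>

private definition \<sigma> where "\<sigma> = inv_into (carrier S) (\<lambda>s. s \<odot>\<^bsub>N\<^esub> u)"

private lemma \<sigma>: "n \<in> carrier N \<Longrightarrow> \<sigma> n \<in> carrier S" "n \<in> carrier N \<Longrightarrow> \<sigma> n \<odot>\<^bsub>N\<^esub> u = n"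
  unfolding \<sigma>_def using gen by (simp_all add: inv_into_into f_inv_into_f[of n "\<lambda>s. s \<odot>\<^bsub>N\<^esub> u"])

private lemma ev_lincomb:
  assumes "\<phi> \<in> fsupp S (carrier B) (carrier N)" "\<psi> \<in> fsupp S (carrier B) (carrier N)"
    "c \<in> carrier S"
  shows "tensor_eval S B \<sigma> (fadd S (fscale S c \<phi>) \<psi>)
    = c \<odot>\<^bsub>B\<^esub> tensor_eval S B \<sigma> \<phi> \<oplus>\<^bsub>B\<^esub> tensor_eval S B \<sigma> \<psi>"
  by (rule tensor_eval_lincomb[OF B \<sigma>(1) assms])

private lemma ann_smult:
  assumes "s \<in> carrier S" "s \<odot>\<^bsub>N\<^esub> u = \<zero>\<^bsub>N\<^esub>" "submodule X S B" "x \<in> X"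
  shows "s \<odot>\<^bsub>B\<^esub> x \<in> (\<lambda>x. r \<odot>\<^bsub>B\<^esub> x) ` X"
proof -
  obtain t where "t \<in> carrier S" "s = r \<otimes>\<^bsub>S\<^esub> t" using assms ann by blast
  with assms show ?thesis
    using B.submoduleE(1,4)[OF assms(3)] r by (auto simp: B.smult_assoc1)
qed

lemma tensor_rels_fsupp:
  assumes X: "submodule X S B"
  shows "tensor_rels S B N X \<subseteq> fsupp S X (carrier N)"
  using B.submoduleE(4,5)[OF X]
  by (auto simp: tensor_rels_def intro!: B.R.fminus_fsupp B.R.fadd_fsupp B.R.fscale_fsupp B.R.fdelta_fsupp)

text \<open>Relations in the first argument evaluate to zero. Those in the second argument evaluate
  to s x, where s measures the failure of \<sigma> to be linear; such s annihilates u, hence is a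
  multiple of r.\<close>

private lemma ev_rels:
  assumes X: "submodule X S B" and g: "g \<in> tensor_rels S B N X"
  shows "tensor_eval S B \<sigma> g \<in> (\<lambda>x. r \<odot>\<^bsub>B\<^esub> x) ` X"
proof -
  note XE = B.submoduleE[OF X]
  note simps = tensor_eval_fminus[OF B \<sigma>(1), where N = N] tensor_eval_fadd[OF B \<sigma>(1), where N = N]
    tensor_eval_fscale[OF B \<sigma>(1), where N = N] tensor_eval_fdelta[OF B \<sigma>(1), where N = N]
    B.R.fminus_fsupp B.R.fadd_fsupp B.R.fscale_fsupp B.R.fdelta_fsupp
  have XB: "x \<in> carrier B" if "x \<in> X" for x using that XE(1) by auto
  have zero: "\<zero>\<^bsub>B\<^esub> \<in> (\<lambda>x. r \<odot>\<^bsub>B\<^esub> x) ` X"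
    by (rule submodule_zero[OF B B.submodule_smult_image[OF X r]])
  from g consider
    (1) x x' n where "x \<in> X" "x' \<in> X" "n \<in> carrier N"
      "g = fminus S (fdelta S (x \<oplus>\<^bsub>B\<^esub> x', n)) (fadd S (fdelta S (x, n)) (fdelta S (x', n)))"
  | (2) x n n' where "x \<in> X" "n \<in> carrier N" "n' \<in> carrier N"
      "g = fminus S (fdelta S (x, n \<oplus>\<^bsub>N\<^esub> n')) (fadd S (fdelta S (x, n)) (fdelta S (x, n')))"
  | (3) c x n where "c \<in> carrier S" "x \<in> X" "n \<in> carrier N"
      "g = fminus S (fdelta S (c \<odot>\<^bsub>B\<^esub> x, n)) (fscale S c (fdelta S (x, n)))"
  | (4) c x n where "c \<in> carrier S" "x \<in> X" "n \<in> carrier N"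
      "g = fminus S (fdelta S (x, c \<odot>\<^bsub>N\<^esub> n)) (fscale S c (fdelta S (x, n)))"
    unfolding tensor_rels_def
    by (elim UnE CollectE exE conjE) ((rule that, assumption+)+)
  then show ?thesis
  proof cases
    case 1
    then have "tensor_eval S B \<sigma> g = \<zero>\<^bsub>B\<^esub>"
      using XB by (simp add: simps \<sigma>(1) B.smult_r_distr B.M.minus_eq B.M.r_neg)
    then show ?thesis using zero by simp
  next
    case 2
    let ?s = "\<sigma> (n \<oplus>\<^bsub>N\<^esub> n') \<oplus>\<^bsub>S\<^esub> \<ominus>\<^bsub>S\<^esub> (\<sigma> n \<oplus>\<^bsub>S\<^esub> \<sigma> n')"
    have "tensor_eval S B \<sigma> g = ?s \<odot>\<^bsub>B\<^esub> x"
      using 2 XB by (simp add: simps \<sigma>(1) B.smult_l_distr B.smult_l_minus B.M.minus_eq)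
    moreover have "?s \<odot>\<^bsub>N\<^esub> u = \<zero>\<^bsub>N\<^esub>"
      using 2 u by (simp add: \<sigma> N.smult_l_distr N.smult_l_minus N.M.r_neg)
    ultimately show ?thesis using ann_smult[OF _ _ X] 2 \<sigma>(1) by simp
  next
    case 3
    then have "tensor_eval S B \<sigma> g = \<zero>\<^bsub>B\<^esub>"
      using XB by (simp add: simps \<sigma>(1) B.M.minus_eq B.M.r_neg B.R.m_comm flip: B.smult_assoc1)
    then show ?thesis using zero by simp
  next
    case 4
    let ?s = "\<sigma> (c \<odot>\<^bsub>N\<^esub> n) \<oplus>\<^bsub>S\<^esub> \<ominus>\<^bsub>S\<^esub> (c \<otimes>\<^bsub>S\<^esub> \<sigma> n)"
    have "tensor_eval S B \<sigma> g = ?s \<odot>\<^bsub>B\<^esub> x"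
      using 4 XB by (simp add: simps \<sigma>(1) B.smult_l_distr B.smult_l_minus B.M.minus_eq B.smult_assoc1)
    moreover have "?s \<odot>\<^bsub>N\<^esub> u = \<zero>\<^bsub>N\<^esub>"
      using 4 u by (simp add: \<sigma> N.smult_l_distr N.smult_l_minus N.M.r_neg N.smult_assoc1)
    ultimately show ?thesis using ann_smult[OF _ _ X] 4 \<sigma>(1) by simp
  qed
qed

text \<open>In other words, evaluation descends to a map from X \<otimes> N to X/rX.\<close>

private lemma ev_fspan:
  assumes X: "submodule X S B" and "v \<in> fspan S (tensor_rels S B N X)"
  shows "v \<in> fsupp S (carrier B) (carrier N) \<and> tensor_eval S B \<sigma> v \<in> (\<lambda>x. r \<odot>\<^bsub>B\<^esub> x) ` X"
  using assms(2)
proof induction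
  case fspan_zero
  have "\<zero>\<^bsub>B\<^esub> \<in> (\<lambda>x. r \<odot>\<^bsub>B\<^esub> x) ` X"
    by (rule submodule_zero[OF B B.submodule_smult_image[OF X r]])
  then show ?case by (simp add: B.R.zero_fsupp tensor_eval_zero[OF B \<sigma>(1)])
next
  case (fspan_step g c v)
  have g: "g \<in> fsupp S (carrier B) (carrier N)"
    using tensor_rels_fsupp[OF X] fspan_step(1) B.R.fsupp_mono[OF B.submoduleE(1)[OF X]] by blast
  note rX = B.submoduleE[OF B.submodule_smult_image[OF X r]]
  have "c \<odot>\<^bsub>B\<^esub> tensor_eval S B \<sigma> g \<oplus>\<^bsub>B\<^esub> tensor_eval S B \<sigma> v \<in> (\<lambda>x. r \<odot>\<^bsub>B\<^esub> x) ` X"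
    using rX(4,5) ev_rels[OF X fspan_step(1)] fspan_step by blast
  then show ?case
    using g fspan_step B.R.fsupp_lincomb[of c g _ _ v] by (auto simp: ev_lincomb)
qed

text \<open>The converse direction: modulo the relations over A, every tensor is a single a
  \<otimes> u with a its value. The induction runs over a finite set containing the support and
  splits off one basis element at a time.\<close>

private lemma reduce:
  assumes A: "submodule A S B" and "\<phi> \<in> fsupp S A (carrier N)"
  shows "tensor_eval S B \<sigma> \<phi> \<in> A"
    and "fminus S \<phi> (fdelta S (tensor_eval S B \<sigma> \<phi>, u)) \<in> fspan S (tensor_rels S B N A)"
proof -
  note AE = B.submoduleE[OF A]
  let ?G = "tensor_rels S B N A"
  let ?W = "fspan S ?G"
  have Gc: "?G \<subseteq> UNIV \<rightarrow> carrier S"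
    using tensor_rels_fsupp[OF A] B.R.fsuppD by blast
  have AB: "x \<in> carrier B" if "x \<in> A" for x using that AE(1) by auto
  note add = B.R.fspan_fadd[OF Gc] and scale = B.R.fspan_fscale[OF Gc]
    and base = B.R.fspan_base[OF Gc]
  have fAB: "\<phi> \<in> fsupp S (carrier B) (carrier N)" if "\<phi> \<in> fsupp S A (carrier N)" for \<phi>
    using that B.R.fsupp_mono[OF AE(1)] by blast
  have "\<phi> \<in> fsupp S A (carrier N) \<longrightarrow> {p. \<phi> p \<noteq> \<zero>\<^bsub>S\<^esub>} \<subseteq> F \<longrightarrow>
      tensor_eval S B \<sigma> \<phi> \<in> A \<and> fminus S \<phi> (fdelta S (tensor_eval S B \<sigma> \<phi>, u)) \<in> ?W"
    if "finite F" for F \<phi>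
    using that
  proof (induction arbitrary: \<phi>)
    case empty
    show ?case
    proof (intro impI)
      assume "{p. \<phi> p \<noteq> \<zero>\<^bsub>S\<^esub>} \<subseteq> {}"
      then have \<phi>: "\<phi> = (\<lambda>_. \<zero>\<^bsub>S\<^esub>)" by auto
      have z: "\<zero>\<^bsub>B\<^esub> \<in> A" by (rule submodule_zero[OF B A])
      \<comment> \<open>That 0 \<otimes> u vanishes is not a defining relation; it is homogeneity in
        the first argument with scalar 0.\<close>
      let ?g = "fminus S (fdelta S (\<zero>\<^bsub>S\<^esub> \<odot>\<^bsub>B\<^esub> \<zero>\<^bsub>B\<^esub>, u)) (fscale S \<zero>\<^bsub>S\<^esub> (fdelta S (\<zero>\<^bsub>B\<^esub>, u)))"
      have "?g \<in> ?G" unfolding tensor_rels_def using z u by blast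
      then have "fscale S (\<ominus>\<^bsub>S\<^esub> \<one>\<^bsub>S\<^esub>) ?g \<in> ?W" using scale base by simp
      moreover have "fminus S \<phi> (fdelta S (\<zero>\<^bsub>B\<^esub>, u)) = fscale S (\<ominus>\<^bsub>S\<^esub> \<one>\<^bsub>S\<^esub>) ?g"
        by (auto simp: \<phi> fminus_def fscale_def B.R.minus_eq B.R.l_minus)
      ultimately show "tensor_eval S B \<sigma> \<phi> \<in> A \<and> fminus S \<phi> (fdelta S (tensor_eval S B \<sigma> \<phi>, u)) \<in> ?W"
        using z by (simp add: \<phi> tensor_eval_zero[OF B \<sigma>(1)])
    qed
  next
    case (insert p F)
    show ?case
    proof (intro impI)
      assume \<phi>: "\<phi> \<in> fsupp S A (carrier N)" and sub: "{p. \<phi> p \<noteq> \<zero>\<^bsub>S\<^esub>} \<subseteq> insert p F"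
      show "tensor_eval S B \<sigma> \<phi> \<in> A \<and> fminus S \<phi> (fdelta S (tensor_eval S B \<sigma> \<phi>, u)) \<in> ?W"
      proof (cases "\<phi> p = \<zero>\<^bsub>S\<^esub>")
        case True
        then have "{p. \<phi> p \<noteq> \<zero>\<^bsub>S\<^esub>} \<subseteq> F" using sub by auto
        then show ?thesis using insert \<phi> by blast
      next
        case False
        obtain x n where p: "p = (x, n)" by (cases p)
        have x: "x \<in> A" and n: "n \<in> carrier N" using False \<phi> p by (auto simp: fsupp_def)
        define c where "c = \<phi> p"
        have c: "c \<in> carrier S" using \<phi> B.R.fsuppD c_def by blast
        define \<phi>' where "\<phi>' = \<phi>(p := \<zero>\<^bsub>S\<^esub>)"
        have s': "{p. \<phi>' p \<noteq> \<zero>\<^bsub>S\<^esub>} \<subseteq> {p. \<phi> p \<noteq> \<zero>\<^bsub>S\<^esub>}" by (auto simp: \<phi>'_def)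
        have \<phi>': "\<phi>' \<in> fsupp S A (carrier N)"
          using \<phi> finite_subset[OF s'] s' unfolding fsupp_def \<phi>'_def
          by (auto split: if_splits)
        have "{p. \<phi>' p \<noteq> \<zero>\<^bsub>S\<^esub>} \<subseteq> F" using sub by (auto simp: \<phi>'_def)
        then have IH: "tensor_eval S B \<sigma> \<phi>' \<in> A"
          "fminus S \<phi>' (fdelta S (tensor_eval S B \<sigma> \<phi>', u)) \<in> ?W"
          using insert \<phi>' by blast+
        have \<phi>_eq: "\<phi> = fadd S (fscale S c (fdelta S (x, n))) \<phi>'"
          using c B.R.fsuppD[OF \<phi>] by (auto simp: fadd_def fscale_def fdelta_def \<phi>'_def c_def p)
        define e where "e = tensor_eval S B \<sigma> \<phi>'"
        have ev: "tensor_eval S B \<sigma> \<phi> = c \<odot>\<^bsub>B\<^esub> (\<sigma> n \<odot>\<^bsub>B\<^esub> x) \<oplus>\<^bsub>B\<^esub> e"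
          unfolding \<phi>_eq e_def
          using ev_lincomb[OF _ fAB[OF \<phi>'] c, where \<phi> = "fdelta S (x, n)"]
            tensor_eval_fdelta[OF B \<sigma>(1) AB[OF x] n] B.R.fdelta_fsupp[OF AB[OF x] n] by simp
        define s where "s = \<sigma> n"
        have s: "s \<in> carrier S" "s \<odot>\<^bsub>N\<^esub> u = n" using \<sigma> n s_def by auto
        let ?D = "fdelta S"
        \<comment> \<open>\<open>g1\<close> to \<open>g3\<close> turn c (x \<otimes> su) into csx
          \<otimes> u, \<open>g4\<close> merges this with e \<otimes> u, and \<open>g5\<close>
          replaces the rest of \<phi> by e \<otimes> u.\<close>
        define g1 where "g1 = fminus S (?D (x, s \<odot>\<^bsub>N\<^esub> u)) (fscale S s (?D (x, u)))"
        define g2 where "g2 = fminus S (?D (s \<odot>\<^bsub>B\<^esub> x, u)) (fscale S s (?D (x, u)))"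
        define g3 where "g3 = fminus S (?D (c \<odot>\<^bsub>B\<^esub> (s \<odot>\<^bsub>B\<^esub> x), u)) (fscale S c (?D (s \<odot>\<^bsub>B\<^esub> x, u)))"
        define g4 where "g4 = fminus S (?D (c \<odot>\<^bsub>B\<^esub> (s \<odot>\<^bsub>B\<^esub> x) \<oplus>\<^bsub>B\<^esub> e, u))
          (fadd S (?D (c \<odot>\<^bsub>B\<^esub> (s \<odot>\<^bsub>B\<^esub> x), u)) (?D (e, u)))"
        define g5 where "g5 = fminus S \<phi>' (?D (e, u))"
        have sx: "s \<odot>\<^bsub>B\<^esub> x \<in> A" "c \<odot>\<^bsub>B\<^esub> (s \<odot>\<^bsub>B\<^esub> x) \<in> A" using AE(4) s c x by auto
        have "g1 \<in> ?G" "g2 \<in> ?G" "g3 \<in> ?G" "g4 \<in> ?G"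
          unfolding tensor_rels_def g1_def g2_def g3_def g4_def
          using x u s(1) c sx IH(1) e_def by blast+
        then have W: "g1 \<in> ?W" "g2 \<in> ?W" "g3 \<in> ?W" "g4 \<in> ?W" using base by auto
        have W5: "g5 \<in> ?W" using IH(2) by (simp add: g5_def e_def)
        let ?m = "\<ominus>\<^bsub>S\<^esub> \<one>\<^bsub>S\<^esub>"
        let ?h = "fadd S (fscale S c (fadd S g1 (fscale S ?m g2)))
          (fadd S (fscale S ?m g3) (fadd S (fscale S ?m g4) g5))"
        have "?h \<in> ?W" using W W5 add scale c by simp
        moreover have "?h = fminus S \<phi> (?D (c \<odot>\<^bsub>B\<^esub> (s \<odot>\<^bsub>B\<^esub> x) \<oplus>\<^bsub>B\<^esub> e, u))"
        proof
          fix q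
          define d1 d2 d3 d4 d5 d6 f where d: "d1 = ?D (x, s \<odot>\<^bsub>N\<^esub> u) q" "d2 = ?D (x, u) q"
            "d3 = ?D (s \<odot>\<^bsub>B\<^esub> x, u) q" "d4 = ?D (c \<odot>\<^bsub>B\<^esub> (s \<odot>\<^bsub>B\<^esub> x), u) q"
            "d5 = ?D (e, u) q" "d6 = ?D (c \<odot>\<^bsub>B\<^esub> (s \<odot>\<^bsub>B\<^esub> x) \<oplus>\<^bsub>B\<^esub> e, u) q" "f = \<phi>' q"
          have [simp]: "d1 \<in> carrier S" "d2 \<in> carrier S" "d3 \<in> carrier S" "d4 \<in> carrier S"
            "d5 \<in> carrier S" "d6 \<in> carrier S" "f \<in> carrier S"
            using B.R.fsuppD[OF \<phi>'] by (simp_all add: d)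
          have "c \<otimes>\<^bsub>S\<^esub> ((d1 \<ominus>\<^bsub>S\<^esub> s \<otimes>\<^bsub>S\<^esub> d2) \<oplus>\<^bsub>S\<^esub> ?m \<otimes>\<^bsub>S\<^esub> (d3 \<ominus>\<^bsub>S\<^esub> s \<otimes>\<^bsub>S\<^esub> d2)) \<oplus>\<^bsub>S\<^esub>
            (?m \<otimes>\<^bsub>S\<^esub> (d4 \<ominus>\<^bsub>S\<^esub> c \<otimes>\<^bsub>S\<^esub> d3) \<oplus>\<^bsub>S\<^esub> (?m \<otimes>\<^bsub>S\<^esub> (d6 \<ominus>\<^bsub>S\<^esub> (d4 \<oplus>\<^bsub>S\<^esub> d5)) \<oplus>\<^bsub>S\<^esub> (f \<ominus>\<^bsub>S\<^esub> d5)))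
            = (c \<otimes>\<^bsub>S\<^esub> d1 \<oplus>\<^bsub>S\<^esub> f) \<ominus>\<^bsub>S\<^esub> d6"
            by (rule B.R.lincomb_identity) (simp_all add: s(1) c)
          then show "?h q = fminus S \<phi> (?D (c \<odot>\<^bsub>B\<^esub> (s \<odot>\<^bsub>B\<^esub> x) \<oplus>\<^bsub>B\<^esub> e, u)) q"
            unfolding \<phi>_eq g1_def g2_def g3_def g4_def g5_def fminus_def fadd_def fscale_def
            by (simp add: s(2)[symmetric] d del: s(2))
        qed
        ultimately show ?thesis
          using ev s_def sx IH(1) AE(5) e_def by simp
      qed
    qed
  qed
  then show "tensor_eval S B \<sigma> \<phi> \<in> A"
    and "fminus S \<phi> (fdelta S (tensor_eval S B \<sigma> \<phi>, u)) \<in> fspan S (tensor_rels S B N A)"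
    using assms(2) by (auto simp: fsupp_def)
qed

text \<open>Evaluation and reduction identify X \<otimes> N with X/rX, for X = A and for X = B. The
  induced map is A/rA \<rightarrow> B/rB, whose kernel is (A \<inter> rB)/rA.\<close>

lemma tensor_inj_cyclic_iff:
  assumes A: "submodule A S B"
  shows "tensor_inj S N A B \<longleftrightarrow>
    (\<forall>b\<in>carrier B. r \<odot>\<^bsub>B\<^esub> b \<in> A \<longrightarrow> (\<exists>a\<in>A. r \<odot>\<^bsub>B\<^esub> b = r \<odot>\<^bsub>B\<^esub> a))"
proof -
  note AE = B.submoduleE[OF A]
  have ru: "r \<odot>\<^bsub>N\<^esub> u = \<zero>\<^bsub>N\<^esub>" using ann[OF r] r by (metis B.R.one_closed B.R.r_one)
  \<comment> \<open>rx \<otimes> u = x \<otimes> ru = 0, and only x itself is needed in X for these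
    relations.\<close>
  have vanish: "fdelta S (r \<odot>\<^bsub>B\<^esub> x, u) \<in> fspan S (tensor_rels S B N X)"
    if X: "submodule X S B" and x: "x \<in> X" for x X
  proof -
    let ?G = "tensor_rels S B N X" let ?W = "fspan S ?G"
    have Gc: "?G \<subseteq> UNIV \<rightarrow> carrier S"
      using tensor_rels_fsupp[OF X] B.R.fsuppD by blast
    note add = B.R.fspan_fadd[OF Gc] and scale = B.R.fspan_fscale[OF Gc]
      and base = B.R.fspan_base[OF Gc]
    define g1 where "g1 = fminus S (fdelta S (r \<odot>\<^bsub>B\<^esub> x, u)) (fscale S r (fdelta S (x, u)))"
    define g2 where "g2 = fminus S (fdelta S (x, r \<odot>\<^bsub>N\<^esub> u)) (fscale S r (fdelta S (x, u)))"
    define g3 where "g3 = fminus S (fdelta S (x, \<zero>\<^bsub>S\<^esub> \<odot>\<^bsub>N\<^esub> u)) (fscale S \<zero>\<^bsub>S\<^esub> (fdelta S (x, u)))"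
    have "g1 \<in> ?G" "g2 \<in> ?G" "g3 \<in> ?G"
      unfolding tensor_rels_def g1_def g2_def g3_def using x u r B.R.zero_closed by blast+
    then have "fadd S g1 (fadd S (fscale S (\<ominus>\<^bsub>S\<^esub> \<one>\<^bsub>S\<^esub>) g2) g3) \<in> ?W"
      using add scale base by simp
    moreover have "fadd S g1 (fadd S (fscale S (\<ominus>\<^bsub>S\<^esub> \<one>\<^bsub>S\<^esub>) g2) g3) = fdelta S (r \<odot>\<^bsub>B\<^esub> x, u)"
    proof
      fix q
      define d1 d2 d3 where d: "d1 = fdelta S (r \<odot>\<^bsub>B\<^esub> x, u) q" "d2 = fdelta S (x, u) q"
        "d3 = fdelta S (x, \<zero>\<^bsub>N\<^esub>) q"
      have [simp]: "d1 \<in> carrier S" "d2 \<in> carrier S" "d3 \<in> carrier S" by (simp_all add: d)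
      have "(d1 \<ominus>\<^bsub>S\<^esub> r \<otimes>\<^bsub>S\<^esub> d2) \<oplus>\<^bsub>S\<^esub> (\<ominus>\<^bsub>S\<^esub> \<one>\<^bsub>S\<^esub> \<otimes>\<^bsub>S\<^esub> (d3 \<ominus>\<^bsub>S\<^esub> r \<otimes>\<^bsub>S\<^esub> d2) \<oplus>\<^bsub>S\<^esub> (d3 \<ominus>\<^bsub>S\<^esub> \<zero>\<^bsub>S\<^esub> \<otimes>\<^bsub>S\<^esub> d2)) = d1"
        using r by (intro B.R.lincomb_identity') simp_all
      then show "fadd S g1 (fadd S (fscale S (\<ominus>\<^bsub>S\<^esub> \<one>\<^bsub>S\<^esub>) g2) g3) q = fdelta S (r \<odot>\<^bsub>B\<^esub> x, u) q"
        unfolding g1_def g2_def g3_def fminus_def fadd_def fscale_def using u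
        by (simp only: ru d N.smult_l_null)
    qed
    ultimately show ?thesis by simp
  qed
  show ?thesis
  proof
    assume inj: "tensor_inj S N A B"
    show "\<forall>b\<in>carrier B. r \<odot>\<^bsub>B\<^esub> b \<in> A \<longrightarrow> (\<exists>a\<in>A. r \<odot>\<^bsub>B\<^esub> b = r \<odot>\<^bsub>B\<^esub> a)"
    proof (intro ballI impI)
      fix b assume b: "b \<in> carrier B" and rb: "r \<odot>\<^bsub>B\<^esub> b \<in> A"
      have "fdelta S (r \<odot>\<^bsub>B\<^esub> b, u) \<in> fspan S (tensor_rels S B N A)"
        using inj vanish[OF B.carrier_is_submodule b] B.R.fdelta_fsupp[OF rb u]
        by (simp add: tensor_inj_def)
      then have "tensor_eval S B \<sigma> (fdelta S (r \<odot>\<^bsub>B\<^esub> b, u)) \<in> (\<lambda>x. r \<odot>\<^bsub>B\<^esub> x) ` A"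
        using ev_fspan[OF A] by blast
      then have 1: "\<sigma> u \<odot>\<^bsub>B\<^esub> (r \<odot>\<^bsub>B\<^esub> b) \<in> (\<lambda>x. r \<odot>\<^bsub>B\<^esub> x) ` A"
        using tensor_eval_fdelta[OF B \<sigma>(1), where N = N] b r u by simp
      \<comment> \<open>The chosen coordinate of u need not be 1. The correction 1 - \<sigma>(u)
        annihilates u, so it also carries rb into rA.\<close>
      let ?s = "\<one>\<^bsub>S\<^esub> \<oplus>\<^bsub>S\<^esub> \<ominus>\<^bsub>S\<^esub> \<sigma> u"
      have s: "?s \<in> carrier S" using \<sigma>(1) u by simp
      have "?s \<odot>\<^bsub>N\<^esub> u = \<zero>\<^bsub>N\<^esub>"
        using \<sigma> u by (simp add: N.smult_l_distr N.smult_l_minus N.M.r_neg)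
      then have 2: "?s \<odot>\<^bsub>B\<^esub> (r \<odot>\<^bsub>B\<^esub> b) \<in> (\<lambda>x. r \<odot>\<^bsub>B\<^esub> x) ` A"
        using ann_smult[OF s _ A rb] by simp
      have "?s \<odot>\<^bsub>B\<^esub> (r \<odot>\<^bsub>B\<^esub> b) \<oplus>\<^bsub>B\<^esub> \<sigma> u \<odot>\<^bsub>B\<^esub> (r \<odot>\<^bsub>B\<^esub> b) = r \<odot>\<^bsub>B\<^esub> b"
        using \<sigma> u r b by (simp add: B.smult_l_distr B.smult_l_minus B.M.a_assoc B.M.l_neg)
      then show "\<exists>a\<in>A. r \<odot>\<^bsub>B\<^esub> b = r \<odot>\<^bsub>B\<^esub> a"
        using B.submoduleE(5)[OF B.submodule_smult_image[OF A r] 2 1] by auto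
    qed
  next
    assume pure: "\<forall>b\<in>carrier B. r \<odot>\<^bsub>B\<^esub> b \<in> A \<longrightarrow> (\<exists>a\<in>A. r \<odot>\<^bsub>B\<^esub> b = r \<odot>\<^bsub>B\<^esub> a)"
    show "tensor_inj S N A B"
      unfolding tensor_inj_def
    proof (intro ballI impI)
      fix \<phi> assume \<phi>: "\<phi> \<in> fsupp S A (carrier N)"
        and span: "\<phi> \<in> fspan S (tensor_rels S B N (carrier B))"
      let ?G = "tensor_rels S B N A" let ?W = "fspan S ?G"
      have Gc: "?G \<subseteq> UNIV \<rightarrow> carrier S"
        using tensor_rels_fsupp[OF A] B.R.fsuppD by blast
      \<comment> \<open>A tensor vanishing over B has its value in rB \<inter> A = rA; being of the
        form ra \<otimes> u, it vanishes over A already.\<close>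
      obtain b where b: "b \<in> carrier B" "tensor_eval S B \<sigma> \<phi> = r \<odot>\<^bsub>B\<^esub> b"
        using ev_fspan[OF B.carrier_is_submodule span] by auto
      obtain a where a: "a \<in> A" "tensor_eval S B \<sigma> \<phi> = r \<odot>\<^bsub>B\<^esub> a" using pure b reduce(1)[OF A \<phi>] by auto
      have "fadd S (fminus S \<phi> (fdelta S (r \<odot>\<^bsub>B\<^esub> a, u))) (fdelta S (r \<odot>\<^bsub>B\<^esub> a, u)) \<in> ?W"
        using B.R.fspan_fadd[OF Gc] reduce(2)[OF A \<phi>] vanish[OF A a(1)] a(2) by simp
      moreover have "fadd S (fminus S \<phi> (fdelta S (r \<odot>\<^bsub>B\<^esub> a, u))) (fdelta S (r \<odot>\<^bsub>B\<^esub> a, u)) = \<phi>"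
        using B.R.fsuppD[OF \<phi>] by (auto simp: fadd_def fminus_def B.R.minus_eq B.R.a_assoc B.R.l_neg)
      ultimately show "\<phi> \<in> ?W" by simp
    qed
  qed
qed

end

section \<open>RD-essential quotients\<close>

context abelian_group
begin

lemma a_inv_zero: "\<ominus> \<zero> = \<zero>"
  by (rule minus_equality) auto

lemma a_minus_zero: "x \<in> carrier G \<Longrightarrow> x \<ominus> \<zero> = x"
  by (simp add: minus_eq a_inv_zero)

lemma a_minus_add_self:
  assumes "x \<in> carrier G" "y \<in> carrier G"
  shows "x \<ominus> (y \<oplus> x) = \<ominus> y"
proof -
  have "x \<ominus> (y \<oplus> x) = x \<oplus> (\<ominus> y \<oplus> \<ominus> x)" using assms by (simp add: minus_eq minus_add)
  also have "\<dots> = \<ominus> y \<oplus> (x \<oplus> \<ominus> x)" using assms a_lcomm[of x "\<ominus> y" "\<ominus> x"] by simp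
  finally show ?thesis using assms by (simp add: r_neg)
qed

end

lemma RD_pure_iff:
  assumes B: "module R B" and A: "submodule A R B"
  shows "RD_pure R A B \<longleftrightarrow>
    (\<forall>r\<in>carrier R. \<forall>b\<in>carrier B. r \<odot>\<^bsub>B\<^esub> b \<in> A \<longrightarrow> (\<exists>a\<in>A. r \<odot>\<^bsub>B\<^esub> b = r \<odot>\<^bsub>B\<^esub> a))"
proof -
  interpret B: module R B by fact
  have "tensor_inj R (cyclic_mod R r) A B \<longleftrightarrow>
    (\<forall>b\<in>carrier B. r \<odot>\<^bsub>B\<^esub> b \<in> A \<longrightarrow> (\<exists>a\<in>A. r \<odot>\<^bsub>B\<^esub> b = r \<odot>\<^bsub>B\<^esub> a))" if "r \<in> carrier R" for r
    by (rule tensor_inj_cyclic_iff[OF B B.R.cyclic_mod_facts(1,3)[OF that] that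
        B.R.cyclic_mod_facts(2,4)[OF that] A])
  then show ?thesis by (simp add: RD_pure_def)
qed

text \<open>Meant for projections onto quotients, with or without a transport to another type. The
  target carries no axioms of its own: it becomes a module as an image of M.\<close>

locale module_epi =
  fixes R :: "('r,'c) ring_scheme" and M :: "('r,'m) module" and Q :: "('r,'q) module"
    and \<pi> :: "'m \<Rightarrow> 'q"
  assumes M: "module R M"
    and carrier_Q: "carrier Q = \<pi> ` carrier M"
    and zero_Q: "\<zero>\<^bsub>Q\<^esub> = \<pi> \<zero>\<^bsub>M\<^esub>"
    and \<pi>_add: "\<And>x y. \<lbrakk>x \<in> carrier M; y \<in> carrier M\<rbrakk> \<Longrightarrow> \<pi> (x \<oplus>\<^bsub>M\<^esub> y) = \<pi> x \<oplus>\<^bsub>Q\<^esub> \<pi> y"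
    and \<pi>_smult: "\<And>c x. \<lbrakk>c \<in> carrier R; x \<in> carrier M\<rbrakk> \<Longrightarrow> \<pi> (c \<odot>\<^bsub>M\<^esub> x) = c \<odot>\<^bsub>Q\<^esub> \<pi> x"
begin

sublocale M: module R M by (rule M)
sublocale Q: module R Q
  by (rule module_hom_image[OF M carrier_Q zero_Q \<pi>_add \<pi>_smult])

lemma \<pi>_closed [simp]: "x \<in> carrier M \<Longrightarrow> \<pi> x \<in> carrier Q"
  by (simp add: carrier_Q)

lemma \<pi>_uminus: "x \<in> carrier M \<Longrightarrow> \<pi> (\<ominus>\<^bsub>M\<^esub> x) = \<ominus>\<^bsub>Q\<^esub> \<pi> x"
  using \<pi>_smult[of "\<ominus>\<^bsub>R\<^esub> \<one>\<^bsub>R\<^esub>" x] by (simp add: M.smult_l_minus Q.smult_l_minus)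

lemma \<pi>_minus: "\<lbrakk>x \<in> carrier M; y \<in> carrier M\<rbrakk> \<Longrightarrow> \<pi> (x \<ominus>\<^bsub>M\<^esub> y) = \<pi> x \<ominus>\<^bsub>Q\<^esub> \<pi> y"
  by (simp add: M.M.minus_eq Q.M.minus_eq \<pi>_add \<pi>_uminus)

lemma submodule_image:
  assumes A: "submodule A R M"
  shows "submodule (\<pi> ` A) R Q"
proof (rule Q.submoduleI)
  note AE = M.submoduleE[OF A]
  have AM: "a \<in> carrier M" if "a \<in> A" for a using that AE(1) by auto
  show "\<pi> ` A \<subseteq> carrier Q" using AM by auto
  show "\<zero>\<^bsub>Q\<^esub> \<in> \<pi> ` A" using submodule_zero[OF M A] by (simp add: zero_Q)
  show "\<ominus>\<^bsub>Q\<^esub> a \<in> \<pi> ` A" if "a \<in> \<pi> ` A" for a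
    using that AM AE(3) by (auto simp flip: \<pi>_uminus)
  show "a \<oplus>\<^bsub>Q\<^esub> b \<in> \<pi> ` A" if "a \<in> \<pi> ` A" "b \<in> \<pi> ` A" for a b
    using that AM AE(5) by (auto simp flip: \<pi>_add)
  show "c \<odot>\<^bsub>Q\<^esub> x \<in> \<pi> ` A" if "c \<in> carrier R" "x \<in> \<pi> ` A" for c x
    using that AM AE(4) by (auto simp flip: \<pi>_smult)
qed

lemma submodule_vimage:
  assumes L: "submodule L R Q"
  shows "submodule {x \<in> carrier M. \<pi> x \<in> L} R M"
  using Q.submoduleE[OF L] submodule_zero[OF Q.module_axioms L]
  by (intro M.submoduleI) (auto simp: \<pi>_add \<pi>_smult \<pi>_uminus zero_Q)

end

lemma (in module) submodule_Union_chain: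
  assumes "C \<noteq> {}" "\<And>X. X \<in> C \<Longrightarrow> submodule X R M"
    and chain: "\<And>X Y. \<lbrakk>X \<in> C; Y \<in> C\<rbrakk> \<Longrightarrow> X \<subseteq> Y \<or> Y \<subseteq> X"
  shows "submodule (\<Union>C) R M"
proof (rule submoduleI)
  show "\<Union>C \<subseteq> carrier M" using submoduleE(1) assms(2) by blast
  obtain X where X: "X \<in> C" using assms(1) by auto
  then have "\<zero>\<^bsub>M\<^esub> \<in> X" using subgroup.one_closed[OF submodule.axioms(1)[OF assms(2)]] by fastforce
  then show "\<zero>\<^bsub>M\<^esub> \<in> \<Union>C" using X by auto
  show "\<ominus>\<^bsub>M\<^esub> a \<in> \<Union>C" if "a \<in> \<Union>C" for a using that submoduleE(3) assms(2) by blast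
  show "c \<odot>\<^bsub>M\<^esub> x \<in> \<Union>C" if "c \<in> carrier R" "x \<in> \<Union>C" for c x
    using that submoduleE(4) assms(2) by blast
  show "a \<oplus>\<^bsub>M\<^esub> b \<in> \<Union>C" if ab: "a \<in> \<Union>C" "b \<in> \<Union>C" for a b
  proof -
    obtain X Y where XY: "X \<in> C" "a \<in> X" "Y \<in> C" "b \<in> Y" using ab by auto
    then consider "a \<in> Y" | "b \<in> X" using chain by blast
    then show ?thesis using XY submoduleE(5)[OF assms(2)] by cases blast+
  qed
qed

text \<open>For N \<subseteq> A \<inter> K this says that A/N embeds in M/K as an RD-pure submodule; the case r = 0
  forces A \<inter> K \<subseteq> N.\<close>

definition RD_pure_over ::
  "('r,'c) ring_scheme \<Rightarrow> ('r,'m) module \<Rightarrow> 'm set \<Rightarrow> 'm set \<Rightarrow> 'm set \<Rightarrow> bool" where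
  "RD_pure_over R M A N K \<longleftrightarrow>
     (\<forall>r\<in>carrier R. \<forall>m\<in>carrier M. \<forall>a\<in>A. r \<odot>\<^bsub>M\<^esub> m \<ominus>\<^bsub>M\<^esub> a \<in> K \<longrightarrow>
        (\<exists>a'\<in>A. a \<ominus>\<^bsub>M\<^esub> r \<odot>\<^bsub>M\<^esub> a' \<in> N))"

lemma RD_pure_overD:
  "\<lbrakk>RD_pure_over R M A N K; r \<in> carrier R; m \<in> carrier M; a \<in> A; r \<odot>\<^bsub>M\<^esub> m \<ominus>\<^bsub>M\<^esub> a \<in> K\<rbrakk>
    \<Longrightarrow> \<exists>a'\<in>A. a \<ominus>\<^bsub>M\<^esub> r \<odot>\<^bsub>M\<^esub> a' \<in> N"
  by (auto simp: RD_pure_over_def)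

lemma RD_pure_over_Int:
  assumes M: "module R M" and A: "submodule A R M" and K: "submodule K R M"
    and N: "N \<subseteq> carrier M"
    and pure: "RD_pure_over R M A N K" and a: "a \<in> A" "a \<in> K"
  shows "a \<in> N"
proof -
  interpret M: module R M by fact
  have aM: "a \<in> carrier M" using M.submoduleE(1)[OF A] a by auto
  have "\<zero>\<^bsub>R\<^esub> \<odot>\<^bsub>M\<^esub> \<zero>\<^bsub>M\<^esub> \<ominus>\<^bsub>M\<^esub> a \<in> K"
    using M.submoduleE(3)[OF K a(2)] aM by (simp add: M.M.minus_eq)
  then obtain a' where "a' \<in> A" "a \<ominus>\<^bsub>M\<^esub> \<zero>\<^bsub>R\<^esub> \<odot>\<^bsub>M\<^esub> a' \<in> N"
    using RD_pure_overD[OF pure _ _ a(1)] by blast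
  moreover have "a' \<in> carrier M" using M.submoduleE(1)[OF A] \<open>a' \<in> A\<close> by auto
  ultimately show ?thesis using aM by (simp add: M.M.a_minus_zero)
qed

text \<open>A submodule K that is maximal among those keeping A/N RD-pure in M/K makes M/K an RD-essential
  extension of A/N.  The map j only serves to realise M/K on the carrier type of the hypothesis.\<close>

lemma RD_essential_quotient:
  fixes R :: "('r,'c) ring_scheme" and M :: "('r,'m) module" and j :: "'m \<Rightarrow> 't"
  assumes hyp: "\<forall>(B :: ('r,'t set) module) A.
      module R B \<and> submodule A R B \<and> RD_essential R A B \<longrightarrow> essential R A B"
    and M: "module R M" and A: "submodule A R M" and N: "submodule N R M" and NA: "N \<subseteq> A"
    and j: "inj_on j (carrier M)"
    and pure: "RD_pure_over R M A N N"
  obtains K where "submodule K R M" "N \<subseteq> K" "RD_pure_over R M A N K"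
    "\<And>m. \<lbrakk>m \<in> carrier M; m \<notin> K\<rbrakk>
      \<Longrightarrow> \<exists>s\<in>carrier R. \<exists>a\<in>A. a \<notin> N \<and> s \<odot>\<^bsub>M\<^esub> m \<ominus>\<^bsub>M\<^esub> a \<in> K"
proof -
  interpret M: module R M by fact
  note AE = M.submoduleE[OF A] and NE = M.submoduleE[OF N]
  have AM: "a \<in> carrier M" if "a \<in> A" for a using that AE(1) by auto
  define \<K> where "\<K> = {K. submodule K R M \<and> N \<subseteq> K \<and> RD_pure_over R M A N K}"
  have "\<exists>K\<in>\<K>. \<forall>X\<in>\<K>. K \<subseteq> X \<longrightarrow> X = K"
  proof (rule subset_Zorn_nonempty)
    show "\<K> \<noteq> {}" using N pure by (auto simp: \<K>_def)
    fix C assume C: "C \<noteq> {}" and chain: "subset.chain \<K> C"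
    have sub: "X \<in> \<K>" if "X \<in> C" for X using chain that by (auto simp: subset.chain_def)
    have "submodule (\<Union>C) R M"
    proof (rule M.submodule_Union_chain[OF C])
      show "submodule X R M" if "X \<in> C" for X using sub[OF that] by (simp add: \<K>_def)
      show "X \<subseteq> Y \<or> Y \<subseteq> X" if "X \<in> C" "Y \<in> C" for X Y
        using chain that unfolding subset.chain_def by blast
    qed
    moreover have "N \<subseteq> \<Union>C" using C sub by (auto simp: \<K>_def)
    \<comment> \<open>Each instance of the condition mentions a single element of the union, which
      lies in one member of the chain.\<close>
    moreover have "RD_pure_over R M A N (\<Union>C)"
      using sub by (fastforce simp: \<K>_def RD_pure_over_def)
    ultimately show "\<Union>C \<in> \<K>" by (simp add: \<K>_def)
  qed
  then obtain K where "K \<in> \<K>" and max: "\<And>X. \<lbrakk>X \<in> \<K>; K \<subseteq> X\<rbrakk> \<Longrightarrow> X = K" by blast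
  then have K: "submodule K R M" and NK: "N \<subseteq> K" and pureK: "RD_pure_over R M A N K"
    by (auto simp: \<K>_def)
  define Q where "Q = transport_module ((`) j) (quot_module M K)"
  define \<pi> where "\<pi> m = j ` (K +>\<^bsub>M\<^esub> m)" for m
  have cosM: "K +>\<^bsub>M\<^esub> m \<subseteq> carrier M" if "m \<in> carrier M" for m
    using M.M.a_r_coset_subset_G[OF M.submoduleE(1)[OF K] that] .
  have injj: "inj_on ((`) j) (carrier (quot_module M K))"
    using cosM inj_on_image_eq_iff[OF j] by (auto simp: inj_on_def[of "(`) j"] quot_module_simps[OF M K])
  have cos: "K +>\<^bsub>M\<^esub> m \<in> carrier (quot_module M K)" if "m \<in> carrier M" for m
    using that by (simp add: quot_module_simps[OF M K])
  interpret \<pi>: module_epi R M Q \<pi>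
  proof
    show "carrier Q = \<pi> ` carrier M"
      by (auto simp: Q_def \<pi>_def transport_module_simps quot_module_simps(1)[OF M K])
    show "\<zero>\<^bsub>Q\<^esub> = \<pi> \<zero>\<^bsub>M\<^esub>"
      by (simp add: Q_def \<pi>_def transport_module_simps quot_module_simps(2)[OF M K])
    show "\<pi> (x \<oplus>\<^bsub>M\<^esub> y) = \<pi> x \<oplus>\<^bsub>Q\<^esub> \<pi> y" if "x \<in> carrier M" "y \<in> carrier M" for x y
      using that transport_module_simps(3)[OF injj cos cos]
      by (simp add: Q_def \<pi>_def quot_module_simps(3)[OF M K])
    show "\<pi> (c \<odot>\<^bsub>M\<^esub> x) = c \<odot>\<^bsub>Q\<^esub> \<pi> x" if "c \<in> carrier R" "x \<in> carrier M" for c x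
      using that transport_module_simps(4)[OF injj cos]
      by (simp add: Q_def \<pi>_def quot_module_simps(4)[OF M K])
  qed
  have ker: "\<pi> x = \<pi> y \<longleftrightarrow> x \<ominus>\<^bsub>M\<^esub> y \<in> K" if "x \<in> carrier M" "y \<in> carrier M" for x y
    using a_rcos_eq_iff[OF M K that] inj_on_image_eq_iff[OF j cosM cosM] that by (simp add: \<pi>_def)
  have ker0: "\<pi> x = \<zero>\<^bsub>Q\<^esub> \<longleftrightarrow> x \<in> K" if "x \<in> carrier M" for x
    using ker[of x "\<zero>\<^bsub>M\<^esub>"] that by (simp add: \<pi>.zero_Q M.M.a_minus_zero)
  have QA: "submodule (\<pi> ` A) R Q" by (rule \<pi>.submodule_image[OF A])
  have "RD_essential R (\<pi> ` A) Q"
    unfolding RD_essential_def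
  proof (intro conjI allI impI)
    show "RD_pure R (\<pi> ` A) Q"
      unfolding RD_pure_iff[OF \<pi>.Q.module_axioms QA]
    proof (intro ballI impI)
      fix r b assume r: "r \<in> carrier R" and "b \<in> carrier Q" and "r \<odot>\<^bsub>Q\<^esub> b \<in> \<pi> ` A"
      then obtain m a where m: "m \<in> carrier M" "b = \<pi> m" and a: "a \<in> A" "r \<odot>\<^bsub>Q\<^esub> \<pi> m = \<pi> a"
        using \<pi>.carrier_Q by auto
      then have "r \<odot>\<^bsub>M\<^esub> m \<ominus>\<^bsub>M\<^esub> a \<in> K" using ker[of "r \<odot>\<^bsub>M\<^esub> m" a] r AM by (simp add: \<pi>.\<pi>_smult)
      then obtain a' where a': "a' \<in> A" "a \<ominus>\<^bsub>M\<^esub> r \<odot>\<^bsub>M\<^esub> a' \<in> N"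
        using RD_pure_overD[OF pureK r m(1) a(1)] by blast
      then have "\<pi> a = r \<odot>\<^bsub>Q\<^esub> \<pi> a'"
        using ker[of a "r \<odot>\<^bsub>M\<^esub> a'"] AM a(1) r NK by (auto simp: \<pi>.\<pi>_smult)
      then show "\<exists>a\<in>\<pi> ` A. r \<odot>\<^bsub>Q\<^esub> b = r \<odot>\<^bsub>Q\<^esub> a" using a m a' by auto
    qed
    fix L assume "submodule L R Q \<and> L \<noteq> {\<zero>\<^bsub>Q\<^esub>}"
    then have L: "submodule L R Q" and L0: "L \<noteq> {\<zero>\<^bsub>Q\<^esub>}" by auto
    show "L \<inter> \<pi> ` A \<noteq> {\<zero>\<^bsub>Q\<^esub>} \<or> \<not> RD_pure R ((\<lambda>a. L +>\<^bsub>Q\<^esub> a) ` \<pi> ` A) (quot_module Q L)"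
    proof (rule ccontr)
      assume "\<not> ?thesis"
      then have disj: "L \<inter> \<pi> ` A = {\<zero>\<^bsub>Q\<^esub>}"
        and pureL: "RD_pure R ((\<lambda>a. L +>\<^bsub>Q\<^esub> a) ` \<pi> ` A) (quot_module Q L)" by auto
      interpret \<rho>: module_epi R Q "quot_module Q L" "\<lambda>a. L +>\<^bsub>Q\<^esub> a"
        by unfold_locales (simp_all add: quot_module_simps[OF \<pi>.Q.module_axioms L] \<pi>.Q.module_axioms)
      note pureL' = pureL[unfolded RD_pure_iff[OF \<rho>.Q.module_axioms \<rho>.submodule_image[OF QA]]]
      \<comment> \<open>A submodule L that violates RD-essentiality is pulled back to M. The
        preimage contains K and keeps A/N RD-pure, so by maximality it equals K, and L is
        zero.\<close>
      define K' where "K' = {m \<in> carrier M. \<pi> m \<in> L}"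
      have K': "submodule K' R M" unfolding K'_def by (rule \<pi>.submodule_vimage[OF L])
      have KK': "K \<subseteq> K'"
      proof
        fix x assume x: "x \<in> K"
        then have "x \<in> carrier M" using M.submoduleE(1)[OF K] by blast
        then show "x \<in> K'"
          using x ker0[of x] submodule_zero[OF \<pi>.Q.module_axioms L] by (simp add: K'_def)
      qed
      have "RD_pure_over R M A N K'"
        unfolding RD_pure_over_def
      proof (intro ballI impI)
        fix r m a assume r: "r \<in> carrier R" and m: "m \<in> carrier M" and a: "a \<in> A"
          and "r \<odot>\<^bsub>M\<^esub> m \<ominus>\<^bsub>M\<^esub> a \<in> K'"
        then have "r \<odot>\<^bsub>Q\<^esub> \<pi> m \<ominus>\<^bsub>Q\<^esub> \<pi> a \<in> L" using AM by (simp add: K'_def \<pi>.\<pi>_smult \<pi>.\<pi>_minus)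
        then have eq: "r \<odot>\<^bsub>quot_module Q L\<^esub> (L +>\<^bsub>Q\<^esub> \<pi> m) = L +>\<^bsub>Q\<^esub> \<pi> a"
          using r m AM[OF a] a_rcos_eq_iff[OF \<pi>.Q.module_axioms L] by (simp flip: \<rho>.\<pi>_smult)
        then have "r \<odot>\<^bsub>quot_module Q L\<^esub> (L +>\<^bsub>Q\<^esub> \<pi> m) \<in> (\<lambda>a. L +>\<^bsub>Q\<^esub> a) ` \<pi> ` A"
          using a by simp
        from pureL'[rule_format, OF r \<rho>.\<pi>_closed[OF \<pi>.\<pi>_closed[OF m]] this]
        obtain a' where a': "a' \<in> A"
          "r \<odot>\<^bsub>quot_module Q L\<^esub> (L +>\<^bsub>Q\<^esub> \<pi> m) = r \<odot>\<^bsub>quot_module Q L\<^esub> (L +>\<^bsub>Q\<^esub> \<pi> a')"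
          by blast
        let ?x = "a \<ominus>\<^bsub>M\<^esub> r \<odot>\<^bsub>M\<^esub> a'"
        \<comment> \<open>RD-purity modulo L only places the image of \<open>?x\<close> in L.
          Disjointness of L from the image of A then puts \<open>?x\<close> into K, and A \<inter> K
          \<subseteq> N puts it into N.\<close>
        have xA: "?x \<in> A" by (rule submodule_minus[OF M A a AE(4)[OF r a'(1)]])
        have "\<pi> a \<ominus>\<^bsub>Q\<^esub> r \<odot>\<^bsub>Q\<^esub> \<pi> a' \<in> L"
          using a'(2) eq r AM[OF a'(1)] AM[OF a] a_rcos_eq_iff[OF \<pi>.Q.module_axioms L]
          by (simp flip: \<rho>.\<pi>_smult)
        then have "\<pi> ?x \<in> L" using r AM[OF a'(1)] AM[OF a] by (simp add: \<pi>.\<pi>_smult \<pi>.\<pi>_minus)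
        then have "\<pi> ?x = \<zero>\<^bsub>Q\<^esub>" using disj xA by blast
        then have "?x \<in> K" using ker0 AM[OF xA] by simp
        then have "?x \<in> N" by (rule RD_pure_over_Int[OF M A K NE(1) pureK xA])
        then show "\<exists>a'\<in>A. a \<ominus>\<^bsub>M\<^esub> r \<odot>\<^bsub>M\<^esub> a' \<in> N" using a' by blast
      qed
      then have "K' = K" using max[OF _ KK'] K' NK KK' by (auto simp: \<K>_def)
      then have "x = \<zero>\<^bsub>Q\<^esub>" if "x \<in> L" for x
        using that \<pi>.Q.submoduleE(1)[OF L] ker0 by (auto simp: K'_def \<pi>.carrier_Q)
      then have "L = {\<zero>\<^bsub>Q\<^esub>}" using submodule_zero[OF \<pi>.Q.module_axioms L] by blast
      with L0 show False by contradiction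
    qed
  qed
  then have ess: "essential R (\<pi> ` A) Q" using hyp QA \<pi>.Q.module_axioms by blast
  show thesis
  proof (rule that[OF K NK pureK])
    fix m assume m: "m \<in> carrier M" "m \<notin> K"
    \<comment> \<open>Essentiality is applied to the cyclic submodule generated by the class of m; a
      nonzero common element supplies s and a.\<close>
    let ?L = "(\<lambda>c. c \<odot>\<^bsub>Q\<^esub> \<pi> m) ` carrier R"
    have L: "submodule ?L R Q"
    proof (rule \<pi>.Q.submoduleI)
      show "?L \<subseteq> carrier Q" using m by auto
      show "\<zero>\<^bsub>Q\<^esub> \<in> ?L" using m by (intro image_eqI[of _ _ "\<zero>\<^bsub>R\<^esub>"]) auto
      show "\<ominus>\<^bsub>Q\<^esub> a \<in> ?L" if "a \<in> ?L" for a
        using that m by (auto simp flip: \<pi>.Q.smult_l_minus)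
      show "a \<oplus>\<^bsub>Q\<^esub> b \<in> ?L" if "a \<in> ?L" "b \<in> ?L" for a b
        using that m by (auto simp flip: \<pi>.Q.smult_l_distr)
      show "c \<odot>\<^bsub>Q\<^esub> a \<in> ?L" if "c \<in> carrier R" "a \<in> ?L" for a c
        using that m by (auto simp flip: \<pi>.Q.smult_assoc1)
    qed
    have "\<pi> m \<in> ?L" using m by (intro image_eqI[of _ _ "\<one>\<^bsub>R\<^esub>"]) auto
    then have "?L \<noteq> {\<zero>\<^bsub>Q\<^esub>}" using ker0 m by auto
    then have "?L \<inter> \<pi> ` A \<noteq> {\<zero>\<^bsub>Q\<^esub>}" using ess L by (auto simp: essential_def)
    moreover have "\<zero>\<^bsub>Q\<^esub> \<in> ?L \<inter> \<pi> ` A"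
      using submodule_zero[OF \<pi>.Q.module_axioms] L QA by auto
    ultimately obtain x where "x \<in> ?L" "x \<in> \<pi> ` A" "x \<noteq> \<zero>\<^bsub>Q\<^esub>" by blast
    then obtain s a where s: "s \<in> carrier R" and a: "a \<in> A" and eq: "s \<odot>\<^bsub>Q\<^esub> \<pi> m = \<pi> a"
      and nz: "\<pi> a \<noteq> \<zero>\<^bsub>Q\<^esub>" by auto
    have "s \<odot>\<^bsub>M\<^esub> m \<ominus>\<^bsub>M\<^esub> a \<in> K" using eq ker[of "s \<odot>\<^bsub>M\<^esub> m" a] s m AM[OF a] by (simp add: \<pi>.\<pi>_smult)
    moreover have "a \<notin> N" using nz ker0 AM[OF a] NK by auto
    ultimately show "\<exists>s\<in>carrier R. \<exists>a\<in>A. a \<notin> N \<and> s \<odot>\<^bsub>M\<^esub> m \<ominus>\<^bsub>M\<^esub> a \<in> K" using s a by blast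
  qed
qed

section \<open>Local T-nilpotence\<close>

locale cring_maximal = cring R + P: maximalideal P R for R :: "('r,'c) ring_scheme" (structure) and P
begin

lemma P_carrier [simp]: "q \<in> P \<Longrightarrow> q \<in> carrier R"
  by (rule P.Icarr)

lemma one_notin_P: "\<one> \<notin> P"
  using P.I_notcarr P.one_imp_carrier by blast

lemma mult_notin_P: "\<lbrakk>s \<in> carrier R; t \<in> carrier R; s \<notin> P; t \<notin> P\<rbrakk> \<Longrightarrow> s \<otimes> t \<notin> P"
  using primeideal.I_prime[OF maximalideal_prime[OF P.is_maximalideal]] by blast

text \<open>By maximality P + sR is the whole ring. The relation t s = 1 + q replaces division by s
  where multiples by P are already under control.\<close>

lemma inverse_mod_P:
  assumes s: "s \<in> carrier R" "s \<notin> P"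
  obtains t q where "t \<in> carrier R" "q \<in> P" "t \<otimes> s = \<one> \<oplus> q"
proof -
  let ?J = "set_add R P (PIdl s)"
  have J: "ideal ?J R" by (rule add_ideals[OF P.is_ideal cgenideal_ideal[OF s(1)]])
  have "p \<in> ?J" if "p \<in> P" for p
  proof -
    have "\<zero> \<in> PIdl s" using ideal.axioms(1)[OF cgenideal_ideal[OF s(1)]]
      by (rule additive_subgroup.zero_closed)
    moreover have "p = p \<oplus> \<zero>" using that by simp
    ultimately show ?thesis using that unfolding set_add_def' by blast
  qed
  moreover have "s \<in> ?J"
  proof -
    have "s = \<zero> \<oplus> s" using s by simp
    then show ?thesis using cgenideal_self[OF s(1)] P.zero_closed unfolding set_add_def' by blast
  qed
  moreover have "?J \<subseteq> carrier R" using ideal.Icarr[OF J] by blast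
  ultimately have "?J = carrier R" using P.I_maximal[OF J] s(2) by blast
  then obtain p x where px: "p \<in> P" "x \<in> carrier R" "\<one> = p \<oplus> x \<otimes> s"
    using one_closed unfolding set_add_def' cgenideal_def by blast
  then have "x \<otimes> s = (p \<oplus> x \<otimes> s) \<oplus> \<ominus> p" using s P_carrier[OF px(1)] by algebra
  then have "x \<otimes> s = \<one> \<oplus> \<ominus> p" using px(3) by simp
  then show thesis using that[of x "\<ominus> p"] px by simp
qed

end

definition seq_module :: "('r,'c) ring_scheme \<Rightarrow> (nat \<Rightarrow> 'r) set \<Rightarrow> ('r, nat \<Rightarrow> 'r) module" where
  "seq_module R H = \<lparr>carrier = H, mult = (\<lambda>f g n. f n \<otimes>\<^bsub>R\<^esub> g n), one = (\<lambda>_. \<one>\<^bsub>R\<^esub>),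
     zero = (\<lambda>_. \<zero>\<^bsub>R\<^esub>), add = (\<lambda>f g n. f n \<oplus>\<^bsub>R\<^esub> g n), smult = (\<lambda>c f n. c \<otimes>\<^bsub>R\<^esub> f n)\<rparr>"

lemma seq_module_simps:
  "carrier (seq_module R H) = H" "\<zero>\<^bsub>seq_module R H\<^esub> = (\<lambda>_. \<zero>\<^bsub>R\<^esub>)"
  "f \<oplus>\<^bsub>seq_module R H\<^esub> g = (\<lambda>n. f n \<oplus>\<^bsub>R\<^esub> g n)"
  "c \<odot>\<^bsub>seq_module R H\<^esub> f = (\<lambda>n. c \<otimes>\<^bsub>R\<^esub> f n)"
  by (simp_all add: seq_module_def)

lemma (in cring) seq_module_module:
  assumes H: "\<And>f n. f \<in> H \<Longrightarrow> f n \<in> carrier R"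
    and zero: "(\<lambda>_. \<zero>) \<in> H"
    and add: "\<And>f g. \<lbrakk>f \<in> H; g \<in> H\<rbrakk> \<Longrightarrow> (\<lambda>n. f n \<oplus> g n) \<in> H"
    and smult: "\<And>c f. \<lbrakk>c \<in> carrier R; f \<in> H\<rbrakk> \<Longrightarrow> (\<lambda>n. c \<otimes> f n) \<in> H"
  shows "module R (seq_module R H)"
proof (rule moduleI)
  show "abelian_group (seq_module R H)"
  proof (rule abelian_groupI)
    fix f assume f: "f \<in> carrier (seq_module R H)"
    show "\<exists>g\<in>carrier (seq_module R H). g \<oplus>\<^bsub>seq_module R H\<^esub> f = \<zero>\<^bsub>seq_module R H\<^esub>"
      using f smult[of "\<ominus> \<one>" f] H[of f]
      by (intro bexI[of _ "\<lambda>n. \<ominus> \<one> \<otimes> f n"]) (auto simp: seq_module_simps l_minus l_neg)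
  qed (auto simp: seq_module_simps zero add H a_ac)
qed (auto simp: seq_module_simps is_cring smult H l_distr r_distr m_assoc)

lemma (in cring) seq_module_minus:
  assumes M: "module R (seq_module R H)" and H: "\<And>f n. f \<in> H \<Longrightarrow> f n \<in> carrier R"
    and f: "f \<in> H" and g: "g \<in> H"
  shows "\<ominus>\<^bsub>seq_module R H\<^esub> g = (\<lambda>n. \<ominus> g n)"
    and "f \<ominus>\<^bsub>seq_module R H\<^esub> g = (\<lambda>n. f n \<ominus> g n)"
proof -
  interpret M: module R "seq_module R H" by fact
  have inv: "\<ominus>\<^bsub>seq_module R H\<^esub> g \<in> H" using M.M.a_inv_closed[of g] g by (simp add: seq_module_simps)
  have "(\<lambda>n. g n \<oplus> (\<ominus>\<^bsub>seq_module R H\<^esub> g) n) = (\<lambda>_. \<zero>)"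
    using M.M.r_neg[of g] g by (simp add: seq_module_simps)
  then have neg: "(\<ominus>\<^bsub>seq_module R H\<^esub> g) n \<oplus> g n = \<zero>" for n
    using a_comm[OF H[OF g] H[OF inv], of n n] by (metis (no_types))
  show *: "\<ominus>\<^bsub>seq_module R H\<^esub> g = (\<lambda>n. \<ominus> g n)"
    by (rule ext) (rule minus_equality[OF neg H[OF g] H[OF inv], symmetric])
  show "f \<ominus>\<^bsub>seq_module R H\<^esub> g = (\<lambda>n. f n \<ominus> g n)"
    unfolding M.M.minus_eq * by (simp add: seq_module_simps minus_eq)
qed

context cring_maximal
begin

text \<open>With r n = p 0 \<cdots> p (n - 1), consider the direct sum of the modules R / r n P inside their
  product, extended by the sequences that eventually satisfy D (k + 1) = D k p k.  The sequence r is
  killed by P there, so in an essential extension it agrees with some finitely supported a.  As r is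
  divisible by r m up to its first m entries, RD-purity gives a n = r n for all n, hence
  r n \<in> r n P for large n.\<close>

lemma T_nilpotent:
  fixes \<iota> :: "'r list set \<Rightarrow> 't"
  assumes hyp: "\<forall>(B :: ('r,'t set) module) A.
      module R B \<and> submodule A R B \<and> RD_essential R A B \<longrightarrow> essential R A B"
    and \<iota>: "inj \<iota>"
    and p: "\<And>n. p n \<in> P"
    and r0: "r 0 = \<one>" and rSuc: "\<And>n. r (Suc n) = r n \<otimes> p n"
  shows "\<exists>n. \<exists>s\<in>carrier R - P. s \<otimes> r n = \<zero>"
proof -
  have pR [simp]: "p n \<in> carrier R" for n using p by simp
  have rR [simp]: "r n \<in> carrier R" for n by (induction n) (auto simp: r0 rSuc)
  define I where "I n = (\<lambda>q. r n \<otimes> q) ` P" for n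
  have IR: "d \<in> carrier R" if "d \<in> I n" for d n using that by (auto simp: I_def)
  have I0: "\<zero> \<in> I n" for n unfolding I_def using P.zero_closed by (intro image_eqI[of _ _ "\<zero>"]) auto
  have Iadd: "d \<oplus> e \<in> I n" if "d \<in> I n" "e \<in> I n" for d e n
    using that by (auto simp: I_def P.a_closed simp flip: r_distr)
  have Iminus: "\<ominus> d \<in> I n" if "d \<in> I n" for d n
    using that by (auto simp: I_def simp flip: r_minus)
  have Imult: "c \<otimes> d \<in> I n" if c: "c \<in> carrier R" and d: "d \<in> I n" for c d n
  proof -
    obtain q where q: "q \<in> P" "d = r n \<otimes> q" using d by (auto simp: I_def)
    then have "c \<otimes> d = r n \<otimes> (c \<otimes> q)" using c P_carrier[OF q(1)] by (simp add: m_lcomm)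
    then show ?thesis using P.I_l_closed[OF q(1) c] by (auto simp: I_def)
  qed
  have Idiff: "d \<ominus> e \<in> I n" if "d \<in> I n" "e \<in> I n" for d e n
    using that Iadd Iminus by (simp add: minus_eq)
  define H where "H = {D. (\<forall>n. D n \<in> carrier R) \<and> (\<exists>n0. \<forall>k\<ge>n0. D (Suc k) = D k \<otimes> p k)}"
  have HR: "D n \<in> carrier R" if "D \<in> H" for D n using that by (auto simp: H_def)
  have Hadd: "(\<lambda>n. f n \<oplus> g n) \<in> H" if f: "f \<in> H" and g: "g \<in> H" for f g
  proof -
    obtain n0 n1 where "\<forall>k\<ge>n0. f (Suc k) = f k \<otimes> p k" "\<forall>k\<ge>n1. g (Suc k) = g k \<otimes> p k"
      using f g by (auto simp: H_def)
    then have "\<forall>k\<ge>max n0 n1. f (Suc k) \<oplus> g (Suc k) = (f k \<oplus> g k) \<otimes> p k"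
      using HR[OF f] HR[OF g] by (simp add: l_distr)
    then show ?thesis using HR[OF f] HR[OF g] unfolding H_def by blast
  qed
  have Hsmult: "(\<lambda>n. c \<otimes> f n) \<in> H" if c: "c \<in> carrier R" and f: "f \<in> H" for c f
  proof -
    obtain n0 where "\<forall>k\<ge>n0. f (Suc k) = f k \<otimes> p k" using f by (auto simp: H_def)
    then have "\<forall>k\<ge>n0. c \<otimes> f (Suc k) = (c \<otimes> f k) \<otimes> p k" using HR[OF f] c by (simp add: m_assoc)
    then show ?thesis using HR[OF f] c by (auto simp: H_def)
  qed
  have fin_H: "(\<lambda>n. if n < m then f n else \<zero>) \<in> H" if "\<And>n. f n \<in> carrier R" for f m
    using that by (auto simp: H_def intro!: exI[of _ m])
  let ?M = "seq_module R H"
  have M: "module R ?M"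
    by (rule seq_module_module) (use HR Hadd Hsmult fin_H[of "\<lambda>_. \<zero>" 0] in auto)
  interpret M: module R ?M by (rule M)
  have minus: "\<ominus>\<^bsub>?M\<^esub> g = (\<lambda>n. \<ominus> g n)" "f \<ominus>\<^bsub>?M\<^esub> g = (\<lambda>n. f n \<ominus> g n)"
    if f: "f \<in> H" and g: "g \<in> H" for f g
    by (rule seq_module_minus[OF M _ f g]; rule HR; assumption)+
  define A where "A = {D \<in> H. \<exists>n0. \<forall>n\<ge>n0. D n \<in> I n}"
  define N where "N = {D \<in> H. \<forall>n. D n \<in> I n}"
  have NA: "N \<subseteq> A" by (auto simp: N_def A_def)
  have AH: "D \<in> H" if "D \<in> A" for D using that by (simp add: A_def)
  have Hminus: "(\<lambda>n. \<ominus> f n) \<in> H" if "f \<in> H" for f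
    using M.M.a_inv_closed[of f] that minus(1)[OF that that] by (simp add: seq_module_simps)
  have N: "submodule N R ?M"
  proof (rule M.submoduleI)
    show "N \<subseteq> carrier ?M" by (auto simp: N_def seq_module_simps)
    show "\<zero>\<^bsub>?M\<^esub> \<in> N" using M.M.zero_closed I0 by (simp add: N_def seq_module_simps)
    show "\<ominus>\<^bsub>?M\<^esub> a \<in> N" if "a \<in> N" for a
      using that Hminus Iminus minus(1)[of a a] by (simp add: N_def)
    show "a \<oplus>\<^bsub>?M\<^esub> b \<in> N" if "a \<in> N" "b \<in> N" for a b
      using that Hadd Iadd by (simp add: N_def seq_module_simps)
    show "c \<odot>\<^bsub>?M\<^esub> a \<in> N" if "c \<in> carrier R" "a \<in> N" for a c
      using that Hsmult Imult by (simp add: N_def seq_module_simps)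
  qed
  have A: "submodule A R ?M"
  proof (rule M.submoduleI)
    show "A \<subseteq> carrier ?M" by (auto simp: A_def seq_module_simps)
    show "\<zero>\<^bsub>?M\<^esub> \<in> A" using M.M.zero_closed I0 by (simp add: A_def seq_module_simps)
    show "\<ominus>\<^bsub>?M\<^esub> a \<in> A" if "a \<in> A" for a
      using that Hminus Iminus minus(1)[of a a] by (simp add: A_def) blast
    show "a \<oplus>\<^bsub>?M\<^esub> b \<in> A" if a: "a \<in> A" and b: "b \<in> A" for a b
    proof -
      obtain n0 n1 where "\<forall>n\<ge>n0. a n \<in> I n" "\<forall>n\<ge>n1. b n \<in> I n" using a b by (auto simp: A_def)
      then have "\<forall>n\<ge>max n0 n1. a n \<oplus> b n \<in> I n" using Iadd by simp
      then show ?thesis using Hadd[OF AH[OF a] AH[OF b]] unfolding A_def seq_module_simps by blast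
    qed
    show "c \<odot>\<^bsub>?M\<^esub> a \<in> A" if "c \<in> carrier R" "a \<in> A" for a c
      using that Hsmult Imult by (simp add: A_def seq_module_simps) blast
  qed
  have fin_A: "(\<lambda>n. if n < m then f n else \<zero>) \<in> A" if "\<And>n. f n \<in> carrier R" for f m
    using fin_H[OF that] I0 by (auto simp: A_def intro!: exI[of _ m])
  have pure: "RD_pure_over R ?M A N N"
    unfolding RD_pure_over_def
  proof (intro ballI impI)
    fix c m a assume c: "c \<in> carrier R" and "m \<in> carrier ?M" and a: "a \<in> A"
      and "c \<odot>\<^bsub>?M\<^esub> m \<ominus>\<^bsub>?M\<^esub> a \<in> N"
    then have m: "m \<in> H" and cm: "\<And>n. c \<otimes> m n \<ominus> a n \<in> I n"
      using minus(2)[OF Hsmult[OF c, of m] AH[OF a]] by (auto simp: seq_module_simps N_def)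
    obtain n0 where n0: "\<forall>n\<ge>n0. a n \<in> I n" using a by (auto simp: A_def)
    \<comment> \<open>A direct sum is RD-pure in the product: from n0 on, a is already zero modulo I
      n, so the solution m may be cut off there.\<close>
    define m' where "m' = (\<lambda>n. if n < n0 then m n else \<zero>)"
    have m': "m' \<in> A" unfolding m'_def by (rule fin_A) (rule HR[OF m])
    have "a n \<ominus> c \<otimes> m' n \<in> I n" for n
    proof (cases "n < n0")
      case True
      have "\<ominus> (c \<otimes> m n \<ominus> a n) = a n \<ominus> c \<otimes> m n"
        using c HR[OF m, of n] HR[OF AH[OF a], of n] by algebra
      then show ?thesis using True Iminus[OF cm[of n]] by (simp add: m'_def)
    next
      case False
      then show ?thesis using n0 c HR[OF AH[OF a], of n] by (simp add: m'_def a_minus_zero)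
    qed
    then have "a \<ominus>\<^bsub>?M\<^esub> c \<odot>\<^bsub>?M\<^esub> m' \<in> N"
      using minus(2)[OF AH[OF a] Hsmult[OF c AH[OF m']]] submodule_minus[OF M A a M.submoduleE(4)[OF A c m']]
      by (simp add: N_def seq_module_simps AH)
    then show "\<exists>a'\<in>A. a \<ominus>\<^bsub>?M\<^esub> c \<odot>\<^bsub>?M\<^esub> a' \<in> N" using m' by blast
  qed
  \<comment> \<open>Codes a sequence of H by its initial segments that reach the point where the
    recursion takes over. Any one of them determines D, and collecting all of them avoids choosing a
    length.\<close>
  define J where "J D = {map D [0..<Suc n] | n. \<forall>k\<ge>n. D (Suc k) = D k \<otimes> p k}" for D
  have "inj_on (\<iota> \<circ> J) (carrier ?M)"
  proof (rule comp_inj_on)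
    show "inj_on J (carrier ?M)"
    proof (rule inj_onI)
      fix D D' assume "D \<in> carrier ?M" "D' \<in> carrier ?M" and eq: "J D = J D'"
      then obtain n where n: "\<forall>k\<ge>n. D (Suc k) = D k \<otimes> p k" by (auto simp: seq_module_simps H_def)
      then have "map D [0..<Suc n] \<in> J D" unfolding J_def by blast
      then have "map D [0..<Suc n] \<in> J D'" using eq by simp
      then obtain n' where n': "map D [0..<Suc n] = map D' [0..<Suc n']"
        "\<forall>k\<ge>n'. D' (Suc k) = D' k \<otimes> p k" unfolding J_def by blast
      from n'(1) have "length (map D [0..<Suc n]) = length (map D' [0..<Suc n'])" by (rule arg_cong)
      then have [simp]: "n' = n" by simp
      have low: "D k = D' k" if "k \<le> n" for k
        using n'(1) that by (auto simp del: upt_Suc)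
      have "D k = D' k" for k
      proof (induction k)
        case 0 show ?case using low by simp
      next
        case (Suc k)
        then show ?case using low[of "Suc k"] n n'(2) by (cases "Suc k \<le> n") auto
      qed
      then show "D = D'" by auto
    qed
    show "inj_on \<iota> (J ` carrier ?M)" using \<iota> by (rule inj_on_subset) simp
  qed
  from RD_essential_quotient[OF hyp M A N NA this pure]
  obtain K where K: "submodule K R ?M" and NK: "N \<subseteq> K" and pureK: "RD_pure_over R ?M A N K"
    and ess: "\<And>m. \<lbrakk>m \<in> carrier ?M; m \<notin> K\<rbrakk>
      \<Longrightarrow> \<exists>s\<in>carrier R. \<exists>a\<in>A. a \<notin> N \<and> s \<odot>\<^bsub>?M\<^esub> m \<ominus>\<^bsub>?M\<^esub> a \<in> K" by metis
  note KE = M.submoduleE[OF K] and AE = M.submoduleE[OF A]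
  have KH: "D \<in> H" if "D \<in> K" for D using that KE(1) by (auto simp: seq_module_simps)
  have rH: "r \<in> H" by (simp add: H_def rSuc)
  have Pr: "q \<odot>\<^bsub>?M\<^esub> r \<in> N" if "q \<in> P" for q
    using that Hsmult[OF P_carrier[OF that] rH] by (auto simp: N_def seq_module_simps I_def m_comm)
  \<comment> \<open>Essentiality of M/K over A/N is used only here: it gives s r - a in K for some
    s, and s has to be replaced by 1.\<close>
  have "\<exists>a\<in>A. r \<ominus>\<^bsub>?M\<^esub> a \<in> K"
  proof (cases "r \<in> K")
    case True
    then show ?thesis
      using submodule_zero[OF M A] M.M.a_minus_zero[of r] rH by (force simp: seq_module_simps(1))
  next
    case False
    then obtain s a where s: "s \<in> carrier R" and a: "a \<in> A" "a \<notin> N"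
      and sa: "s \<odot>\<^bsub>?M\<^esub> r \<ominus>\<^bsub>?M\<^esub> a \<in> K" using ess[of r] rH by (auto simp: seq_module_simps(1))
    have aM: "a \<in> carrier ?M" and rM: "r \<in> carrier ?M" using AH[OF a(1)] rH by (auto simp: seq_module_simps(1))
    \<comment> \<open>For s in P, s r would lie in N \<subseteq> K, hence a in A \<inter> K
      \<subseteq> N.\<close>
    have "s \<notin> P"
    proof
      assume "s \<in> P"
      then have sr: "s \<odot>\<^bsub>?M\<^esub> r \<in> K" using Pr NK by blast
      have "s \<odot>\<^bsub>?M\<^esub> r \<ominus>\<^bsub>?M\<^esub> (s \<odot>\<^bsub>?M\<^esub> r \<ominus>\<^bsub>?M\<^esub> a) \<in> K" by (rule submodule_minus[OF M K sr sa])
      moreover have "s \<odot>\<^bsub>?M\<^esub> r \<ominus>\<^bsub>?M\<^esub> (s \<odot>\<^bsub>?M\<^esub> r \<ominus>\<^bsub>?M\<^esub> a) = a"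
        using s aM rM
        by (simp add: M.M.minus_eq M.M.minus_add M.M.r_neg2)
      ultimately have "a \<in> N" using RD_pure_over_Int[OF M A K _ pureK a(1)] M.submoduleE(1)[OF N] by simp
      then show False using a by simp
    qed
    then obtain t q where t: "t \<in> carrier R" "q \<in> P" "t \<otimes> s = \<one> \<oplus> q"
      using inverse_mod_P[OF s] by blast
    have qK: "q \<odot>\<^bsub>?M\<^esub> r \<in> K" using Pr[OF t(2)] NK by blast
    \<comment> \<open>Multiplication by t changes s r into r + q r, and q r can be discarded since
      it lies in K.\<close>
    have "t \<odot>\<^bsub>?M\<^esub> (s \<odot>\<^bsub>?M\<^esub> r \<ominus>\<^bsub>?M\<^esub> a) \<ominus>\<^bsub>?M\<^esub> q \<odot>\<^bsub>?M\<^esub> r \<in> K"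
      by (rule submodule_minus[OF M K KE(4)[OF t(1) sa] qK])
    moreover have "t \<odot>\<^bsub>?M\<^esub> (s \<odot>\<^bsub>?M\<^esub> r \<ominus>\<^bsub>?M\<^esub> a) \<ominus>\<^bsub>?M\<^esub> q \<odot>\<^bsub>?M\<^esub> r = r \<ominus>\<^bsub>?M\<^esub> t \<odot>\<^bsub>?M\<^esub> a"
    proof -
      have "t \<odot>\<^bsub>?M\<^esub> (s \<odot>\<^bsub>?M\<^esub> r \<ominus>\<^bsub>?M\<^esub> a) = (t \<otimes> s) \<odot>\<^bsub>?M\<^esub> r \<ominus>\<^bsub>?M\<^esub> t \<odot>\<^bsub>?M\<^esub> a"
        using s t(1) aM rM by (simp add: M.M.minus_eq M.smult_r_distr M.smult_r_minus M.smult_assoc1)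
      also have "(t \<otimes> s) \<odot>\<^bsub>?M\<^esub> r = r \<oplus>\<^bsub>?M\<^esub> q \<odot>\<^bsub>?M\<^esub> r"
        unfolding t(3) using t(2) rM by (simp add: M.smult_l_distr)
      finally show ?thesis
        using t(1,2) aM rM by (simp add: M.M.minus_eq M.M.a_ac M.M.r_neg2 M.M.r_neg1 M.M.r_neg)
    qed
    ultimately show ?thesis using AE(4)[OF t(1) a(1)] by auto
  qed
  then obtain a where a: "a \<in> A" and ra: "r \<ominus>\<^bsub>?M\<^esub> a \<in> K" by blast
  have aR: "a n \<in> carrier R" for n using HR[OF AH[OF a]] .
  have key: "a n \<ominus> r n \<in> I n" for n
  proof -
    \<comment> \<open>One index beyond n, so that r m = r n p n and every multiple of r m is zero
      modulo I n = r n P.\<close>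
    define m where "m = Suc n"
    \<comment> \<open>The tail of r divided by r m: zero below m, then 1, p m, p m p (m + 1), and so
      on.\<close>
    define y where "y = rec_nat (\<zero> :: 'r) (\<lambda>k v. if Suc k = m then \<one> else v \<otimes> p k)"
    have y0: "y 0 = \<zero>" and ySuc: "y (Suc k) = (if Suc k = m then \<one> else y k \<otimes> p k)" for k
      by (simp_all add: y_def)
    have yR [simp]: "y k \<in> carrier R" for k by (induction k) (auto simp: y0 ySuc)
    have ylow: "y k = \<zero>" if "k < m" for k using that by (induction k) (auto simp: y0 ySuc)
    have yhigh: "r m \<otimes> y k = r k" if "m \<le> k" for k
      using that
    proof (induction k)
      case 0 then show ?case by (simp add: m_def)
    next
      case (Suc k)
      then show ?case by (cases "Suc k = m") (auto simp: ySuc rSuc simp flip: m_assoc)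
    qed
    have yH: "y \<in> H" by (auto simp: H_def ySuc intro!: exI[of _ m])
    define b where "b = (\<lambda>k. if k < m then r k else \<zero>)"
    have bA: "b \<in> A" unfolding b_def by (rule fin_A) simp
    have abA: "a \<ominus>\<^bsub>?M\<^esub> b \<in> A" by (rule submodule_minus[OF M A a bA])
    have ab: "a \<ominus>\<^bsub>?M\<^esub> b = (\<lambda>k. a k \<ominus> b k)" by (rule minus(2)[OF AH[OF a] AH[OF bA]])
    \<comment> \<open>With b the part of r below m, r = r m y + b. Hence r - a in K says that a - b
      is divisible by r m modulo K, and RD-purity moves this divisibility into A modulo N.\<close>
    have "r m \<odot>\<^bsub>?M\<^esub> y \<ominus>\<^bsub>?M\<^esub> (a \<ominus>\<^bsub>?M\<^esub> b) = r \<ominus>\<^bsub>?M\<^esub> a"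
    proof
      fix k
      have 1: "(r m \<odot>\<^bsub>?M\<^esub> y \<ominus>\<^bsub>?M\<^esub> (a \<ominus>\<^bsub>?M\<^esub> b)) k = r m \<otimes> y k \<ominus> (a k \<ominus> b k)"
        using minus(2)[OF Hsmult[OF rR yH] AH[OF abA], of m] by (simp add: ab seq_module_simps)
      have 2: "(r \<ominus>\<^bsub>?M\<^esub> a) k = r k \<ominus> a k" using minus(2)[OF rH AH[OF a]] by simp
      show "(r m \<odot>\<^bsub>?M\<^esub> y \<ominus>\<^bsub>?M\<^esub> (a \<ominus>\<^bsub>?M\<^esub> b)) k = (r \<ominus>\<^bsub>?M\<^esub> a) k"
      proof (cases "k < m")
        case True
        have "r m \<otimes> \<zero> \<ominus> (a k \<ominus> r k) = r k \<ominus> a k"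
          using rR[of m] aR[of k] rR[of k] by algebra
        then show ?thesis unfolding 1 2 using True by (simp add: ylow b_def)
      next
        case False
        then show ?thesis unfolding 1 2 using aR[of k] by (simp add: yhigh b_def a_minus_zero)
      qed
    qed
    then have "r m \<odot>\<^bsub>?M\<^esub> y \<ominus>\<^bsub>?M\<^esub> (a \<ominus>\<^bsub>?M\<^esub> b) \<in> K" using ra by simp
    then obtain a' where a': "a' \<in> A" "a \<ominus>\<^bsub>?M\<^esub> b \<ominus>\<^bsub>?M\<^esub> r m \<odot>\<^bsub>?M\<^esub> a' \<in> N"
      using RD_pure_overD[OF pureK rR _ abA, of y m] yH by (auto simp: seq_module_simps(1))
    have "(a n \<ominus> b n) \<ominus> r m \<otimes> a' n \<in> I n"
      using a'(2) minus(2)[OF AH[OF abA] Hsmult[OF rR AH[OF a'(1)]], of m]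
      by (simp add: ab seq_module_simps N_def)
    moreover have "r m \<otimes> a' n \<in> I n"
      using Imult[of "a' n" "r m" n] HR[OF AH[OF a'(1)], of n] p[of n]
      by (auto simp: m_def rSuc I_def m_comm)
    ultimately have "((a n \<ominus> b n) \<ominus> r m \<otimes> a' n) \<oplus> r m \<otimes> a' n \<in> I n" by (rule Iadd)
    moreover have "((a n \<ominus> b n) \<ominus> r m \<otimes> a' n) \<oplus> r m \<otimes> a' n = a n \<ominus> b n"
      using aR[of n] HR[OF AH[OF bA], of n] HR[OF AH[OF a'(1)], of n] rR[of m] by algebra
    ultimately show ?thesis by (simp add: b_def m_def)
  qed
  \<comment> \<open>Far out a is zero modulo I n, while \<open>key\<close> keeps it congruent to r
    n. So r n = r n q with q in P, and 1 - q, an element outside P, annihilates r n.\<close>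
  obtain n where n: "a n \<in> I n" using a by (auto simp: A_def)
  have "a n \<ominus> (a n \<ominus> r n) \<in> I n" by (rule Idiff[OF n key])
  moreover have "a n \<ominus> (a n \<ominus> r n) = r n" using aR[of n] rR[of n] by algebra
  ultimately obtain q where q: "q \<in> P" "r n = r n \<otimes> q" by (auto simp: I_def)
  let ?s = "\<one> \<ominus> q"
  have "?s \<notin> P"
  proof
    assume "?s \<in> P"
    then have "?s \<oplus> q \<in> P" using q(1) by (rule P.a_closed)
    moreover have "?s \<oplus> q = \<one>" using P_carrier[OF q(1)] by algebra
    ultimately show False using one_notin_P by simp
  qed
  moreover have "?s \<otimes> r n = r n \<ominus> r n \<otimes> q" using P_carrier[OF q(1)] rR[of n] by algebra
  then have "?s \<otimes> r n = \<zero>" using q(2) by (simp add: minus_eq r_neg)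
  ultimately show ?thesis using q(1) by (intro exI[of _ n] bexI[of _ ?s]) auto
qed

end

section \<open>Local principality\<close>

definition prod_module :: "('r,'a) module \<Rightarrow> ('r,'b) module \<Rightarrow> ('r, 'a \<times> 'b) module" where
  "prod_module U V = \<lparr>carrier = carrier U \<times> carrier V,
     mult = (\<lambda>_ _. (\<zero>\<^bsub>U\<^esub>, \<zero>\<^bsub>V\<^esub>)), one = (\<zero>\<^bsub>U\<^esub>, \<zero>\<^bsub>V\<^esub>), zero = (\<zero>\<^bsub>U\<^esub>, \<zero>\<^bsub>V\<^esub>),
     add = (\<lambda>x y. (fst x \<oplus>\<^bsub>U\<^esub> fst y, snd x \<oplus>\<^bsub>V\<^esub> snd y)),
     smult = (\<lambda>c x. (c \<odot>\<^bsub>U\<^esub> fst x, c \<odot>\<^bsub>V\<^esub> snd x))\<rparr>"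

lemma prod_module_simps:
  "carrier (prod_module U V) = carrier U \<times> carrier V"
  "\<zero>\<^bsub>prod_module U V\<^esub> = (\<zero>\<^bsub>U\<^esub>, \<zero>\<^bsub>V\<^esub>)"
  "(x, y) \<oplus>\<^bsub>prod_module U V\<^esub> (x', y') = (x \<oplus>\<^bsub>U\<^esub> x', y \<oplus>\<^bsub>V\<^esub> y')"
  "c \<odot>\<^bsub>prod_module U V\<^esub> (x, y) = (c \<odot>\<^bsub>U\<^esub> x, c \<odot>\<^bsub>V\<^esub> y)"
  by (simp_all add: prod_module_def)

lemma prod_module_module:
  assumes "module R U" "module R V"
  shows "module R (prod_module U V)"
proof -
  interpret U: module R U by fact
  interpret V: module R V by fact
  show ?thesis
  proof (rule moduleI)
    show "abelian_group (prod_module U V)"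
    proof (rule abelian_groupI)
      fix x assume "x \<in> carrier (prod_module U V)"
      then show "\<exists>y\<in>carrier (prod_module U V). y \<oplus>\<^bsub>prod_module U V\<^esub> x = \<zero>\<^bsub>prod_module U V\<^esub>"
        by (cases x) (auto simp: prod_module_simps U.M.l_neg V.M.l_neg
            intro!: bexI[of _ "(\<ominus>\<^bsub>U\<^esub> fst x, \<ominus>\<^bsub>V\<^esub> snd x)"])
    qed (auto simp: prod_module_simps U.M.a_ac V.M.a_ac)
  qed (auto simp: prod_module_simps U.R.is_cring U.smult_l_distr V.smult_l_distr
      U.smult_r_distr V.smult_r_distr U.smult_assoc1 V.smult_assoc1)
qed

lemma prod_module_minus:
  assumes U: "module R U" and V: "module R V"
    and "x \<in> carrier U" "x' \<in> carrier U" "y \<in> carrier V" "y' \<in> carrier V"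
  shows "\<ominus>\<^bsub>prod_module U V\<^esub> (x, y) = (\<ominus>\<^bsub>U\<^esub> x, \<ominus>\<^bsub>V\<^esub> y)"
    and "(x, y) \<ominus>\<^bsub>prod_module U V\<^esub> (x', y') = (x \<ominus>\<^bsub>U\<^esub> x', y \<ominus>\<^bsub>V\<^esub> y')"
proof -
  interpret U: module R U by fact
  interpret V: module R V by fact
  interpret M: module R "prod_module U V" by (rule prod_module_module[OF U V])
  have *: "\<ominus>\<^bsub>prod_module U V\<^esub> (x, y) = (\<ominus>\<^bsub>U\<^esub> x, \<ominus>\<^bsub>V\<^esub> y)"
    if "x \<in> carrier U" "y \<in> carrier V" for x y
    by (rule M.M.minus_equality) (use that in \<open>auto simp: prod_module_simps U.M.l_neg V.M.l_neg\<close>)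
  show "\<ominus>\<^bsub>prod_module U V\<^esub> (x, y) = (\<ominus>\<^bsub>U\<^esub> x, \<ominus>\<^bsub>V\<^esub> y)"
    and "(x, y) \<ominus>\<^bsub>prod_module U V\<^esub> (x', y') = (x \<ominus>\<^bsub>U\<^esub> x', y \<ominus>\<^bsub>V\<^esub> y')"
    using assms by (simp_all add: * M.M.minus_eq U.M.minus_eq V.M.minus_eq prod_module_simps)
qed

lemma self_module_simps:
  "carrier (self_module R) = carrier R" "\<zero>\<^bsub>self_module R\<^esub> = \<zero>\<^bsub>R\<^esub>"
  "x \<oplus>\<^bsub>self_module R\<^esub> y = x \<oplus>\<^bsub>R\<^esub> y" "c \<odot>\<^bsub>self_module R\<^esub> x = c \<otimes>\<^bsub>R\<^esub> x"
  by (simp_all add: self_module_def)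

lemma (in module) submodule_smult_ideal:
  assumes I: "ideal I R" and z: "z \<in> carrier M"
  shows "submodule ((\<lambda>c. c \<odot>\<^bsub>M\<^esub> z) ` I) R M"
proof (rule submoduleI)
  interpret I: ideal I R by fact
  have IR: "q \<in> carrier R" if "q \<in> I" for q using that by simp
  let ?N = "(\<lambda>c. c \<odot>\<^bsub>M\<^esub> z) ` I"
  show "?N \<subseteq> carrier M" using z IR by auto
  show "\<zero>\<^bsub>M\<^esub> \<in> ?N" using z I.zero_closed by (intro image_eqI[of _ _ "\<zero>"]) auto
  show "\<ominus>\<^bsub>M\<^esub> a \<in> ?N" if "a \<in> ?N" for a
    using that z IR by (auto simp flip: smult_l_minus)
  show "a \<oplus>\<^bsub>M\<^esub> b \<in> ?N" if "a \<in> ?N" "b \<in> ?N" for a b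
    using that z IR I.a_closed by (auto simp flip: smult_l_distr)
  show "c \<odot>\<^bsub>M\<^esub> a \<in> ?N" if "c \<in> carrier R" "a \<in> ?N" for a c
    using that z IR I.I_l_closed by (auto simp flip: smult_assoc1)
qed

context cring_maximal
begin

text \<open>Otherwise z = (a, b) spans an RD-pure simple submodule of (R \<oplus> R) / P z.  In an essential RD-pure
  extension of a simple module every element of P acts as zero, although z = a (1, 0) + b (0, 1).\<close>

lemma common_divisor:
  fixes \<iota> :: "'r list set \<Rightarrow> 't"
  assumes hyp: "\<forall>(B :: ('r,'t set) module) A.
      module R B \<and> submodule A R B \<and> RD_essential R A B \<longrightarrow> essential R A B"
    and \<iota>: "inj \<iota>"
    and a: "a \<in> P" and b: "b \<in> P"
  shows "\<exists>r\<in>P. \<exists>t\<in>carrier R - P. \<exists>u\<in>carrier R. \<exists>v\<in>carrier R. t \<otimes> a = r \<otimes> u \<and> t \<otimes> b = r \<otimes> v"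
proof (rule ccontr)
  assume "\<not> ?thesis"
  then have contra: False if "r \<in> P" "t \<in> carrier R" "t \<notin> P" "u \<in> carrier R" "v \<in> carrier R"
    "t \<otimes> a = r \<otimes> u" "t \<otimes> b = r \<otimes> v" for r t u v
    using that by blast
  have aR [simp]: "a \<in> carrier R" and bR [simp]: "b \<in> carrier R" using a b by auto
  let ?S = "self_module R"
  let ?M = "prod_module ?S ?S"
  have M: "module R ?M" by (rule prod_module_module[OF self_module_module self_module_module])
  interpret M: module R ?M by (rule M)
  let ?z = "(a, b)"
  have z: "?z \<in> carrier ?M" by (simp add: prod_module_simps self_module_simps)
  define A where "A = (\<lambda>c. c \<odot>\<^bsub>?M\<^esub> ?z) ` carrier R"
  define N where "N = (\<lambda>c. c \<odot>\<^bsub>?M\<^esub> ?z) ` P"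
  have A: "submodule A R ?M" unfolding A_def by (rule M.submodule_smult_ideal[OF oneideal z])
  have N: "submodule N R ?M" unfolding N_def by (rule M.submodule_smult_ideal[OF P.is_ideal z])
  have NA: "N \<subseteq> A" by (auto simp: N_def A_def)
  note NE = M.submoduleE[OF N] and AE = M.submoduleE[OF A]
  have pure: "RD_pure_over R ?M A N N"
    unfolding RD_pure_over_def
  proof (intro ballI impI)
    fix r m x assume r: "r \<in> carrier R" and m: "m \<in> carrier ?M" and x: "x \<in> A"
      and rm: "r \<odot>\<^bsub>?M\<^esub> m \<ominus>\<^bsub>?M\<^esub> x \<in> N"
    obtain c where c: "c \<in> carrier R" "x = c \<odot>\<^bsub>?M\<^esub> ?z" using x by (auto simp: A_def)
    show "\<exists>a'\<in>A. x \<ominus>\<^bsub>?M\<^esub> r \<odot>\<^bsub>?M\<^esub> a' \<in> N"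
    proof (cases "r \<in> P")
      case False
      then obtain t q where t: "t \<in> carrier R" "q \<in> P" "t \<otimes> r = \<one> \<oplus> q"
        using inverse_mod_P[OF r] by blast
      \<comment> \<open>A scalar r outside P acts invertibly on A/N, with inverse t.\<close>
      have "c \<ominus> r \<otimes> (t \<otimes> c) = c \<ominus> (t \<otimes> r) \<otimes> c" using r t(1) c(1) by algebra
      also have "\<dots> = \<ominus> (c \<otimes> q)" unfolding t(3) using c(1) P_carrier[OF t(2)] by algebra
      finally have "c \<ominus> r \<otimes> (t \<otimes> c) \<in> P" using P.I_l_closed[OF t(2) c(1)] by simp
      then have "(c \<ominus> r \<otimes> (t \<otimes> c)) \<odot>\<^bsub>?M\<^esub> ?z \<in> N" by (simp add: N_def)
      moreover have "(c \<ominus> r \<otimes> (t \<otimes> c)) \<odot>\<^bsub>?M\<^esub> ?z = x \<ominus>\<^bsub>?M\<^esub> r \<odot>\<^bsub>?M\<^esub> ((t \<otimes> c) \<odot>\<^bsub>?M\<^esub> ?z)"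
        using c r t(1) z by (simp add: M.M.minus_eq minus_eq M.smult_l_distr M.smult_l_minus M.smult_assoc1)
      moreover have "(t \<otimes> c) \<odot>\<^bsub>?M\<^esub> ?z \<in> A" using t(1) c(1) by (simp add: A_def)
      ultimately show ?thesis by metis
    next
      case True
      have "c \<in> P"
      proof (rule ccontr)
        \<comment> \<open>For c outside P, also q + c is outside P, and (q + c) z = r m exhibits r
          in P as a common divisor of the kind assumed not to exist.\<close>
        assume cP: "c \<notin> P"
        obtain q where q: "q \<in> P" "r \<odot>\<^bsub>?M\<^esub> m \<ominus>\<^bsub>?M\<^esub> x = q \<odot>\<^bsub>?M\<^esub> ?z" using rm by (auto simp: N_def)
        obtain u v where uv: "m = (u, v)" "u \<in> carrier R" "v \<in> carrier R"
          using m by (auto simp: prod_module_simps self_module_simps)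
        have "(r \<odot>\<^bsub>?M\<^esub> m \<ominus>\<^bsub>?M\<^esub> x) \<oplus>\<^bsub>?M\<^esub> x = r \<odot>\<^bsub>?M\<^esub> m"
          using r m c z by (simp add: M.M.minus_eq M.M.a_assoc M.M.l_neg)
        then have "(q \<oplus> c) \<odot>\<^bsub>?M\<^esub> ?z = r \<odot>\<^bsub>?M\<^esub> m"
          unfolding q(2) using c q(1) z by (simp add: M.smult_l_distr)
        then have "(q \<oplus> c) \<otimes> a = r \<otimes> u" "(q \<oplus> c) \<otimes> b = r \<otimes> v"
          by (simp_all add: uv prod_module_simps self_module_simps)
        moreover have "q \<oplus> c \<notin> P"
        proof
          assume "q \<oplus> c \<in> P"
          then have "(q \<oplus> c) \<oplus> \<ominus> q \<in> P" using q(1) by simp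
          moreover have "(q \<oplus> c) \<oplus> \<ominus> q = c" using P_carrier[OF q(1)] c(1) by algebra
          ultimately show False using cP by simp
        qed
        ultimately show False using contra[OF True _ _ uv(2,3), of "q \<oplus> c"] c(1) q(1) by simp
      qed
      then have "x \<in> N" using c by (simp add: N_def)
      then have "x \<ominus>\<^bsub>?M\<^esub> r \<odot>\<^bsub>?M\<^esub> \<zero>\<^bsub>?M\<^esub> \<in> N" using r NE(1) by (auto simp: M.M.a_minus_zero)
      then show ?thesis using submodule_zero[OF M A] by blast
    qed
  qed
  have "inj_on (\<lambda>x. \<iota> {[fst x, snd x]}) (carrier ?M)"
    using injD[OF \<iota>] by (fastforce intro: inj_onI)
  from RD_essential_quotient[OF hyp M A N NA this pure]
  obtain K where K: "submodule K R ?M" and NK: "N \<subseteq> K" and pureK: "RD_pure_over R ?M A N K"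
    and ess: "\<And>m. \<lbrakk>m \<in> carrier ?M; m \<notin> K\<rbrakk>
      \<Longrightarrow> \<exists>s\<in>carrier R. \<exists>a\<in>A. a \<notin> N \<and> s \<odot>\<^bsub>?M\<^esub> m \<ominus>\<^bsub>?M\<^esub> a \<in> K" by metis
  have PK: "r \<odot>\<^bsub>?M\<^esub> m \<in> K" if r: "r \<in> P" and m: "m \<in> carrier ?M" for r m
  proof (rule ccontr)
    assume "r \<odot>\<^bsub>?M\<^esub> m \<notin> K"
    then obtain s x where s: "s \<in> carrier R" and x: "x \<in> A" "x \<notin> N"
      and K1: "s \<odot>\<^bsub>?M\<^esub> (r \<odot>\<^bsub>?M\<^esub> m) \<ominus>\<^bsub>?M\<^esub> x \<in> K"
      using ess[of "r \<odot>\<^bsub>?M\<^esub> m"] r m by auto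
    have sr: "s \<otimes> r \<in> P" using P.I_l_closed[OF r s] .
    have "(s \<otimes> r) \<odot>\<^bsub>?M\<^esub> m \<ominus>\<^bsub>?M\<^esub> x \<in> K" using K1 s r m by (simp add: M.smult_assoc1)
    \<comment> \<open>RD-purity at the scalar s r, which lies in P: x becomes a multiple of s r by
      an element of A modulo N. As P A \<subseteq> N, this contradicts x \<notin> N.\<close>
    then obtain a' where a': "a' \<in> A" "x \<ominus>\<^bsub>?M\<^esub> (s \<otimes> r) \<odot>\<^bsub>?M\<^esub> a' \<in> N"
      using RD_pure_overD[OF pureK P_carrier[OF sr] m x(1)] by blast
    obtain c where c: "c \<in> carrier R" "a' = c \<odot>\<^bsub>?M\<^esub> ?z" using a' by (auto simp: A_def)
    have "(s \<otimes> r) \<odot>\<^bsub>?M\<^esub> a' = ((s \<otimes> r) \<otimes> c) \<odot>\<^bsub>?M\<^esub> ?z"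
      using c s r z by (simp only: M.smult_assoc1 P_carrier m_closed)
    then have "(s \<otimes> r) \<odot>\<^bsub>?M\<^esub> a' \<in> N" using P.I_r_closed[OF sr c(1)] by (simp add: N_def)
    from NE(5)[OF a'(2) this]
    have "(x \<ominus>\<^bsub>?M\<^esub> (s \<otimes> r) \<odot>\<^bsub>?M\<^esub> a') \<oplus>\<^bsub>?M\<^esub> (s \<otimes> r) \<odot>\<^bsub>?M\<^esub> a' \<in> N" .
    moreover have "x \<in> carrier ?M" "(s \<otimes> r) \<odot>\<^bsub>?M\<^esub> a' \<in> carrier ?M"
      using AE(1) x a' P_carrier[OF sr] by (auto intro!: M.smult_closed)
    ultimately have "x \<in> N" by (simp add: M.M.minus_eq M.M.a_assoc M.M.l_neg)
    then show False using x by simp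
  qed
  have "a \<odot>\<^bsub>?M\<^esub> (\<one>, \<zero>) \<oplus>\<^bsub>?M\<^esub> b \<odot>\<^bsub>?M\<^esub> (\<zero>, \<one>) = ?z"
    by (simp add: prod_module_simps self_module_simps)
  moreover have "a \<odot>\<^bsub>?M\<^esub> (\<one>, \<zero>) \<oplus>\<^bsub>?M\<^esub> b \<odot>\<^bsub>?M\<^esub> (\<zero>, \<one>) \<in> K"
    by (rule M.submoduleE(5)[OF K PK[OF a] PK[OF b]]) (simp_all add: prod_module_simps self_module_simps)
  ultimately have "?z \<in> K" by simp
  moreover have "?z \<in> A" unfolding A_def using z by (intro image_eqI[of _ _ \<one>]) auto
  ultimately have "?z \<in> N" using RD_pure_over_Int[OF M A K NE(1) pureK] by blast
  then obtain q where q: "q \<in> P" "a = q \<otimes> a" "b = q \<otimes> b"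
    by (auto simp: N_def prod_module_simps self_module_simps)
  \<comment> \<open>Now z = q z with q in P, so 1 - q kills a and b. Then 0 is a common divisor in P
    with both cofactors 0, again excluded.\<close>
  let ?t = "\<one> \<ominus> q"
  have qR: "q \<in> carrier R" using q by simp
  have "?t \<notin> P"
  proof
    assume "?t \<in> P"
    then have "?t \<oplus> q \<in> P" using q(1) by (rule P.a_closed)
    moreover have "?t \<oplus> q = \<one>" using qR by algebra
    ultimately show False using one_notin_P by simp
  qed
  moreover have "?t \<otimes> a = a \<ominus> q \<otimes> a" "?t \<otimes> b = b \<ominus> q \<otimes> b" using qR aR bR by algebra+
  then have "?t \<otimes> a = \<zero> \<otimes> \<zero>" "?t \<otimes> b = \<zero> \<otimes> \<zero>"
    using q(2,3) by (simp_all add: minus_eq r_neg)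
  ultimately show False using contra[OF P.zero_closed _ _ zero_closed zero_closed, of ?t] qR by simp
qed

text \<open>If no element of P locally divides all of P, every x in P misses some b in P, and a
  common divisor of x and b divides x with cofactor in P. Iteration writes a fixed a0, up to factors
  outside P, as ever longer products of elements of P, which T-nilpotence forbids. Nilpotence of p
  is T-nilpotence for a constant sequence.\<close>

lemma locally_principal_nilpotent:
  fixes \<iota> :: "'r list set \<Rightarrow> 't"
  assumes hyp: "\<forall>(B :: ('r,'t set) module) A.
      module R B \<and> submodule A R B \<and> RD_essential R A B \<longrightarrow> essential R A B"
    and \<iota>: "inj \<iota>"
  obtains p n s where "p \<in> P" "\<And>a. a \<in> P \<Longrightarrow> \<exists>t\<in>carrier R - P. \<exists>c\<in>carrier R. t \<otimes> a = p \<otimes> c"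
    "s \<in> carrier R - P" "s \<otimes> p [^] (n::nat) = \<zero>"
proof -
  have "\<exists>p\<in>P. \<forall>a\<in>P. \<exists>t\<in>carrier R - P. \<exists>c\<in>carrier R. t \<otimes> a = p \<otimes> c"
  proof (rule ccontr)
    assume "\<not> ?thesis"
    then have ex: "\<exists>b\<in>P. \<forall>t\<in>carrier R - P. \<forall>c\<in>carrier R. t \<otimes> b \<noteq> p \<otimes> c" if "p \<in> P" for p
      using that by blast
    \<comment> \<open>A chain of proper divisors of a0, whose successive quotients contradict T-nilpotence.\<close>
    define T where "T x u t y \<longleftrightarrow> y \<in> P \<and> u \<in> P \<and> t \<in> carrier R - P \<and> t \<otimes> x = y \<otimes> u" for x u t y
    have step: "\<exists>y u t. T x u t y" if x: "x \<in> P" for x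
    proof -
      obtain b where b: "b \<in> P" "\<And>t c. \<lbrakk>t \<in> carrier R - P; c \<in> carrier R\<rbrakk> \<Longrightarrow> t \<otimes> b \<noteq> x \<otimes> c"
        using ex[OF x] by blast
      obtain r t u v where *: "r \<in> P" "t \<in> carrier R" "t \<notin> P" "u \<in> carrier R" "v \<in> carrier R"
        "t \<otimes> x = r \<otimes> u" "t \<otimes> b = r \<otimes> v"
        using common_divisor[OF hyp \<iota> x b(1)] by blast
      \<comment> \<open>If u were outside P, x would locally divide r, hence b, against the choice
        of b.\<close>
      have "u \<in> P"
      proof (rule ccontr)
        assume u: "u \<notin> P"
        have xR: "x \<in> carrier R" and bR: "b \<in> carrier R" and rR: "r \<in> carrier R" using x b * by auto
        have "(u \<otimes> t) \<otimes> b = u \<otimes> (r \<otimes> v)" using * bR by (simp add: m_assoc)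
        also have "\<dots> = v \<otimes> (r \<otimes> u)" using * rR by algebra
        also have "\<dots> = v \<otimes> (t \<otimes> x)" using *(6) by simp
        also have "\<dots> = x \<otimes> (v \<otimes> t)" using *(2,5) xR by algebra
        finally show False using b(2)[of "u \<otimes> t" "v \<otimes> t"] * u mult_notin_P[of u t] by simp
      qed
      then show ?thesis using * unfolding T_def by blast
    qed
    \<comment> \<open>What 0 fails to divide locally is an element that nothing outside P
      annihilates.\<close>
    obtain a0 where a0: "a0 \<in> P" "\<And>t. t \<in> carrier R - P \<Longrightarrow> t \<otimes> a0 \<noteq> \<zero>"
      using ex[OF P.zero_closed] by force
    have "\<exists>f. f 0 = a0 \<and> (\<forall>n. f n \<in> P) \<and> (\<forall>n. \<exists>u t. T (f n) u t (f (Suc n)))"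
    proof -
      have "\<exists>f. \<forall>n. (f n \<in> P \<and> (n = 0 \<longrightarrow> f n = a0)) \<and> (\<exists>u t. T (f n) u t (f (Suc n)))"
      proof (rule dependent_nat_choice)
        show "\<exists>x. x \<in> P \<and> (0 = (0::nat) \<longrightarrow> x = a0)" using a0 by blast
        show "\<exists>y. (y \<in> P \<and> (Suc n = 0 \<longrightarrow> y = a0)) \<and> (\<exists>u t. T x u t y)"
          if "x \<in> P \<and> (n = 0 \<longrightarrow> x = a0)" for x n
          using step[of x] that T_def by blast
      qed
      then show ?thesis by blast
    qed
    then obtain f where f0: "f 0 = a0" and fP: "\<And>n. f n \<in> P"
      and "\<forall>n. \<exists>u t. T (f n) u t (f (Suc n))" by blast
    then obtain u t where ut: "\<And>n. T (f n) (u n) (t n) (f (Suc n))" by metis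
    have uP: "u n \<in> P" and tR: "t n \<in> carrier R" "t n \<notin> P"
      and tf: "t n \<otimes> f n = f (Suc n) \<otimes> u n" for n using ut[of n] by (auto simp: T_def)
    define r where "r = rec_nat \<one> (\<lambda>n v. v \<otimes> u n)"
    have r0: "r 0 = \<one>" and rSuc: "r (Suc n) = r n \<otimes> u n" for n by (simp_all add: r_def)
    have rR: "r n \<in> carrier R" for n using uP by (induction n) (auto simp: r0 rSuc)
    \<comment> \<open>Up to a factor outside P, a0 is the product of the first n cofactors times the
      n-th divisor. The factors t n accumulate in w.\<close>
    have "\<exists>w\<in>carrier R - P. w \<otimes> a0 = r n \<otimes> f n" for n
    proof (induction n)
      case 0
      show ?case using a0(1) one_notin_P by (intro bexI[of _ \<one>]) (auto simp: r0 f0)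
    next
      case (Suc n)
      then obtain w where w: "w \<in> carrier R" "w \<notin> P" "w \<otimes> a0 = r n \<otimes> f n" by blast
      have a0R: "a0 \<in> carrier R" and fR: "f n \<in> carrier R" "f (Suc n) \<in> carrier R" and uR: "u n \<in> carrier R"
        using a0 fP uP by auto
      have "(t n \<otimes> w) \<otimes> a0 = t n \<otimes> (r n \<otimes> f n)" using w tR a0R by (simp add: m_assoc)
      also have "\<dots> = r n \<otimes> (t n \<otimes> f n)" using tR(1)[of n] rR[of n] fR by algebra
      also have "\<dots> = r (Suc n) \<otimes> f (Suc n)" unfolding tf rSuc using rR[of n] fR uR by algebra
      finally show ?case using mult_notin_P[of "t n" w] w tR[of n] by (intro bexI[of _ "t n \<otimes> w"]) auto
    qed
    moreover obtain n s where s: "s \<in> carrier R - P" "s \<otimes> r n = \<zero>"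
      using T_nilpotent[OF hyp \<iota> uP r0 rSuc] by blast
    ultimately obtain w where w: "w \<in> carrier R" "w \<notin> P" "w \<otimes> a0 = r n \<otimes> f n" by blast
    have "(s \<otimes> w) \<otimes> a0 = (s \<otimes> r n) \<otimes> f n"
      using w s(1) a0(1) rR[of n] fP[of n] by (simp add: m_assoc)
    also have "\<dots> = \<zero>" using s fP[of n] by simp
    finally show False using a0(2)[of "s \<otimes> w"] mult_notin_P[of s w] w s(1) by simp
  qed
  then obtain p where p: "p \<in> P" "\<And>a. a \<in> P \<Longrightarrow> \<exists>t\<in>carrier R - P. \<exists>c\<in>carrier R. t \<otimes> a = p \<otimes> c"
    by blast
  have "\<exists>n. \<exists>s\<in>carrier R - P. s \<otimes> p [^] (n::nat) = \<zero>"
    by (rule T_nilpotent[OF hyp \<iota>]) (use p in auto)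
  then show thesis using that p by blast
qed

end

section \<open>Extending homomorphisms along pure monomorphisms\<close>

text \<open>Purity is tested on S/rS. Since \<open>pure_sub\<close> only admits modules on sets of
  lists, each coset is replaced by the set of its one-element lists; the copy is still generated by
  one element with annihilator rS.\<close>

lemma pure_sub_imp_RD:
  fixes S :: "('s,'c) ring_scheme" and B :: "('s,'b) module"
  assumes B: "module S B" and X: "submodule X S B" and pure: "pure_sub S X B"
    and r: "r \<in> carrier S" and b: "b \<in> carrier B" "r \<odot>\<^bsub>B\<^esub> b \<in> X"
  shows "\<exists>x\<in>X. r \<odot>\<^bsub>B\<^esub> b = r \<odot>\<^bsub>B\<^esub> x"
proof -
  interpret B: module S B by fact
  let ?C = "cyclic_mod S r"
  let ?i = "\<lambda>X. (\<lambda>s. [s]) ` X :: 's list set"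
  let ?N = "transport_module ?i ?C"
  let ?u = "PIdl\<^bsub>S\<^esub> r +>\<^bsub>S\<^esub> \<one>\<^bsub>S\<^esub>"
  note C = B.R.cyclic_mod_facts[OF r]
  interpret C: module S ?C by (rule C(1))
  have inj: "inj_on ?i (carrier ?C)"
    by (rule inj_onI) (simp add: inj_image_eq_iff inj_def)
  have N: "module S ?N" by (rule transport_module_module[OF C(1) inj])
  have sm: "s \<odot>\<^bsub>?N\<^esub> ?i ?u = ?i (s \<odot>\<^bsub>?C\<^esub> ?u)" for s
    by (rule transport_module_simps(4)[OF inj C(3)])
  have gen: "carrier ?N = (\<lambda>s. s \<odot>\<^bsub>?N\<^esub> ?i ?u) ` carrier S"
    unfolding transport_module_simps(1) sm by (subst C(2)) (simp add: image_image)
  have ann: "s \<odot>\<^bsub>?N\<^esub> ?i ?u = \<zero>\<^bsub>?N\<^esub> \<longleftrightarrow> (\<exists>t\<in>carrier S. s = r \<otimes>\<^bsub>S\<^esub> t)" if s: "s \<in> carrier S" for s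
    unfolding sm transport_module_simps(2) C(4)[OF s, symmetric]
    by (rule inj_on_eq_iff[OF inj]) (use s C(3) in auto)
  have "tensor_inj S ?N X B" using pure N unfolding pure_sub_def by blast
  moreover have "?i ?u \<in> carrier ?N" using C(3) by (simp add: transport_module_simps(1))
  ultimately show ?thesis using tensor_inj_cyclic_iff[OF B N _ r gen ann X] b by blast
qed

text \<open>Lets modules over R_P be seen by the hypothesis, which concerns R-modules.\<close>

definition restrict_scalars :: "('r \<Rightarrow> 'l) \<Rightarrow> ('l,'v) module \<Rightarrow> ('r,'v) module" where
  "restrict_scalars \<phi> V = \<lparr>carrier = carrier V, mult = mult V, one = one V, zero = zero V,
     add = add V, smult = (\<lambda>c x. \<phi> c \<odot>\<^bsub>V\<^esub> x)\<rparr>"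

lemma restrict_scalars_simps:
  "carrier (restrict_scalars \<phi> V) = carrier V" "\<zero>\<^bsub>restrict_scalars \<phi> V\<^esub> = \<zero>\<^bsub>V\<^esub>"
  "x \<oplus>\<^bsub>restrict_scalars \<phi> V\<^esub> y = x \<oplus>\<^bsub>V\<^esub> y" "c \<odot>\<^bsub>restrict_scalars \<phi> V\<^esub> x = \<phi> c \<odot>\<^bsub>V\<^esub> x"
  "\<ominus>\<^bsub>restrict_scalars \<phi> V\<^esub> x = \<ominus>\<^bsub>V\<^esub> x" "x \<ominus>\<^bsub>restrict_scalars \<phi> V\<^esub> y = x \<ominus>\<^bsub>V\<^esub> y"
  by (simp_all add: restrict_scalars_def a_inv_def a_minus_def m_inv_def)

lemma restrict_scalars_module:
  assumes "cring R" "\<phi> \<in> ring_hom R L" "module L V"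
  shows "module R (restrict_scalars \<phi> V)"
proof -
  interpret R: cring R by fact
  interpret V: module L V by fact
  show ?thesis
  proof (rule moduleI[OF assms(1)])
    show "abelian_group (restrict_scalars \<phi> V)"
      by (rule abelian_groupI)
        (auto simp: restrict_scalars_simps V.M.a_ac intro: V.M.l_neg bexI[of _ "\<ominus>\<^bsub>V\<^esub> _"])
  qed (use assms(2) in \<open>auto simp: restrict_scalars_simps ring_hom_closed ring_hom_add
      ring_hom_mult ring_hom_one V.smult_l_distr V.smult_r_distr V.smult_assoc1\<close>)
qed

lemma module_hom_zero_uminus:
  assumes "module S A" "module S B" "f \<in> module_hom S A B"
  shows "f \<zero>\<^bsub>A\<^esub> = \<zero>\<^bsub>B\<^esub>" and "x \<in> carrier A \<Longrightarrow> f (\<ominus>\<^bsub>A\<^esub> x) = \<ominus>\<^bsub>B\<^esub> f x"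
proof -
  interpret A: module S A by fact
  interpret B: module S B by fact
  have f: "f x \<in> carrier B" "c \<in> carrier S \<Longrightarrow> f (c \<odot>\<^bsub>A\<^esub> x) = c \<odot>\<^bsub>B\<^esub> f x" if "x \<in> carrier A" for x c
    using assms(3) that by (auto simp: module_hom_def)
  show "f \<zero>\<^bsub>A\<^esub> = \<zero>\<^bsub>B\<^esub>"
    using f(1)[OF A.M.zero_closed] f(2)[OF A.M.zero_closed A.R.zero_closed] by simp
  show "f (\<ominus>\<^bsub>A\<^esub> x) = \<ominus>\<^bsub>B\<^esub> f x" if "x \<in> carrier A"
    using f(1)[OF that] f(2)[OF that, of "\<ominus>\<^bsub>S\<^esub> \<one>\<^bsub>S\<^esub>"] that by (simp add: A.smult_l_minus B.smult_l_minus)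
qed

text \<open>Finite geometric series; it inverts 1 + q wherever q becomes nilpotent.\<close>

lemma (in cring) one_plus_dvd:
  assumes q: "q \<in> carrier R"
  shows "\<exists>y\<in>carrier R. (\<one> \<oplus> q) \<otimes> y = \<one> \<ominus> (\<ominus> q) [^] (n::nat)"
proof (induction n)
  case 0
  show ?case using q by (intro bexI[of _ \<zero>]) (auto simp: minus_eq r_neg)
next
  case (Suc n)
  then obtain y where y: "y \<in> carrier R" "(\<one> \<oplus> q) \<otimes> y = \<one> \<ominus> (\<ominus> q) [^] n" by blast
  define z where "z = (\<ominus> q) [^] n"
  have z: "z \<in> carrier R" using q by (simp add: z_def)
  have "(\<one> \<oplus> q) \<otimes> (\<one> \<ominus> q \<otimes> y) = \<one> \<oplus> q \<ominus> q \<otimes> ((\<one> \<oplus> q) \<otimes> y)"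
    using q y(1) by algebra
  also have "\<dots> = \<one> \<oplus> q \<ominus> q \<otimes> (\<one> \<ominus> z)" by (simp add: y(2) z_def)
  also have "\<dots> = \<one> \<ominus> z \<otimes> \<ominus> q" using q z by algebra
  finally show ?case using q y(1) by (intro bexI[of _ "\<one> \<ominus> q \<otimes> y"]) (auto simp: z_def)
qed

context cring_maximal
begin

text \<open>K below is a complement of E in the pushout (B \<oplus> E) / N of f and g.  It exists because an
  essential RD-pure extension of E is trivial here: if p x \<in> E then p x = p e with e \<in> E, and x - e
  is annihilated by P, hence lies in E.\<close>

lemma pure_hom_extension:
  fixes L :: "('l,'d) ring_scheme" and \<phi> :: "'r \<Rightarrow> 'l"
    and E :: "('l,'e) module" and A :: "('l,'a) module" and B :: "('l,'b) module"
    and j :: "'b \<times> 'e \<Rightarrow> 't"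
  assumes hyp: "\<forall>(B :: ('r,'t set) module) A.
      module R B \<and> submodule A R B \<and> RD_essential R A B \<longrightarrow> essential R A B"
    and j: "inj j"
    and \<phi>: "\<phi> \<in> ring_hom R L"
    and unit: "\<And>u. \<lbrakk>u \<in> carrier R; u \<notin> P\<rbrakk> \<Longrightarrow> \<exists>w\<in>carrier R. \<phi> (w \<otimes> u) = \<one>\<^bsub>L\<^esub>"
    and fracs: "\<And>x. x \<in> carrier L \<Longrightarrow> \<exists>t\<in>carrier R - P. \<exists>c\<in>carrier R. \<phi> t \<otimes>\<^bsub>L\<^esub> x = \<phi> c"
    and p: "p \<in> P" and princ: "\<And>a. a \<in> P \<Longrightarrow> \<exists>t\<in>carrier R - P. \<exists>c\<in>carrier R. t \<otimes> a = p \<otimes> c"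
    and nil: "\<phi> (p [^] (n::nat)) = \<zero>\<^bsub>L\<^esub>"
    and E: "module L E" and A: "module L A" and B: "module L B"
    and f: "pure_mono L A B f" and g: "g \<in> module_hom L A E"
  shows "\<exists>h\<in>module_hom L B E. \<forall>a\<in>carrier A. h (f a) = g a"
proof -
  interpret E: module L E by fact
  interpret A: module L A by fact
  interpret B: module L B by fact
  have f_hom: "f \<in> module_hom L A B" and f_inj: "inj_on f (carrier A)"
    and f_pure: "pure_sub L (f ` carrier A) B" using f by (auto simp: pure_mono_def)
  have fc [simp]: "f x \<in> carrier B" if "x \<in> carrier A" for x using that f_hom by (auto simp: module_hom_def)
  have gc [simp]: "g x \<in> carrier E" if "x \<in> carrier A" for x using that g by (auto simp: module_hom_def)
  have f_add: "f (x \<oplus>\<^bsub>A\<^esub> y) = f x \<oplus>\<^bsub>B\<^esub> f y" if "x \<in> carrier A" "y \<in> carrier A" for x y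
    using that f_hom by (auto simp: module_hom_def)
  have g_add: "g (x \<oplus>\<^bsub>A\<^esub> y) = g x \<oplus>\<^bsub>E\<^esub> g y" if "x \<in> carrier A" "y \<in> carrier A" for x y
    using that g by (auto simp: module_hom_def)
  have f_sm: "f (c \<odot>\<^bsub>A\<^esub> x) = c \<odot>\<^bsub>B\<^esub> f x" if "c \<in> carrier L" "x \<in> carrier A" for c x
    using that f_hom by (auto simp: module_hom_def)
  have g_sm: "g (c \<odot>\<^bsub>A\<^esub> x) = c \<odot>\<^bsub>E\<^esub> g x" if "c \<in> carrier L" "x \<in> carrier A" for c x
    using that g by (auto simp: module_hom_def)
  note f0 = module_hom_zero_uminus[OF A B f_hom] and g0 = module_hom_zero_uminus[OF A E g]
  have \<phi>c [simp]: "\<phi> c \<in> carrier L" if "c \<in> carrier R" for c by (rule ring_hom_closed[OF \<phi> that])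
  let ?X = "f ` carrier A"
  have X: "submodule ?X L B"
  proof (rule B.submoduleI)
    show "?X \<subseteq> carrier B" by auto
    show "\<zero>\<^bsub>B\<^esub> \<in> ?X" using f0(1) A.M.zero_closed by (metis imageI)
    show "\<ominus>\<^bsub>B\<^esub> b \<in> ?X" if "b \<in> ?X" for b using that by (auto simp flip: f0(2))
    show "b \<oplus>\<^bsub>B\<^esub> b' \<in> ?X" if "b \<in> ?X" "b' \<in> ?X" for b b' using that by (auto simp flip: f_add)
    show "c \<odot>\<^bsub>B\<^esub> b \<in> ?X" if "c \<in> carrier L" "b \<in> ?X" for b c using that by (auto simp flip: f_sm)
  qed
  let ?B = "restrict_scalars \<phi> B" and ?E = "restrict_scalars \<phi> E"
  let ?M = "prod_module ?B ?E"
  have RB: "module R ?B" and RE: "module R ?E"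
    by (rule restrict_scalars_module[OF is_cring \<phi>]; fact)+
  have M: "module R ?M" by (rule prod_module_module[OF RB RE])
  interpret M: module R ?M by (rule M)
  have Mc: "carrier ?M = carrier B \<times> carrier E"
    and M0: "\<zero>\<^bsub>?M\<^esub> = (\<zero>\<^bsub>B\<^esub>, \<zero>\<^bsub>E\<^esub>)"
    and Madd: "\<And>b b' e e'. (b, e) \<oplus>\<^bsub>?M\<^esub> (b', e') = (b \<oplus>\<^bsub>B\<^esub> b', e \<oplus>\<^bsub>E\<^esub> e')"
    and Msm: "\<And>c b e. c \<odot>\<^bsub>?M\<^esub> (b, e) = (\<phi> c \<odot>\<^bsub>B\<^esub> b, \<phi> c \<odot>\<^bsub>E\<^esub> e)"
    by (simp_all add: prod_module_simps restrict_scalars_simps)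
  have Mneg: "\<ominus>\<^bsub>?M\<^esub> (b, e) = (\<ominus>\<^bsub>B\<^esub> b, \<ominus>\<^bsub>E\<^esub> e)" if "b \<in> carrier B" "e \<in> carrier E" for b e
    using prod_module_minus(1)[OF RB RE, of b b e e] that by (simp add: restrict_scalars_simps)
  have Mminus: "(b, e) \<ominus>\<^bsub>?M\<^esub> (b', e') = (b \<ominus>\<^bsub>B\<^esub> b', e \<ominus>\<^bsub>E\<^esub> e')"
    if "b \<in> carrier B" "e \<in> carrier E" "b' \<in> carrier B" "e' \<in> carrier E" for b e b' e'
    using prod_module_minus(2)[OF RB RE, of b b' e e'] that by (simp add: restrict_scalars_simps)
  \<comment> \<open>M/N is the pushout of f and g, and A'/N is the image of E in it: modulo N, (f a,
    e) equals (0, e + g a).\<close>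
  define A' where "A' = ?X \<times> carrier E"
  define N where "N = (\<lambda>a. (f a, \<ominus>\<^bsub>E\<^esub> g a)) ` carrier A"
  have A': "submodule A' R ?M"
    using B.submoduleE(3,4,5)[OF X] submodule_zero[OF B X]
    by (intro M.submoduleI) (auto simp: A'_def Mc M0 Madd Msm Mneg)
  have N: "submodule N R ?M"
  proof (rule M.submoduleI)
    show "N \<subseteq> carrier ?M" by (auto simp: N_def Mc)
    show "\<zero>\<^bsub>?M\<^esub> \<in> N" unfolding N_def M0
      by (rule image_eqI[of _ _ "\<zero>\<^bsub>A\<^esub>"]) (auto simp: f0 g0 E.M.a_inv_zero)
    show "\<ominus>\<^bsub>?M\<^esub> x \<in> N" if x: "x \<in> N" for x
    proof -
      obtain a where a: "a \<in> carrier A" "x = (f a, \<ominus>\<^bsub>E\<^esub> g a)" using x by (auto simp: N_def)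
      then have "\<ominus>\<^bsub>?M\<^esub> x = (f (\<ominus>\<^bsub>A\<^esub> a), \<ominus>\<^bsub>E\<^esub> g (\<ominus>\<^bsub>A\<^esub> a))" by (simp add: Mneg f0 g0)
      then show ?thesis using a by (auto simp: N_def)
    qed
    show "x \<oplus>\<^bsub>?M\<^esub> y \<in> N" if xy: "x \<in> N" "y \<in> N" for x y
    proof -
      obtain a b where a: "a \<in> carrier A" "x = (f a, \<ominus>\<^bsub>E\<^esub> g a)" "b \<in> carrier A" "y = (f b, \<ominus>\<^bsub>E\<^esub> g b)"
        using xy by (auto simp: N_def)
      then have "x \<oplus>\<^bsub>?M\<^esub> y = (f (a \<oplus>\<^bsub>A\<^esub> b), \<ominus>\<^bsub>E\<^esub> g (a \<oplus>\<^bsub>A\<^esub> b))"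
        by (simp add: Madd f_add g_add E.M.minus_add)
      then show ?thesis using a by (auto simp: N_def)
    qed
    show "c \<odot>\<^bsub>?M\<^esub> x \<in> N" if c: "c \<in> carrier R" and x: "x \<in> N" for c x
    proof -
      obtain a where a: "a \<in> carrier A" "x = (f a, \<ominus>\<^bsub>E\<^esub> g a)" using x by (auto simp: N_def)
      then have "c \<odot>\<^bsub>?M\<^esub> x = (f (\<phi> c \<odot>\<^bsub>A\<^esub> a), \<ominus>\<^bsub>E\<^esub> g (\<phi> c \<odot>\<^bsub>A\<^esub> a))"
        using c by (simp add: Msm f_sm g_sm E.smult_r_minus)
      then show ?thesis using a c by (auto simp: N_def)
    qed
  qed
  have NA': "N \<subseteq> A'" by (auto simp: N_def A'_def)
  note A'E = M.submoduleE[OF A']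
  have pure: "RD_pure_over R ?M A' N N"
    unfolding RD_pure_over_def
  proof (intro ballI impI)
    fix r m x assume r: "r \<in> carrier R" and m: "m \<in> carrier ?M" and x: "x \<in> A'"
      and rm: "r \<odot>\<^bsub>?M\<^esub> m \<ominus>\<^bsub>?M\<^esub> x \<in> N"
    obtain b e0 where b: "m = (b, e0)" "b \<in> carrier B" "e0 \<in> carrier E" using m by (auto simp: Mc)
    obtain a e where a: "x = (f a, e)" "a \<in> carrier A" "e \<in> carrier E" using x by (auto simp: A'_def)
    obtain a1 where a1: "a1 \<in> carrier A" "\<phi> r \<odot>\<^bsub>B\<^esub> b \<ominus>\<^bsub>B\<^esub> f a = f a1" "\<phi> r \<odot>\<^bsub>E\<^esub> e0 \<ominus>\<^bsub>E\<^esub> e = \<ominus>\<^bsub>E\<^esub> g a1"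
      using rm r a b by (auto simp: N_def Msm Mminus)
    have "(\<phi> r \<odot>\<^bsub>B\<^esub> b \<ominus>\<^bsub>B\<^esub> f a) \<oplus>\<^bsub>B\<^esub> f a = \<phi> r \<odot>\<^bsub>B\<^esub> b"
      using r a b by (simp add: B.M.minus_eq B.M.a_assoc B.M.l_neg)
    then have rb: "\<phi> r \<odot>\<^bsub>B\<^esub> b = f (a1 \<oplus>\<^bsub>A\<^esub> a)" using a1 a by (simp add: f_add)
    then have "\<phi> r \<odot>\<^bsub>B\<^esub> b \<in> ?X" using a1 a by simp
    \<comment> \<open>The first coordinate is solved by RD-purity of f(A) in B; in the second, e0
      itself serves.\<close>
    then obtain a2 where a2: "a2 \<in> carrier A" "\<phi> r \<odot>\<^bsub>B\<^esub> b = \<phi> r \<odot>\<^bsub>B\<^esub> f a2"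
      using pure_sub_imp_RD[OF B X f_pure \<phi>c[OF r] b(2)] by auto
    have "f a \<ominus>\<^bsub>B\<^esub> \<phi> r \<odot>\<^bsub>B\<^esub> f a2 = f (\<ominus>\<^bsub>A\<^esub> a1)"
      unfolding a2(2)[symmetric] rb using a1 a
      by (simp add: f_add f0 B.M.a_minus_add_self)
    moreover have "e \<ominus>\<^bsub>E\<^esub> \<phi> r \<odot>\<^bsub>E\<^esub> e0 = \<ominus>\<^bsub>E\<^esub> g (\<ominus>\<^bsub>A\<^esub> a1)"
    proof -
      have "e \<ominus>\<^bsub>E\<^esub> \<phi> r \<odot>\<^bsub>E\<^esub> e0 = \<ominus>\<^bsub>E\<^esub> (\<phi> r \<odot>\<^bsub>E\<^esub> e0 \<ominus>\<^bsub>E\<^esub> e)"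
        using r a b by (simp add: E.M.minus_eq E.M.minus_add E.M.a_comm)
      then show ?thesis using a1 by (simp add: g0)
    qed
    ultimately have "x \<ominus>\<^bsub>?M\<^esub> r \<odot>\<^bsub>?M\<^esub> (f a2, e0) \<in> N"
      using a b a2(1) r a1(1) by (auto simp: N_def Msm Mminus)
    moreover have "(f a2, e0) \<in> A'" using a2(1) b by (simp add: A'_def)
    ultimately show "\<exists>a'\<in>A'. x \<ominus>\<^bsub>?M\<^esub> r \<odot>\<^bsub>?M\<^esub> a' \<in> N" by blast
  qed
  have "inj_on j (carrier ?M)" using j by (rule inj_on_subset) simp
  from RD_essential_quotient[OF hyp M A' N NA' this pure]
  obtain K where K: "submodule K R ?M" and NK: "N \<subseteq> K" and pureK: "RD_pure_over R ?M A' N K"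
    and ess: "\<And>m. \<lbrakk>m \<in> carrier ?M; m \<notin> K\<rbrakk>
      \<Longrightarrow> \<exists>s\<in>carrier R. \<exists>a\<in>A'. a \<notin> N \<and> s \<odot>\<^bsub>?M\<^esub> m \<ominus>\<^bsub>?M\<^esub> a \<in> K" by metis
  note KE = M.submoduleE[OF K]
  have Minv: "\<exists>w\<in>carrier R. \<forall>m\<in>carrier ?M. w \<odot>\<^bsub>?M\<^esub> (u \<odot>\<^bsub>?M\<^esub> m) = m"
    if u: "u \<in> carrier R" "u \<notin> P" for u
  proof -
    obtain w where w: "w \<in> carrier R" "\<phi> (w \<otimes> u) = \<one>\<^bsub>L\<^esub>" using unit u by blast
    have "w \<odot>\<^bsub>?M\<^esub> (u \<odot>\<^bsub>?M\<^esub> m) = m" if "m \<in> carrier ?M" for m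
    proof -
      have "w \<odot>\<^bsub>?M\<^esub> (u \<odot>\<^bsub>?M\<^esub> m) = (w \<otimes> u) \<odot>\<^bsub>?M\<^esub> m" using w u that by (simp add: M.smult_assoc1)
      also have "\<dots> = m" using that by (cases m) (auto simp: Msm w(2) Mc)
      finally show ?thesis .
    qed
    then show ?thesis using w by blast
  qed
  \<comment> \<open>Membership in A' + K. Showing this for all of M makes K/N a complement of
    A'/N.\<close>
  define good where "good m \<longleftrightarrow> (\<exists>x\<in>A'. m \<ominus>\<^bsub>?M\<^esub> x \<in> K)" for m
  have A'M: "x \<in> carrier ?M" if "x \<in> A'" for x using that A'E(1) by blast
  have step: "good m" if m: "m \<in> carrier ?M" and "good (p \<odot>\<^bsub>?M\<^esub> m)" for m
  proof -
    have pR: "p \<in> carrier R" using p by simp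
    obtain x where x: "x \<in> A'" "p \<odot>\<^bsub>?M\<^esub> m \<ominus>\<^bsub>?M\<^esub> x \<in> K" using \<open>good (p \<odot>\<^bsub>?M\<^esub> m)\<close> by (auto simp: good_def)
    obtain a where a: "a \<in> A'" "x \<ominus>\<^bsub>?M\<^esub> p \<odot>\<^bsub>?M\<^esub> a \<in> N"
      using RD_pure_overD[OF pureK pR m x] by blast
    define y where "y = m \<ominus>\<^bsub>?M\<^esub> a"
    have y: "y \<in> carrier ?M" using m A'M[OF a(1)] by (simp add: y_def)
    have "(p \<odot>\<^bsub>?M\<^esub> m \<ominus>\<^bsub>?M\<^esub> x) \<oplus>\<^bsub>?M\<^esub> (x \<ominus>\<^bsub>?M\<^esub> p \<odot>\<^bsub>?M\<^esub> a) \<in> K"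
      by (rule KE(5)[OF x(2)]) (use a NK in blast)
    moreover have "(p \<odot>\<^bsub>?M\<^esub> m \<ominus>\<^bsub>?M\<^esub> x) \<oplus>\<^bsub>?M\<^esub> (x \<ominus>\<^bsub>?M\<^esub> p \<odot>\<^bsub>?M\<^esub> a) = p \<odot>\<^bsub>?M\<^esub> y"
      using pR m A'M[OF a(1)] A'M[OF x(1)]
      by (simp add: y_def M.M.minus_eq M.smult_r_distr M.smult_r_minus M.M.a_assoc M.M.r_neg1)
    ultimately have py: "p \<odot>\<^bsub>?M\<^esub> y \<in> K" by simp
    \<comment> \<open>Up to a factor acting invertibly on M, every q in P is a multiple of p, and p
      y already lies in K.\<close>
    have Py: "q \<odot>\<^bsub>?M\<^esub> y \<in> K" if q: "q \<in> P" for q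
    proof -
      obtain t c where t: "t \<in> carrier R" "t \<notin> P" and c: "c \<in> carrier R" "t \<otimes> q = p \<otimes> c"
        using princ[OF q] by blast
      obtain w where w: "w \<in> carrier R" "\<forall>m\<in>carrier ?M. w \<odot>\<^bsub>?M\<^esub> (t \<odot>\<^bsub>?M\<^esub> m) = m"
        using Minv[OF t] by blast
      have "t \<odot>\<^bsub>?M\<^esub> (q \<odot>\<^bsub>?M\<^esub> y) = (p \<otimes> c) \<odot>\<^bsub>?M\<^esub> y" using t q y by (simp add: M.smult_assoc1 flip: c(2))
      also have "\<dots> = c \<odot>\<^bsub>?M\<^esub> (p \<odot>\<^bsub>?M\<^esub> y)" using pR c y by (simp add: m_comm flip: M.smult_assoc1)
      also have "\<dots> \<in> K" using KE(4)[OF c(1) py] .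
      finally have "w \<odot>\<^bsub>?M\<^esub> (t \<odot>\<^bsub>?M\<^esub> (q \<odot>\<^bsub>?M\<^esub> y)) \<in> K" by (rule KE(4)[OF w(1)])
      then show ?thesis using w(2) q y by simp
    qed
    show ?thesis
    proof (cases "y \<in> K")
      case True
      then show ?thesis using a(1) unfolding good_def y_def by blast
    next
      case False
      then obtain s a1 where s: "s \<in> carrier R" and a1: "a1 \<in> A'" "a1 \<notin> N"
        and sy: "s \<odot>\<^bsub>?M\<^esub> y \<ominus>\<^bsub>?M\<^esub> a1 \<in> K" using ess[OF y] by blast
      \<comment> \<open>Otherwise s y, and with it a1, would lie in K, whereas A' \<inter> K
        \<subseteq> N.\<close>
      have "s \<notin> P"
      proof
        assume "s \<in> P"
        then have sK: "s \<odot>\<^bsub>?M\<^esub> y \<in> K" using Py by blast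
        have "s \<odot>\<^bsub>?M\<^esub> y \<ominus>\<^bsub>?M\<^esub> (s \<odot>\<^bsub>?M\<^esub> y \<ominus>\<^bsub>?M\<^esub> a1) \<in> K" by (rule submodule_minus[OF M K sK sy])
        moreover have "s \<odot>\<^bsub>?M\<^esub> y \<ominus>\<^bsub>?M\<^esub> (s \<odot>\<^bsub>?M\<^esub> y \<ominus>\<^bsub>?M\<^esub> a1) = a1"
          using s y A'M[OF a1(1)] by (simp add: M.M.minus_eq M.M.minus_add M.M.r_neg2)
        ultimately have "a1 \<in> N"
          using RD_pure_over_Int[OF M A' K _ pureK a1(1)] M.submoduleE(1)[OF N] by simp
        then show False using a1 by simp
      qed
      then obtain w where w: "w \<in> carrier R" "\<forall>m\<in>carrier ?M. w \<odot>\<^bsub>?M\<^esub> (s \<odot>\<^bsub>?M\<^esub> m) = m"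
        using Minv[OF s] by blast
      have "w \<odot>\<^bsub>?M\<^esub> (s \<odot>\<^bsub>?M\<^esub> y \<ominus>\<^bsub>?M\<^esub> a1) \<in> K" by (rule KE(4)[OF w(1) sy])
      moreover have "w \<odot>\<^bsub>?M\<^esub> (s \<odot>\<^bsub>?M\<^esub> y \<ominus>\<^bsub>?M\<^esub> a1) = m \<ominus>\<^bsub>?M\<^esub> (a \<oplus>\<^bsub>?M\<^esub> w \<odot>\<^bsub>?M\<^esub> a1)"
      proof -
        have "w \<odot>\<^bsub>?M\<^esub> (s \<odot>\<^bsub>?M\<^esub> y \<ominus>\<^bsub>?M\<^esub> a1) = y \<ominus>\<^bsub>?M\<^esub> w \<odot>\<^bsub>?M\<^esub> a1"
          using w s y A'M[OF a1(1)] by (simp add: M.M.minus_eq M.smult_r_distr M.smult_r_minus)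
        then show ?thesis
          using m A'M[OF a(1)] A'M[OF a1(1)] w(1) by (simp add: y_def M.M.minus_eq M.M.minus_add M.M.a_assoc)
      qed
      ultimately show ?thesis
        unfolding good_def using A'E(5)[OF a(1) A'E(4)[OF w(1) a1(1)]] by auto
    qed
  qed
  have pow: "good m" if "m \<in> carrier ?M" "good (p [^] (k::nat) \<odot>\<^bsub>?M\<^esub> m)" for k m
    using that
  proof (induction k arbitrary: m)
    case 0
    then show ?case by simp
  next
    case (Suc k)
    have eq: "p [^] Suc k \<odot>\<^bsub>?M\<^esub> m = p [^] k \<odot>\<^bsub>?M\<^esub> (p \<odot>\<^bsub>?M\<^esub> m)" using Suc(2) p by (simp add: M.smult_assoc1)
    have pm: "p \<odot>\<^bsub>?M\<^esub> m \<in> carrier ?M" using Suc(2) p by simp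
    show ?case by (rule step[OF Suc(2) Suc.IH[OF pm Suc(3)[unfolded eq]]])
  qed
  have all_good: "good m" if m: "m \<in> carrier ?M" for m
  proof (rule pow[OF m])
    have "p [^] n \<odot>\<^bsub>?M\<^esub> m = \<zero>\<^bsub>?M\<^esub>" using m by (cases m) (auto simp: Msm nil Mc M0)
    moreover have "\<zero>\<^bsub>?M\<^esub> \<ominus>\<^bsub>?M\<^esub> \<zero>\<^bsub>?M\<^esub> \<in> K" using submodule_zero[OF M K] by (simp add: M.M.a_minus_zero)
    ultimately show "good (p [^] n \<odot>\<^bsub>?M\<^esub> m)" unfolding good_def using submodule_zero[OF M A'] by auto
  qed
  have ex: "\<exists>e\<in>carrier E. (b, \<ominus>\<^bsub>E\<^esub> e) \<in> K" if b: "b \<in> carrier B" for b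
  proof -
    have "good (b, \<zero>\<^bsub>E\<^esub>)" by (rule all_good) (simp add: Mc b)
    then obtain a e where a: "a \<in> carrier A" "e \<in> carrier E" "(b, \<zero>\<^bsub>E\<^esub>) \<ominus>\<^bsub>?M\<^esub> (f a, e) \<in> K"
      by (auto simp: good_def A'_def)
    \<comment> \<open>Adding this element of N trades the part f a of the first coordinate for g a
      in the second.\<close>
    have "(f a, \<ominus>\<^bsub>E\<^esub> g a) \<in> K" using a(1) NK by (auto simp: N_def)
    from KE(5)[OF a(3) this] have "(b, \<ominus>\<^bsub>E\<^esub> (e \<oplus>\<^bsub>E\<^esub> g a)) \<in> K"
      using a b by (simp add: Mminus Madd B.M.minus_eq B.M.a_assoc B.M.l_neg E.M.minus_eq E.M.minus_add)
    then show ?thesis using a by (intro bexI[of _ "e \<oplus>\<^bsub>E\<^esub> g a"]) auto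
  qed
  have uniq: "e = e'" if e: "e \<in> carrier E" "e' \<in> carrier E" "(b, \<ominus>\<^bsub>E\<^esub> e) \<in> K" "(b, \<ominus>\<^bsub>E\<^esub> e') \<in> K" for b e e'
  proof -
    have b: "b \<in> carrier B" using KE(1) e(3) by (auto simp: Mc)
    have "(b, \<ominus>\<^bsub>E\<^esub> e') \<ominus>\<^bsub>?M\<^esub> (b, \<ominus>\<^bsub>E\<^esub> e) \<in> K" by (rule submodule_minus[OF M K e(4,3)])
    then have 1: "(\<zero>\<^bsub>B\<^esub>, e \<ominus>\<^bsub>E\<^esub> e') \<in> K"
      using b e by (simp add: Mminus B.M.minus_eq B.M.r_neg E.M.minus_eq E.M.a_comm)
    have "\<zero>\<^bsub>B\<^esub> \<in> ?X" by (rule submodule_zero[OF B X])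
    then have "(\<zero>\<^bsub>B\<^esub>, e \<ominus>\<^bsub>E\<^esub> e') \<in> A'" using e by (simp add: A'_def)
    then have "(\<zero>\<^bsub>B\<^esub>, e \<ominus>\<^bsub>E\<^esub> e') \<in> N"
      using 1 RD_pure_over_Int[OF M A' K _ pureK] M.submoduleE(1)[OF N] by simp
    then obtain a where a: "a \<in> carrier A" "f a = \<zero>\<^bsub>B\<^esub>" "e \<ominus>\<^bsub>E\<^esub> e' = \<ominus>\<^bsub>E\<^esub> g a" by (auto simp: N_def)
    have "a = \<zero>\<^bsub>A\<^esub>" using inj_onD[OF f_inj, of a "\<zero>\<^bsub>A\<^esub>"] a f0(1) by simp
    then have "e \<ominus>\<^bsub>E\<^esub> e' = \<zero>\<^bsub>E\<^esub>" using a(3) g0(1) E.M.a_inv_zero by simp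
    then have "(e \<ominus>\<^bsub>E\<^esub> e') \<oplus>\<^bsub>E\<^esub> e' = e'" using e by simp
    then show ?thesis using e by (simp add: E.M.minus_eq E.M.a_assoc E.M.l_neg)
  qed
  \<comment> \<open>K is the graph of -h. Values exist because M = A' + K, and they are unique
    because A' \<inter> K = N and f is injective. The sign is that of N, so N \<subseteq> K yields h
    (f a) = g a.\<close>
  define h where "h b = (SOME e. e \<in> carrier E \<and> (b, \<ominus>\<^bsub>E\<^esub> e) \<in> K)" for b
  have h: "h b \<in> carrier E" "(b, \<ominus>\<^bsub>E\<^esub> h b) \<in> K" if "b \<in> carrier B" for b
    using someI_ex[of "\<lambda>e. e \<in> carrier E \<and> (b, \<ominus>\<^bsub>E\<^esub> e) \<in> K"] ex[OF that] unfolding h_def by blast+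
  have h_eq: "h b = e" if "e \<in> carrier E" "(b, \<ominus>\<^bsub>E\<^esub> e) \<in> K" for b e
  proof -
    have "b \<in> carrier B" using KE(1) that by (auto simp: Mc)
    then show ?thesis using uniq[OF h(1) that(1) h(2) that(2)] by simp
  qed
  have h_R: "h (\<phi> c \<odot>\<^bsub>B\<^esub> b) = \<phi> c \<odot>\<^bsub>E\<^esub> h b" if c: "c \<in> carrier R" and b: "b \<in> carrier B" for c b
    by (rule h_eq) (use KE(4)[OF c h(2)[OF b]] c h(1)[OF b] in \<open>auto simp: Msm E.smult_r_minus\<close>)
  have "h \<in> module_hom L B E"
    unfolding module_hom_def
  proof (intro CollectI conjI ballI)
    show "h \<in> carrier B \<rightarrow> carrier E" using h by auto
    show "h (x \<oplus>\<^bsub>B\<^esub> y) = h x \<oplus>\<^bsub>E\<^esub> h y" if x: "x \<in> carrier B" and y: "y \<in> carrier B" for x y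
      by (rule h_eq) (use KE(5)[OF h(2)[OF x] h(2)[OF y]] h(1)[OF x] h(1)[OF y] in
          \<open>auto simp: Madd E.M.minus_add\<close>)
    \<comment> \<open>K is only an R-submodule, so h is at first linear over the image of R. A
      scalar of L is handled by clearing its denominator t, which acts invertibly on E.\<close>
    show "h (c \<odot>\<^bsub>B\<^esub> x) = c \<odot>\<^bsub>E\<^esub> h x" if c: "c \<in> carrier L" and x: "x \<in> carrier B" for c x
    proof -
      obtain t d where t: "t \<in> carrier R" "t \<notin> P" and d: "d \<in> carrier R" "\<phi> t \<otimes>\<^bsub>L\<^esub> c = \<phi> d"
        using fracs[OF c] by blast
      obtain w where w: "w \<in> carrier R" "\<phi> (w \<otimes> t) = \<one>\<^bsub>L\<^esub>" using unit[OF t] by blast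
      have wt: "\<phi> w \<otimes>\<^bsub>L\<^esub> \<phi> t = \<one>\<^bsub>L\<^esub>" using w t \<phi> by (simp add: ring_hom_mult)
      have cancel: "\<phi> w \<odot>\<^bsub>E\<^esub> (\<phi> t \<odot>\<^bsub>E\<^esub> e) = e" if "e \<in> carrier E" for e
        using that w t wt by (simp flip: E.smult_assoc1)
      have "\<phi> t \<odot>\<^bsub>E\<^esub> h (c \<odot>\<^bsub>B\<^esub> x) = h (\<phi> t \<odot>\<^bsub>B\<^esub> (c \<odot>\<^bsub>B\<^esub> x))" using h_R t c x by simp
      also have "\<dots> = h (\<phi> d \<odot>\<^bsub>B\<^esub> x)" using t c x by (simp add: d(2) flip: B.smult_assoc1)
      also have "\<dots> = \<phi> d \<odot>\<^bsub>E\<^esub> h x" using h_R d x by simp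
      also have "\<dots> = \<phi> t \<odot>\<^bsub>E\<^esub> (c \<odot>\<^bsub>E\<^esub> h x)" using t c h(1)[OF x] by (simp flip: d(2) E.smult_assoc1)
      finally have eq: "\<phi> t \<odot>\<^bsub>E\<^esub> h (c \<odot>\<^bsub>B\<^esub> x) = \<phi> t \<odot>\<^bsub>E\<^esub> (c \<odot>\<^bsub>E\<^esub> h x)" .
      then have "\<phi> w \<odot>\<^bsub>E\<^esub> (\<phi> t \<odot>\<^bsub>E\<^esub> h (c \<odot>\<^bsub>B\<^esub> x)) = \<phi> w \<odot>\<^bsub>E\<^esub> (\<phi> t \<odot>\<^bsub>E\<^esub> (c \<odot>\<^bsub>E\<^esub> h x))" by simp
      then show ?thesis using cancel c x h(1) by simp
    qed
  qed
  moreover have "h (f a) = g a" if "a \<in> carrier A" for a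
    by (rule h_eq) (use that NK in \<open>auto simp: N_def\<close>)
  ultimately show ?thesis by blast
qed

end

section \<open>The localization at a maximal ideal\<close>

context cring_maximal
begin

abbreviation "S \<equiv> carrier R - P"

lemma S_mult: "\<lbrakk>s \<in> S; t \<in> S\<rbrakk> \<Longrightarrow> s \<otimes> t \<in> S"
  using mult_notin_P by auto

lemma loc_eqI:
  assumes "a \<in> carrier R" "b \<in> carrier R" "s \<in> S" "t \<in> S" "u \<in> S" "u \<otimes> (a \<otimes> t \<ominus> b \<otimes> s) = \<zero>"
  shows "((a, s), (b, t)) \<in> loc_eq R S"
  using assms unfolding loc_eq_def by blast

lemma loc_eq_equiv: "equiv (carrier R \<times> S) (loc_eq R S)"
proof (rule equivI)
  show "loc_eq R S \<subseteq> (carrier R \<times> S) \<times> (carrier R \<times> S)" by (auto simp: loc_eq_def)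
  show "refl_on (carrier R \<times> S) (loc_eq R S)"
    using one_notin_P
    by (auto simp: refl_on_def minus_eq r_neg intro!: loc_eqI[where u = \<one>])
  show "sym (loc_eq R S)"
  proof (rule symI)
    fix x y assume xy: "(x, y) \<in> loc_eq R S"
    then obtain a s b t u where *: "x = (a, s)" "y = (b, t)" "a \<in> carrier R" "b \<in> carrier R"
      "s \<in> S" "t \<in> S" "u \<in> S" "u \<otimes> (a \<otimes> t \<ominus> b \<otimes> s) = \<zero>"
      unfolding loc_eq_def by blast
    have c: "s \<in> carrier R" "t \<in> carrier R" "u \<in> carrier R" using * by auto
    have "u \<otimes> (b \<otimes> s \<ominus> a \<otimes> t) = \<ominus> (u \<otimes> (a \<otimes> t \<ominus> b \<otimes> s))" using *(3,4) c by algebra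
    then have "u \<otimes> (b \<otimes> s \<ominus> a \<otimes> t) = \<zero>" using *(8) by simp
    then show "(y, x) \<in> loc_eq R S" unfolding *(1,2) using * loc_eqI by blast
  qed
  show "trans (loc_eq R S)"
  proof (rule transI)
    fix x y z assume xy: "(x, y) \<in> loc_eq R S" and yz: "(y, z) \<in> loc_eq R S"
    obtain a s b t u where *: "x = (a, s)" "y = (b, t)" "a \<in> carrier R" "b \<in> carrier R"
      "s \<in> S" "t \<in> S" "u \<in> S" "u \<otimes> (a \<otimes> t \<ominus> b \<otimes> s) = \<zero>"
      using xy unfolding loc_eq_def by blast
    obtain c w v where **: "z = (c, w)" "c \<in> carrier R" "w \<in> S" "v \<in> S" "v \<otimes> (b \<otimes> w \<ominus> c \<otimes> t) = \<zero>"
      using yz *(2) unfolding loc_eq_def by blast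
    have cc: "s \<in> carrier R" "t \<in> carrier R" "u \<in> carrier R" "w \<in> carrier R" "v \<in> carrier R"
      using * ** by auto
    \<comment> \<open>The factor t enters the witness because b/t is eliminated between the two
      relations.\<close>
    have "(u \<otimes> (v \<otimes> t)) \<otimes> (a \<otimes> w \<ominus> c \<otimes> s) =
      (v \<otimes> w) \<otimes> (u \<otimes> (a \<otimes> t \<ominus> b \<otimes> s)) \<oplus> (u \<otimes> s) \<otimes> (v \<otimes> (b \<otimes> w \<ominus> c \<otimes> t))"
      using *(3,4) **(2) cc by algebra
    then have "(u \<otimes> (v \<otimes> t)) \<otimes> (a \<otimes> w \<ominus> c \<otimes> s) = \<zero>" using *(8) **(5) cc by simp
    moreover have "u \<otimes> (v \<otimes> t) \<in> S" using *(6,7) **(4) S_mult by blast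
    ultimately show "(x, z) \<in> loc_eq R S"
      unfolding *(1) **(1) using loc_eqI[OF *(3) **(2) *(5) **(3)] by blast
  qed
qed

lemma frac_eq_iff:
  assumes "a \<in> carrier R" "b \<in> carrier R" "s \<in> S" "t \<in> S"
  shows "frac R S a s = frac R S b t \<longleftrightarrow> ((a, s), (b, t)) \<in> loc_eq R S"
  unfolding frac_def using eq_equiv_class_iff[OF loc_eq_equiv, of "(a, s)" "(b, t)"] assms by simp

lemma frac_eqI:
  assumes "a \<in> carrier R" "b \<in> carrier R" "s \<in> S" "t \<in> S" "u \<in> S" "u \<otimes> (a \<otimes> t \<ominus> b \<otimes> s) = \<zero>"
  shows "frac R S a s = frac R S b t"
  using loc_eqI[OF assms] frac_eq_iff assms by blast

text \<open>The operations of the localization pick representatives with \<open>SOME\<close>. All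
  that is known of the picked pair is that it is equivalent to the given one.\<close>

lemma some_in_frac:
  assumes "a \<in> carrier R" "s \<in> S"
  obtains a' s' u where "(SOME p. p \<in> frac R S a s) = (a', s')" "a' \<in> carrier R" "s' \<in> S" "u \<in> S"
    "u \<otimes> (a \<otimes> s' \<ominus> a' \<otimes> s) = \<zero>"
proof -
  have "(a, s) \<in> frac R S a s"
    unfolding frac_def using equiv_class_self[OF loc_eq_equiv] assms by blast
  then have "(SOME p. p \<in> frac R S a s) \<in> frac R S a s" by (rule someI)
  then have "((a, s), SOME p. p \<in> frac R S a s) \<in> loc_eq R S" by (simp add: frac_def)
  then show thesis using that unfolding loc_eq_def by blast
qed

lemma frac_mult:
  assumes "a \<in> carrier R" "b \<in> carrier R" "s \<in> S" "t \<in> S"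
  shows "frac R S a s \<otimes>\<^bsub>localize_at R P\<^esub> frac R S b t = frac R S (a \<otimes> b) (s \<otimes> t)"
proof -
  obtain a' s' u where 1: "(SOME p. p \<in> frac R S a s) = (a', s')" "a' \<in> carrier R" "s' \<in> S" "u \<in> S"
    "u \<otimes> (a \<otimes> s' \<ominus> a' \<otimes> s) = \<zero>" using some_in_frac[OF assms(1,3)] .
  obtain b' t' v where 2: "(SOME p. p \<in> frac R S b t) = (b', t')" "b' \<in> carrier R" "t' \<in> S" "v \<in> S"
    "v \<otimes> (b \<otimes> t' \<ominus> b' \<otimes> t) = \<zero>" using some_in_frac[OF assms(2,4)] .
  have c: "s \<in> carrier R" "t \<in> carrier R" "s' \<in> carrier R" "t' \<in> carrier R" "u \<in> carrier R" "v \<in> carrier R"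
    using assms 1 2 by auto
  \<comment> \<open>The product of the two witnesses works, since the difference of the fractions is
    a combination of the two given relations.\<close>
  have "(u \<otimes> v) \<otimes> ((a' \<otimes> b') \<otimes> (s \<otimes> t) \<ominus> (a \<otimes> b) \<otimes> (s' \<otimes> t')) =
    \<ominus> ((v \<otimes> (b \<otimes> t')) \<otimes> (u \<otimes> (a \<otimes> s' \<ominus> a' \<otimes> s)) \<oplus> (u \<otimes> (a' \<otimes> s)) \<otimes> (v \<otimes> (b \<otimes> t' \<ominus> b' \<otimes> t)))"
    using assms(1,2) 1(2) 2(2) c by algebra
  then have "(u \<otimes> v) \<otimes> ((a' \<otimes> b') \<otimes> (s \<otimes> t) \<ominus> (a \<otimes> b) \<otimes> (s' \<otimes> t')) = \<zero>"
    using 1 2 assms c by simp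
  then have "frac R S (a' \<otimes> b') (s' \<otimes> t') = frac R S (a \<otimes> b) (s \<otimes> t)"
    using 1 2 assms S_mult by (intro frac_eqI[where u = "u \<otimes> v"]) blast+
  then show ?thesis by (simp add: localize_at_def localization_def 1(1) 2(1))
qed

lemma frac_add:
  assumes "a \<in> carrier R" "b \<in> carrier R" "s \<in> S" "t \<in> S"
  shows "frac R S a s \<oplus>\<^bsub>localize_at R P\<^esub> frac R S b t = frac R S (a \<otimes> t \<oplus> b \<otimes> s) (s \<otimes> t)"
proof -
  obtain a' s' u where 1: "(SOME p. p \<in> frac R S a s) = (a', s')" "a' \<in> carrier R" "s' \<in> S" "u \<in> S"
    "u \<otimes> (a \<otimes> s' \<ominus> a' \<otimes> s) = \<zero>" using some_in_frac[OF assms(1,3)] .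
  obtain b' t' v where 2: "(SOME p. p \<in> frac R S b t) = (b', t')" "b' \<in> carrier R" "t' \<in> S" "v \<in> S"
    "v \<otimes> (b \<otimes> t' \<ominus> b' \<otimes> t) = \<zero>" using some_in_frac[OF assms(2,4)] .
  have c: "s \<in> carrier R" "t \<in> carrier R" "s' \<in> carrier R" "t' \<in> carrier R" "u \<in> carrier R" "v \<in> carrier R"
    using assms 1 2 by auto
  have "(u \<otimes> v) \<otimes> ((a' \<otimes> t' \<oplus> b' \<otimes> s') \<otimes> (s \<otimes> t) \<ominus> (a \<otimes> t \<oplus> b \<otimes> s) \<otimes> (s' \<otimes> t')) =
    \<ominus> ((v \<otimes> (t \<otimes> t')) \<otimes> (u \<otimes> (a \<otimes> s' \<ominus> a' \<otimes> s)) \<oplus> (u \<otimes> (s \<otimes> s')) \<otimes> (v \<otimes> (b \<otimes> t' \<ominus> b' \<otimes> t)))"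
    using assms(1,2) 1(2) 2(2) c by algebra
  then have "(u \<otimes> v) \<otimes> ((a' \<otimes> t' \<oplus> b' \<otimes> s') \<otimes> (s \<otimes> t) \<ominus> (a \<otimes> t \<oplus> b \<otimes> s) \<otimes> (s' \<otimes> t')) = \<zero>"
    using 1 2 assms c by simp
  then have "frac R S (a' \<otimes> t' \<oplus> b' \<otimes> s') (s' \<otimes> t') = frac R S (a \<otimes> t \<oplus> b \<otimes> s) (s \<otimes> t)"
    using 1 2 assms S_mult c
    by (intro frac_eqI[where u = "u \<otimes> v"]) (blast intro: a_closed m_closed)+
  then show ?thesis by (simp add: localize_at_def localization_def 1(1) 2(1))
qed

lemma frac_one_ring_hom: "(\<lambda>a. frac R S a \<one>) \<in> ring_hom R (localize_at R P)"
  using one_notin_P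
  by (intro ring_hom_memI) (auto simp: frac_mult frac_add, auto simp: localize_at_def localization_def)

lemma frac_one_eq_zero:
  assumes "a \<in> carrier R" "s \<in> S" "s \<otimes> a = \<zero>"
  shows "frac R S a \<one> = \<zero>\<^bsub>localize_at R P\<^esub>"
proof -
  have "frac R S a \<one> = frac R S \<zero> \<one>"
    by (rule frac_eqI[where u = s]) (use assms one_notin_P in \<open>auto simp: a_minus_zero\<close>)
  then show ?thesis by (simp add: localize_at_def localization_def)
qed

lemma frac_denominator:
  assumes "x \<in> carrier (localize_at R P)"
  shows "\<exists>t\<in>S. \<exists>c\<in>carrier R. frac R S t \<one> \<otimes>\<^bsub>localize_at R P\<^esub> x = frac R S c \<one>"
proof -
  obtain c t where x: "x = frac R S c t" "c \<in> carrier R" "t \<in> S"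
    using assms by (auto simp: localize_at_def localization_def)
  have t: "t \<in> carrier R" using x by simp
  have "frac R S t \<one> \<otimes>\<^bsub>localize_at R P\<^esub> x = frac R S (t \<otimes> c) t"
    using x one_notin_P by (simp add: frac_mult)
  also have "\<dots> = frac R S c \<one>"
    by (rule frac_eqI[where u = \<one>]) (use x one_notin_P in \<open>auto simp: m_comm minus_eq r_neg\<close>)
  finally show ?thesis using x by blast
qed

text \<open>The inverse is sought in R: t u = 1 + q with q in P. In the localization -q is
  nilpotent, because some v outside P has v (-q) in pR and s kills p^n. The geometric series then
  gives y with (1 + q) y = 1 - (-q)^n, so w = y t is mapped to an inverse of u.\<close>

lemma localization_unit:
  assumes L: "cring (localize_at R P)"
    and princ: "\<And>a. a \<in> P \<Longrightarrow> \<exists>t\<in>S. \<exists>c\<in>carrier R. t \<otimes> a = p \<otimes> c"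
    and p: "p \<in> P" and s: "s \<in> S" "s \<otimes> p [^] (n::nat) = \<zero>"
    and u: "u \<in> carrier R" "u \<notin> P"
  shows "\<exists>w\<in>carrier R. frac R S (w \<otimes> u) \<one> = \<one>\<^bsub>localize_at R P\<^esub>"
proof -
  interpret L: cring "localize_at R P" by fact
  interpret \<phi>: ring_hom_cring R "localize_at R P" "\<lambda>a. frac R S a \<one>"
    by (intro ring_hom_cring.intro ring_hom_cring_axioms.intro frac_one_ring_hom is_cring L)
  obtain t q where t: "t \<in> carrier R" "q \<in> P" "t \<otimes> u = \<one> \<oplus> q"
    using inverse_mod_P[OF u] by blast
  have q: "q \<in> carrier R" "\<ominus> q \<in> P" using t by auto
  obtain v c where v: "v \<in> S" and c: "c \<in> carrier R" "v \<otimes> \<ominus> q = p \<otimes> c" using princ[OF q(2)] by blast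
  have vR: "v \<in> carrier R" and sR: "s \<in> carrier R" and pR: "p \<in> carrier R" using v s p by auto
  have vn: "v [^] n \<in> S"
    by (induction n) (use one_notin_P v S_mult in auto)
  have "(s \<otimes> v [^] n) \<otimes> (\<ominus> q) [^] n = s \<otimes> (v \<otimes> \<ominus> q) [^] n"
    using vR sR q by (simp add: nat_pow_distrib m_assoc)
  also have "\<dots> = (s \<otimes> p [^] n) \<otimes> c [^] n"
    unfolding c(2) using pR c sR by (simp add: nat_pow_distrib m_assoc)
  finally have "(s \<otimes> v [^] n) \<otimes> (\<ominus> q) [^] n = \<zero>" using s c by simp
  then have 1: "frac R S ((\<ominus> q) [^] n) \<one> = \<zero>\<^bsub>localize_at R P\<^esub>"
    using frac_one_eq_zero[OF _ S_mult[OF s(1) vn]] q by simp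
  obtain y where y: "y \<in> carrier R" "(\<one> \<oplus> q) \<otimes> y = \<one> \<ominus> (\<ominus> q) [^] n"
    using one_plus_dvd[OF q(1)] by blast
  have "(y \<otimes> t) \<otimes> u = (t \<otimes> u) \<otimes> y" using y(1) t(1) u(1) by (simp add: m_ac)
  then have "(y \<otimes> t) \<otimes> u = \<one> \<oplus> \<ominus> ((\<ominus> q) [^] n)" using t(3) y(2) by (simp add: minus_eq)
  then have "frac R S ((y \<otimes> t) \<otimes> u) \<one> = \<one>\<^bsub>localize_at R P\<^esub>"
    using q 1 by simp
  then show ?thesis using y t by blast
qed

end

theorem theorem3p4:
  fixes R :: "'r ring" and P :: "'r set"
  assumes cring: "cring R"
    and hyp: "\<forall>(B :: ('r, ('r + 'e + 'a + 'b) list set set) module) A.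
                module R B \<and> submodule A R B \<and> RD_essential R A B \<longrightarrow> essential R A B"
    and max: "maximalideal P R"
  shows "\<forall>(E :: (('r \<times> 'r) set, 'e) module) (A :: (('r \<times> 'r) set, 'a) module)
            (B :: (('r \<times> 'r) set, 'b) module) f.
           pure_injective_along (localize_at R P) E A B f"
proof (intro allI)
  fix E :: "(('r \<times> 'r) set, 'e) module" and A :: "(('r \<times> 'r) set, 'a) module"
    and B :: "(('r \<times> 'r) set, 'b) module" and f
  interpret cring_maximal R P by (rule cring_maximal.intro[OF cring max])
  let ?L = "localize_at R P"
  \<comment> \<open>Two encodings into the type beneath the outermost \<open>set\<close> of the
    hypothesis, that layer being reserved for cosets: one for sets of lists over R, the other for
    pairs from B \<oplus> E in the pushout.\<close>
  let ?\<iota> = "(`) (map Inl) :: 'r list set \<Rightarrow> ('r + 'e + 'a + 'b) list set"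
  let ?j = "\<lambda>x. {[Inr (Inr (Inr (fst x))), Inr (Inl (snd x))]} :: ('r + 'e + 'a + 'b) list set"
  have \<iota>: "inj ?\<iota>" by (rule injI) (simp add: inj_image_eq_iff[OF inj_mapI[OF inj_Inl]])
  have j: "inj (?j :: 'b \<times> 'e \<Rightarrow> _)" by (auto intro!: injI)
  obtain p n s where p: "p \<in> P"
    and princ: "\<And>a. a \<in> P \<Longrightarrow> \<exists>t\<in>carrier R - P. \<exists>c\<in>carrier R. t \<otimes>\<^bsub>R\<^esub> a = p \<otimes>\<^bsub>R\<^esub> c"
    and s: "s \<in> carrier R - P" "s \<otimes>\<^bsub>R\<^esub> p [^]\<^bsub>R\<^esub> (n::nat) = \<zero>\<^bsub>R\<^esub>"
    using locally_principal_nilpotent[OF hyp \<iota>] by metis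
  show "pure_injective_along ?L E A B f"
    unfolding pure_injective_along_def
  proof (intro impI ballI)
    fix g assume "module ?L E \<and> module ?L A \<and> module ?L B \<and> pure_mono ?L A B f"
      and g: "g \<in> module_hom ?L A E"
    then have E: "module ?L E" and A: "module ?L A" and B: "module ?L B" and f: "pure_mono ?L A B f"
      by auto
    \<comment> \<open>The ring axioms of the localization are supplied by the presence of a module
      over it.\<close>
    have L: "cring ?L" using E by (rule module.axioms(1))
    have nil: "frac R S (p [^]\<^bsub>R\<^esub> n) \<one>\<^bsub>R\<^esub> = \<zero>\<^bsub>?L\<^esub>"
      using frac_one_eq_zero[OF _ s] p by simp
    show "\<exists>h\<in>module_hom ?L B E. \<forall>a\<in>carrier A. h (f a) = g a"
      by (rule pure_hom_extension[OF hyp j frac_one_ring_hom localization_unit[OF L princ p s]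
            frac_denominator p princ nil E A B f g])
  qed
qed

end
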